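(* Let $(M,L,\psi)$ be a weighted Finsler spacetime of dimension $n+1\ge2$, and let $N\in(-\infty,0)\cup[n,+\infty]$. Suppose that the timelike genericity condition holds and that the timelike $N$-convergence condition holds, i.e. $\mathrm{Ric}_N(v)\ge0$ for all future-directed timelike vectors $v$. Then every future-directed inextendible timelike geodesic either includes a pair of conjugate points or is $\epsilon$-incomplete for any $\epsilon\in\mathbb{R}$ with $|\epsilon|<\sqrt{\frac{N}{N-n}}$ (the bound is read as $1$ for $N=+\infty$, and as no restriction on $\epsilon$ for $N=n$).
   Context: **Lorentz–Finsler setting.** $M$ is a connected $C^\infty$-manifold without boundary of dimension $n+1$. A Lorentz–Finsler structure is a function $L:TM\to\mathbb{R}$ such that $L\in C^\infty(TM\setminus\{0\})$; $L(cv)=c^2L(v)$ for all $v\in TM$, $c>0$; and for every $v\in TM\setminus\{0\}$ the matrix $g_{\alpha\beta}(v)=\frac{\partial^2 L}{\partial v^\alpha\partial v^\beta}(v)$, $\alpha,\beta=0,\dots,n$, is non-degenerate of signature $(-,+,\dots,+)$. It defines a Lorentzian inner product $g_v$ on $T_xM$ (for $v\in T_xM\setminus\{0\}$), with $g_v(v,v)=2L(v)$. A vector $v$ is timelike if $L(v)<0$, lightlike if $L(v)=0$ and $v\ne 0$, causal if timelike or lightlike. A Finsler spacetime is such an $(M,L)$ time-oriented by a smooth vector field $X$ with $L(X(x))<0$ for all $x$. A causal $v\in T_xM$ is future-directed if it lies in the same connected component of $\overline{\Omega'_x}\setminus\{0\}$ as $X(x)$, where $\Omega'_x=\{v\in T_xM: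 L(v)<0\}$. $\Omega_x$ is the set of future-directed timelike vectors, $\overline\Omega=\bigcup_x\overline\Omega_x$. $F(v)=\sqrt{-2L(v)}$ on causal vectors; timelike geodesics are parametrized with unit speed, $F(\dot\eta)\equiv1$. A causal curve $\eta:(a,b)\to M$ is inextendible if $\eta(t)$ converges neither as $t\to a$ nor as $t\to b$. **Connection and curvature.** With $(g^{\alpha\beta}(v))$ the inverse matrix, set $\widetilde\Gamma^\alpha_{\beta\gamma}(v)=\frac12\sum_\delta g^{\alpha\delta}(v)\big(\frac{\partial g_{\delta\gamma}}{\partial x^\beta}+\frac{\partial g_{\beta\delta}}{\partial x^\gamma}-\frac{\partial g_{\beta\gamma}}{\partial x^\delta}\big)(v)$, $G^\alpha(v)=\frac12\sum_{\beta,\gamma}\widetilde\Gamma^\alpha_{\beta\gamma}(v)v^\beta v^\gamma$, $N^\alpha_\beta(v)=\frac{\partial G^\alpha}{\partial v^\beta}(v)$, and $\Gamma^\alpha_{\beta\gamma}(v)=\widetilde\Gamma^\alpha_{\beta\gamma}(v)-\frac12\sum_{\delta,\mu}g^{\alpha\delta}(v)\big(\frac{\partial g_{\delta\gamma}}{\partial v^\mu}N^\mu_\beta+\frac{\partial g_{\beta\delta}}{\partial v^\mu}N^\mu_\gamma-\frac{\partial g_{\beta\gamma}}{\partial v^\mu}N^\mu_\delta\big)(v)$. Along a curve $\eta$, the covariant derivative $D^{\dot\eta}_{\dot\eta}Y$ has components $\dot Y^\alpha+\sum\Gamma^\alpha_{\beta\gamma}(\dot\eta)\dot\eta^\beta Y^\gamma$.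 A causal geodesic is a smooth causal curve with $\ddot\eta^\alpha+2G^\alpha(\dot\eta)=0$. Put $R^\alpha_\beta(v)=2\frac{\partial G^\alpha}{\partial x^\beta}-\sum_\gamma\big(\frac{\partial N^\alpha_\beta}{\partial x^\gamma}v^\gamma-2\frac{\partial N^\alpha_\beta}{\partial v^\gamma}G^\gamma\big)-\sum_\gamma N^\alpha_\gamma N^\gamma_\beta$ (all at $v$), $R_v(w)=\sum R^\alpha_\beta(v)w^\beta\frac{\partial}{\partial x^\alpha}$ and $\mathrm{Ric}(v)=\mathrm{trace}(R_v)$. A Jacobi field along a causal geodesic $\eta$ is a solution of $D^{\dot\eta}_{\dot\eta}D^{\dot\eta}_{\dot\eta}Y+R_{\dot\eta}(Y)=0$. $\eta$ has a pair of conjugate points if there are parameters $t_1<t_2$ and a nontrivial Jacobi field $Y$ along $\eta$ with $Y(t_1)=Y(t_2)=0$. **Weight.** $\psi:\overline\Omega\setminus\{0\}\to\mathbb{R}$ is $C^\infty$ with $\psi(cv)=\psi(v)$ for $c>0$. For a causal geodesic $\eta$, $\psi_\eta(t)=\psi(\dot\eta(t))$. For $v\in\overline\Omega\setminus\{0\}$ and the geodesic $\eta$ with $\dot\eta(0)=v$: $\mathrm{Ric}_N(v)=\mathrm{Ric}(v)+\psi_\eta''(0)-\frac{\psi_\eta'(0)^2}{N-n}$ for $N\in\mathbb{R}\setminus\{n\}$; $\mathrm{Ric}_\infty(v)=\mathrm{Ric}(v)+\psi_\eta''(0)$; $\mathrm{Ric}_n(v)=\mathrm{Ric}(v)+\psi_\eta''(0)$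 if $\psi_\eta'(0)=0$ and $-\infty$ otherwise. **Timelike genericity.** For a unit-speed timelike geodesic $\eta$, $N_\eta(t)$ is the $g_{\dot\eta(t)}$-orthogonal complement of $\dot\eta(t)$ and $\mathsf{R}(t)=R_{\dot\eta(t)}:N_\eta(t)\to N_\eta(t)$. The timelike genericity condition: for every inextendible unit-speed timelike geodesic $\eta:(a,b)\to M$ there is $t_1\in(a,b)$ with $\mathsf{R}(t_1)\ne0$. **$\epsilon$-completeness.** $\tau_\epsilon=\int e^{\frac{2(\epsilon-1)}{n}\psi_\eta(t)}dt$. An inextendible timelike geodesic $\eta:(a,b)\to M$ is future $\epsilon$-complete if $\lim_{t\to b}\tau_\epsilon(t)=+\infty$, past $\epsilon$-complete if $\lim_{t\to a}\tau_\epsilon(t)=-\infty$, and $\epsilon$-incomplete if at least one of these fails. *)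

theory Defs
  imports "HOL-Analysis.Analysis"
begin

section \<open>Smoothness\<close>

text \<open>For open \<open>S\<close>: all partial derivatives up to order \<open>k\<close> exist and are continuous on \<open>S\<close>.\<close>

primrec Ck_on :: "nat \<Rightarrow> 'a::euclidean_space set \<Rightarrow> ('a \<Rightarrow> 'b::real_normed_vector) \<Rightarrow> bool" where
  "Ck_on 0 S f \<longleftrightarrow> continuous_on S f"
| "Ck_on (Suc k) S f \<longleftrightarrow> (\<forall>x\<in>S. f differentiable (at x)) \<and>
     (\<forall>i\<in>Basis. Ck_on k S (\<lambda>x. frechet_derivative f (at x) i))"

text \<open>On an arbitrary set, smooth means locally the restriction of a smooth function on an open
  set (the weight below lives on a set with boundary); on open sets this is \<open>\<forall>k. Ck_on k S f\<close>.\<close>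

definition smooth_on :: "'a::euclidean_space set \<Rightarrow> ('a \<Rightarrow> 'b::real_normed_vector) \<Rightarrow> bool" where
  "smooth_on S f \<longleftrightarrow> (\<forall>x\<in>S. \<exists>W g. open W \<and> x \<in> W \<and> (\<forall>k. Ck_on k W g) \<and> (\<forall>y\<in>S \<inter> W. f y = g y))"


section \<open>Manifolds and tangent vectors\<close>

text \<open>A chart is its domain together with its coordinate map. The values of the coordinate map
  outside the domain are irrelevant.\<close>

type_synonym ('m, 'n) chart = "'m set \<times> ('m \<Rightarrow> real ^ 'n)"

abbreviation dom_chart :: "('m, 'n) chart \<Rightarrow> 'm set" where
  "dom_chart \<equiv> fst"

abbreviation chart_map :: "('m, 'n) chart \<Rightarrow> 'm \<Rightarrow> real ^ 'n" where
  "chart_map \<equiv> snd"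

abbreviation chart_img :: "('m, 'n) chart \<Rightarrow> (real ^ 'n) set" where
  "chart_img c \<equiv> chart_map c ` dom_chart c"

abbreviation chart_inv :: "('m, 'n) chart \<Rightarrow> real ^ 'n \<Rightarrow> 'm" where
  "chart_inv c \<equiv> inv_into (dom_chart c) (chart_map c)"

definition transition :: "('m, 'n) chart \<Rightarrow> ('m, 'n) chart \<Rightarrow> real ^ 'n \<Rightarrow> real ^ 'n" where
  "transition c d = chart_map d \<circ> chart_inv c"

definition smooth_atlas ::
  "('m::{t2_space, second_countable_topology}, 'n::finite) chart set \<Rightarrow> bool" where
  "smooth_atlas A \<longleftrightarrow>
     (\<Union>c\<in>A. dom_chart c) = UNIV \<and>
     (\<forall>c\<in>A. open (dom_chart c) \<and> open (chart_img c) \<and>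
        homeomorphism (dom_chart c) (chart_img c) (chart_map c) (chart_inv c)) \<and>
     (\<forall>c\<in>A. \<forall>d\<in>A. smooth_on (chart_map c ` (dom_chart c \<inter> dom_chart d)) (transition c d))"

text \<open>A tangent vector at \<open>x\<close> is the family of its components in the charts around \<open>x\<close>, related by
  the Jacobians of the coordinate changes; the entry of a chart not around \<open>x\<close> is \<open>0\<close>.\<close>

type_synonym ('m, 'n) tvec = "('m, 'n) chart \<Rightarrow> real ^ 'n"

definition tangent_space :: "('m, 'n::finite) chart set \<Rightarrow> 'm \<Rightarrow> ('m, 'n) tvec set" where
  "tangent_space A x = {v.
     (\<forall>c. \<not> (c \<in> A \<and> x \<in> dom_chart c) \<longrightarrow> v c = 0) \<and>
     (\<forall>c\<in>A. \<forall>d\<in>A. x \<in> dom_chart c \<inter> dom_chart d \<longrightarrow>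
        v d = frechet_derivative (transition c d) (at (chart_map c x)) (v c))}"

text \<open>The tangent vector at \<open>x\<close> with components \<open>u\<close> in the chart \<open>c\<close>.\<close>

definition tangent_vec ::
  "('m, 'n::finite) chart set \<Rightarrow> ('m, 'n) chart \<Rightarrow> 'm \<Rightarrow> real ^ 'n \<Rightarrow> ('m, 'n) tvec" where
  "tangent_vec A c x u = (\<lambda>d. if d \<in> A \<and> x \<in> dom_chart d
     then frechet_derivative (transition c d) (at (chart_map c x)) u else 0)"

text \<open>Functions on (a subset of) the tangent bundle are curried; \<open>local_rep A f c\<close> is \<open>f\<close> in the
  coordinates \<open>(x, v)\<close> of the tangent bundle induced by the chart \<open>c\<close>.\<close>

definition local_rep :: "('m, 'n::finite) chart set \<Rightarrow> ('m \<Rightarrow> ('m, 'n) tvec \<Rightarrow> real) \<Rightarrow>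
    ('m, 'n) chart \<Rightarrow> (real ^ 'n) \<times> (real ^ 'n) \<Rightarrow> real" where
  "local_rep A f c = (\<lambda>(y, u). f (chart_inv c y) (tangent_vec A c (chart_inv c y) u))"

text \<open>Some chart around \<open>x\<close>. It is only used to evaluate tensors, whose values do not depend on
  the chart.\<close>

definition chart_at :: "('m, 'n) chart set \<Rightarrow> 'm \<Rightarrow> ('m, 'n) chart" where
  "chart_at A x = (SOME c. c \<in> A \<and> x \<in> dom_chart c)"

definition smooth_vector_field ::
  "('m, 'n::finite) chart set \<Rightarrow> ('m \<Rightarrow> ('m, 'n) tvec) \<Rightarrow> bool" where
  "smooth_vector_field A X \<longleftrightarrow> (\<forall>x. X x \<in> tangent_space A x) \<and>
     (\<forall>c\<in>A. smooth_on (chart_img c) (\<lambda>y. X (chart_inv c y) c))"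

definition velocity :: "('m, 'n::finite) chart set \<Rightarrow> (real \<Rightarrow> 'm) \<Rightarrow> real \<Rightarrow> ('m, 'n) tvec" where
  "velocity A \<eta> t = (\<lambda>c. if c \<in> A \<and> \<eta> t \<in> dom_chart c
     then vector_derivative (\<lambda>s. chart_map c (\<eta> s)) (at t) else 0)"

definition smooth_curve ::
  "('m::topological_space, 'n::finite) chart set \<Rightarrow> real set \<Rightarrow> (real \<Rightarrow> 'm) \<Rightarrow> bool" where
  "smooth_curve A I \<eta> \<longleftrightarrow> continuous_on I \<eta> \<and>
     (\<forall>c\<in>A. smooth_on {t\<in>I. \<eta> t \<in> dom_chart c} (\<lambda>t. chart_map c (\<eta> t)))"


section \<open>Connection and curvature in coordinates\<close>

text \<open>Here \<open>l\<close> is a function of the coordinates \<open>z = (x, v)\<close> of the tangent bundle.\<close>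

definition dx :: "'n \<Rightarrow> ((real ^ 'n::finite) \<times> (real ^ 'n) \<Rightarrow> real) \<Rightarrow> (real ^ 'n) \<times> (real ^ 'n) \<Rightarrow> real" where
  "dx \<alpha> h z = frechet_derivative h (at z) (axis \<alpha> 1, 0)"

definition dv :: "'n \<Rightarrow> ((real ^ 'n::finite) \<times> (real ^ 'n) \<Rightarrow> real) \<Rightarrow> (real ^ 'n) \<times> (real ^ 'n) \<Rightarrow> real" where
  "dv \<alpha> h z = frechet_derivative h (at z) (0, axis \<alpha> 1)"

definition g_mat :: "((real ^ 'n::finite) \<times> (real ^ 'n) \<Rightarrow> real) \<Rightarrow> (real ^ 'n) \<times> (real ^ 'n) \<Rightarrow> real ^ 'n ^ 'n" where
  "g_mat l z = (\<chi> \<alpha> \<beta>. dv \<alpha> (dv \<beta> l) z)"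

abbreviation g_low :: "((real ^ 'n::finite) \<times> (real ^ 'n) \<Rightarrow> real) \<Rightarrow> 'n \<Rightarrow> 'n \<Rightarrow> (real ^ 'n) \<times> (real ^ 'n) \<Rightarrow> real" where
  "g_low l \<alpha> \<beta> \<equiv> (\<lambda>z. g_mat l z $ \<alpha> $ \<beta>)"

abbreviation g_up :: "((real ^ 'n::finite) \<times> (real ^ 'n) \<Rightarrow> real) \<Rightarrow> 'n \<Rightarrow> 'n \<Rightarrow> (real ^ 'n) \<times> (real ^ 'n) \<Rightarrow> real" where
  "g_up l \<alpha> \<beta> \<equiv> (\<lambda>z. matrix_inv (g_mat l z) $ \<alpha> $ \<beta>)"

definition Gamma_tilde ::
  "((real ^ 'n::finite) \<times> (real ^ 'n) \<Rightarrow> real) \<Rightarrow> 'n \<Rightarrow> 'n \<Rightarrow> 'n \<Rightarrow> (real ^ 'n) \<times> (real ^ 'n) \<Rightarrow> real" where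
  "Gamma_tilde l \<alpha> \<beta> \<gamma> z = 1 / 2 * (\<Sum>\<delta>\<in>UNIV. g_up l \<alpha> \<delta> z *
     (dx \<beta> (g_low l \<delta> \<gamma>) z + dx \<gamma> (g_low l \<beta> \<delta>) z - dx \<delta> (g_low l \<beta> \<gamma>) z))"

definition spray :: "((real ^ 'n::finite) \<times> (real ^ 'n) \<Rightarrow> real) \<Rightarrow> (real ^ 'n) \<times> (real ^ 'n) \<Rightarrow> real ^ 'n" where
  "spray l z = (\<chi> \<alpha>. 1 / 2 * (\<Sum>\<beta>\<in>UNIV. \<Sum>\<gamma>\<in>UNIV. Gamma_tilde l \<alpha> \<beta> \<gamma> z * (snd z $ \<beta>) * (snd z $ \<gamma>)))"

definition N_conn ::
  "((real ^ 'n::finite) \<times> (real ^ 'n) \<Rightarrow> real) \<Rightarrow> 'n \<Rightarrow> 'n \<Rightarrow> (real ^ 'n) \<times> (real ^ 'n) \<Rightarrow> real" where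
  "N_conn l \<alpha> \<beta> z = dv \<beta> (\<lambda>z. spray l z $ \<alpha>) z"

definition Gamma ::
  "((real ^ 'n::finite) \<times> (real ^ 'n) \<Rightarrow> real) \<Rightarrow> 'n \<Rightarrow> 'n \<Rightarrow> 'n \<Rightarrow> (real ^ 'n) \<times> (real ^ 'n) \<Rightarrow> real" where
  "Gamma l \<alpha> \<beta> \<gamma> z = Gamma_tilde l \<alpha> \<beta> \<gamma> z - 1 / 2 * (\<Sum>\<delta>\<in>UNIV. \<Sum>\<mu>\<in>UNIV. g_up l \<alpha> \<delta> z *
     (dv \<mu> (g_low l \<delta> \<gamma>) z * N_conn l \<mu> \<beta> z + dv \<mu> (g_low l \<beta> \<delta>) z * N_conn l \<mu> \<gamma> z
      - dv \<mu> (g_low l \<beta> \<gamma>) z * N_conn l \<mu> \<delta> z))"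

definition R_mat :: "((real ^ 'n::finite) \<times> (real ^ 'n) \<Rightarrow> real) \<Rightarrow> (real ^ 'n) \<times> (real ^ 'n) \<Rightarrow> real ^ 'n ^ 'n" where
  "R_mat l z = (\<chi> \<alpha> \<beta>. 2 * dx \<beta> (\<lambda>z. spray l z $ \<alpha>) z
     - (\<Sum>\<gamma>\<in>UNIV. dx \<gamma> (N_conn l \<alpha> \<beta>) z * (snd z $ \<gamma>) - 2 * dv \<gamma> (N_conn l \<alpha> \<beta>) z * (spray l z $ \<gamma>))
     - (\<Sum>\<gamma>\<in>UNIV. N_conn l \<alpha> \<gamma> z * N_conn l \<gamma> \<beta> z))"


section \<open>Finsler spacetimes\<close>

definition lorentz_signature :: "real ^ 'n ^ 'n::finite \<Rightarrow> bool" where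
  "lorentz_signature B \<longleftrightarrow> (\<exists>(P :: real ^ 'n ^ 'n) i0. invertible P \<and>
     transpose P ** B ** P = (\<chi> i j. if i = j then if i = i0 then -1 else 1 else 0))"

definition lorentz_finsler ::
  "('m, 'n::finite) chart set \<Rightarrow> ('m \<Rightarrow> ('m, 'n) tvec \<Rightarrow> real) \<Rightarrow> bool" where
  "lorentz_finsler A L \<longleftrightarrow>
     (\<forall>c\<in>A. smooth_on (chart_img c \<times> - {0}) (local_rep A L c)) \<and>
     (\<forall>x. \<forall>v\<in>tangent_space A x. \<forall>k>0. L x (\<lambda>c. k *\<^sub>R v c) = k\<^sup>2 * L x v) \<and>
     (\<forall>c\<in>A. \<forall>x\<in>dom_chart c. \<forall>v\<in>tangent_space A x - {\<lambda>_. 0}.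
        lorentz_signature (g_mat (local_rep A L c) (chart_map c x, v c)))"

definition timelike :: "('m \<Rightarrow> ('m, 'n::finite) tvec \<Rightarrow> real) \<Rightarrow> 'm \<Rightarrow> ('m, 'n) tvec \<Rightarrow> bool" where
  "timelike L x v \<longleftrightarrow> L x v < 0"

definition lightlike :: "('m \<Rightarrow> ('m, 'n::finite) tvec \<Rightarrow> real) \<Rightarrow> 'm \<Rightarrow> ('m, 'n) tvec \<Rightarrow> bool" where
  "lightlike L x v \<longleftrightarrow> L x v = 0 \<and> v \<noteq> (\<lambda>_. 0)"

definition causal :: "('m \<Rightarrow> ('m, 'n::finite) tvec \<Rightarrow> real) \<Rightarrow> 'm \<Rightarrow> ('m, 'n) tvec \<Rightarrow> bool" where
  "causal L x v \<longleftrightarrow> timelike L x v \<or> lightlike L x v"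

definition finsler_F :: "('m \<Rightarrow> ('m, 'n::finite) tvec \<Rightarrow> real) \<Rightarrow> 'm \<Rightarrow> ('m, 'n) tvec \<Rightarrow> real" where
  "finsler_F L x v = sqrt (- 2 * L x v)"

text \<open>Closures and connected components in a tangent space are taken in the product topology on
  families of components. The tangent space is closed in it, and inherits the topology of any one
  of its coordinate isomorphisms with \<open>real ^ 'n\<close>.\<close>

definition future_directed :: "('m, 'n::finite) chart set \<Rightarrow> ('m \<Rightarrow> ('m, 'n) tvec \<Rightarrow> real) \<Rightarrow>
    ('m \<Rightarrow> ('m, 'n) tvec) \<Rightarrow> 'm \<Rightarrow> ('m, 'n) tvec \<Rightarrow> bool" where
  "future_directed A L X x v \<longleftrightarrow> v \<in> tangent_space A x \<and> causal L x v \<and>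
     connected_component (closure {w \<in> tangent_space A x. timelike L x w} - {\<lambda>_. 0}) (X x) v"

definition future_cone :: "('m, 'n::finite) chart set \<Rightarrow> ('m \<Rightarrow> ('m, 'n) tvec \<Rightarrow> real) \<Rightarrow>
    ('m \<Rightarrow> ('m, 'n) tvec) \<Rightarrow> 'm \<Rightarrow> ('m, 'n) tvec set" where
  "future_cone A L X x = {v. timelike L x v \<and> future_directed A L X x v}"

definition finsler_spacetime ::
  "('m::{t2_space, second_countable_topology}, 'n::finite) chart set \<Rightarrow>
    ('m \<Rightarrow> ('m, 'n) tvec \<Rightarrow> real) \<Rightarrow> ('m \<Rightarrow> ('m, 'n) tvec) \<Rightarrow> bool" where
  "finsler_spacetime A L X \<longleftrightarrow> smooth_atlas A \<and> connected (UNIV :: 'm set) \<and>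
     lorentz_finsler A L \<and> smooth_vector_field A X \<and> (\<forall>x. L x (X x) < 0)"

definition weight :: "('m, 'n::finite) chart set \<Rightarrow> ('m \<Rightarrow> ('m, 'n) tvec \<Rightarrow> real) \<Rightarrow>
    ('m \<Rightarrow> ('m, 'n) tvec) \<Rightarrow> ('m \<Rightarrow> ('m, 'n) tvec \<Rightarrow> real) \<Rightarrow> bool" where
  "weight A L X \<psi> \<longleftrightarrow>
     (\<forall>c\<in>A. smooth_on {(y, u). y \<in> chart_img c \<and> tangent_vec A c (chart_inv c y) u \<in>
        closure (future_cone A L X (chart_inv c y)) - {\<lambda>_. 0}} (local_rep A \<psi> c)) \<and>
     (\<forall>x. \<forall>v\<in>closure (future_cone A L X x) - {\<lambda>_. 0}. \<forall>k>0. \<psi> x (\<lambda>c. k *\<^sub>R v c) = \<psi> x v)"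

definition g_inner :: "('m, 'n::finite) chart set \<Rightarrow> ('m \<Rightarrow> ('m, 'n) tvec \<Rightarrow> real) \<Rightarrow>
    'm \<Rightarrow> ('m, 'n) tvec \<Rightarrow> ('m, 'n) tvec \<Rightarrow> ('m, 'n) tvec \<Rightarrow> real" where
  "g_inner A L x v w w' = (let c = chart_at A x in
     w c \<bullet> (g_mat (local_rep A L c) (chart_map c x, v c) *v w' c))"

definition R_op :: "('m, 'n::finite) chart set \<Rightarrow> ('m \<Rightarrow> ('m, 'n) tvec \<Rightarrow> real) \<Rightarrow>
    'm \<Rightarrow> ('m, 'n) tvec \<Rightarrow> ('m, 'n) tvec \<Rightarrow> ('m, 'n) tvec" where
  "R_op A L x v w = (let c = chart_at A x in
     tangent_vec A c x (R_mat (local_rep A L c) (chart_map c x, v c) *v w c))"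

definition Ric :: "('m, 'n::finite) chart set \<Rightarrow> ('m \<Rightarrow> ('m, 'n) tvec \<Rightarrow> real) \<Rightarrow>
    'm \<Rightarrow> ('m, 'n) tvec \<Rightarrow> real" where
  "Ric A L x v = (let c = chart_at A x in trace (R_mat (local_rep A L c) (chart_map c x, v c)))"


section \<open>Geodesics and Jacobi fields\<close>

text \<open>Curves are defined on the open interval \<open>einterval a b\<close>, whose ends may be infinite. Limits at
  an end \<open>b\<close> are limits of \<open>f \<circ> real_of_ereal\<close> along \<open>at_left b\<close> in the extended reals.\<close>

definition causal_geodesic :: "('m::topological_space, 'n::finite) chart set \<Rightarrow>
    ('m \<Rightarrow> ('m, 'n) tvec \<Rightarrow> real) \<Rightarrow> ereal \<Rightarrow> ereal \<Rightarrow> (real \<Rightarrow> 'm) \<Rightarrow> bool" where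
  "causal_geodesic A L a b \<eta> \<longleftrightarrow> a < b \<and> smooth_curve A (einterval a b) \<eta> \<and>
     (\<forall>t\<in>einterval a b. causal L (\<eta> t) (velocity A \<eta> t)) \<and>
     (\<forall>t\<in>einterval a b. \<forall>c\<in>A. \<eta> t \<in> dom_chart c \<longrightarrow>
        ((\<lambda>s. velocity A \<eta> s c) has_vector_derivative
           - 2 *\<^sub>R spray (local_rep A L c) (chart_map c (\<eta> t), velocity A \<eta> t c)) (at t))"

definition timelike_geodesic :: "('m::topological_space, 'n::finite) chart set \<Rightarrow>
    ('m \<Rightarrow> ('m, 'n) tvec \<Rightarrow> real) \<Rightarrow> ereal \<Rightarrow> ereal \<Rightarrow> (real \<Rightarrow> 'm) \<Rightarrow> bool" where
  "timelike_geodesic A L a b \<eta> \<longleftrightarrow> causal_geodesic A L a b \<eta> \<and>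
     (\<forall>t\<in>einterval a b. timelike L (\<eta> t) (velocity A \<eta> t) \<and>
        finsler_F L (\<eta> t) (velocity A \<eta> t) = 1)"

definition inextendible :: "ereal \<Rightarrow> ereal \<Rightarrow> (real \<Rightarrow> 'm::topological_space) \<Rightarrow> bool" where
  "inextendible a b \<eta> \<longleftrightarrow>
     (\<nexists>p. ((\<eta> \<circ> real_of_ereal) \<longlongrightarrow> p) (at_right a)) \<and>
     (\<nexists>p. ((\<eta> \<circ> real_of_ereal) \<longlongrightarrow> p) (at_left b))"

text \<open>\<open>Z\<close> is the value at \<open>t\<close> of the covariant derivative, with reference vector the velocity of
  \<open>\<eta>\<close>, of the vector field \<open>Y\<close> along \<open>\<eta>\<close>.\<close>

definition has_covariant_derivative :: "('m, 'n::finite) chart set \<Rightarrow>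
    ('m \<Rightarrow> ('m, 'n) tvec \<Rightarrow> real) \<Rightarrow> (real \<Rightarrow> 'm) \<Rightarrow> (real \<Rightarrow> ('m, 'n) tvec) \<Rightarrow>
    ('m, 'n) tvec \<Rightarrow> real \<Rightarrow> bool" where
  "has_covariant_derivative A L \<eta> Y Z t \<longleftrightarrow> Z \<in> tangent_space A (\<eta> t) \<and>
     (\<forall>c\<in>A. \<eta> t \<in> dom_chart c \<longrightarrow>
       ((\<lambda>s. Y s c) has_vector_derivative
          Z c - (\<chi> \<alpha>. \<Sum>\<beta>\<in>UNIV. \<Sum>\<gamma>\<in>UNIV.
            Gamma (local_rep A L c) \<alpha> \<beta> \<gamma> (chart_map c (\<eta> t), velocity A \<eta> t c)
              * (velocity A \<eta> t c $ \<beta>) * (Y t c $ \<gamma>))) (at t))"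

definition jacobi_field :: "('m, 'n::finite) chart set \<Rightarrow> ('m \<Rightarrow> ('m, 'n) tvec \<Rightarrow> real) \<Rightarrow>
    ereal \<Rightarrow> ereal \<Rightarrow> (real \<Rightarrow> 'm) \<Rightarrow> (real \<Rightarrow> ('m, 'n) tvec) \<Rightarrow> bool" where
  "jacobi_field A L a b \<eta> Y \<longleftrightarrow> (\<forall>t\<in>einterval a b. Y t \<in> tangent_space A (\<eta> t)) \<and>
     (\<exists>Z. \<forall>t\<in>einterval a b. has_covariant_derivative A L \<eta> Y (Z t) t \<and>
        has_covariant_derivative A L \<eta> Z (\<lambda>c. - R_op A L (\<eta> t) (velocity A \<eta> t) (Y t) c) t)"

definition has_conjugate_points :: "('m, 'n::finite) chart set \<Rightarrow>
    ('m \<Rightarrow> ('m, 'n) tvec \<Rightarrow> real) \<Rightarrow> ereal \<Rightarrow> ereal \<Rightarrow> (real \<Rightarrow> 'm) \<Rightarrow> bool" where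
  "has_conjugate_points A L a b \<eta> \<longleftrightarrow>
     (\<exists>t1\<in>einterval a b. \<exists>t2\<in>einterval a b. \<exists>Y. t1 < t2 \<and> jacobi_field A L a b \<eta> Y \<and>
        (\<exists>t\<in>einterval a b. Y t \<noteq> (\<lambda>_. 0)) \<and> Y t1 = (\<lambda>_. 0) \<and> Y t2 = (\<lambda>_. 0))"


section \<open>Weighted Ricci curvature, genericity and completeness\<close>

definition psi_along :: "('m, 'n::finite) chart set \<Rightarrow> ('m \<Rightarrow> ('m, 'n) tvec \<Rightarrow> real) \<Rightarrow>
    (real \<Rightarrow> 'm) \<Rightarrow> real \<Rightarrow> real" where
  "psi_along A \<psi> \<eta> t = \<psi> (\<eta> t) (velocity A \<eta> t)"

text \<open>The causal geodesic with initial velocity \<open>v\<close> at \<open>x\<close>, unique as a germ at \<open>0\<close>.\<close>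

definition geodesic_from :: "('m::topological_space, 'n::finite) chart set \<Rightarrow>
    ('m \<Rightarrow> ('m, 'n) tvec \<Rightarrow> real) \<Rightarrow> 'm \<Rightarrow> ('m, 'n) tvec \<Rightarrow> real \<Rightarrow> 'm" where
  "geodesic_from A L x v = (SOME \<eta>. \<exists>a b. a < 0 \<and> 0 < b \<and> causal_geodesic A L a b \<eta> \<and>
     \<eta> 0 = x \<and> velocity A \<eta> 0 = v)"

text \<open>The manifold has dimension \<open>n + 1\<close>. The value at \<open>N = -\<infinity>\<close> is arbitrary and not used.\<close>

definition Ric_weighted :: "('m::topological_space, 'n::finite) chart set \<Rightarrow>
    ('m \<Rightarrow> ('m, 'n) tvec \<Rightarrow> real) \<Rightarrow> ('m \<Rightarrow> ('m, 'n) tvec \<Rightarrow> real) \<Rightarrow>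
    nat \<Rightarrow> ereal \<Rightarrow> 'm \<Rightarrow> ('m, 'n) tvec \<Rightarrow> ereal" where
  "Ric_weighted A L \<psi> n N x v =
    (let p = psi_along A \<psi> (geodesic_from A L x v); p1 = deriv p 0; p2 = deriv (deriv p) 0 in
       if N = \<infinity> then ereal (Ric A L x v + p2)
       else if N = ereal (real n) then (if p1 = 0 then ereal (Ric A L x v + p2) else -\<infinity>)
       else ereal (Ric A L x v + p2 - p1\<^sup>2 / (real_of_ereal N - real n)))"

definition timelike_convergence :: "('m::topological_space, 'n::finite) chart set \<Rightarrow>
    ('m \<Rightarrow> ('m, 'n) tvec \<Rightarrow> real) \<Rightarrow> ('m \<Rightarrow> ('m, 'n) tvec) \<Rightarrow> ('m \<Rightarrow> ('m, 'n) tvec \<Rightarrow> real) \<Rightarrow>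
    nat \<Rightarrow> ereal \<Rightarrow> bool" where
  "timelike_convergence A L X \<psi> n N \<longleftrightarrow>
     (\<forall>x. \<forall>v\<in>future_cone A L X x. 0 \<le> Ric_weighted A L \<psi> n N x v)"

definition normal_space :: "('m, 'n::finite) chart set \<Rightarrow> ('m \<Rightarrow> ('m, 'n) tvec \<Rightarrow> real) \<Rightarrow>
    (real \<Rightarrow> 'm) \<Rightarrow> real \<Rightarrow> ('m, 'n) tvec set" where
  "normal_space A L \<eta> t = {w \<in> tangent_space A (\<eta> t).
     g_inner A L (\<eta> t) (velocity A \<eta> t) (velocity A \<eta> t) w = 0}"

text \<open>No time orientation of the geodesic is required here.\<close>

definition timelike_genericity :: "('m::topological_space, 'n::finite) chart set \<Rightarrow>
    ('m \<Rightarrow> ('m, 'n) tvec \<Rightarrow> real) \<Rightarrow> bool" where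
  "timelike_genericity A L \<longleftrightarrow>
     (\<forall>a b \<eta>. timelike_geodesic A L a b \<eta> \<and> inextendible a b \<eta> \<longrightarrow>
        (\<exists>t1\<in>einterval a b. \<exists>w\<in>normal_space A L \<eta> t1.
           R_op A L (\<eta> t1) (velocity A \<eta> t1) w \<noteq> (\<lambda>_. 0)))"

text \<open>The indefinite integral \<open>\<tau>\<close>, normalised to vanish at \<open>t0\<close>; changing \<open>t0\<close> adds a constant.\<close>

definition tau :: "('m, 'n::finite) chart set \<Rightarrow> ('m \<Rightarrow> ('m, 'n) tvec \<Rightarrow> real) \<Rightarrow>
    nat \<Rightarrow> real \<Rightarrow> (real \<Rightarrow> 'm) \<Rightarrow> real \<Rightarrow> real \<Rightarrow> real" where
  "tau A \<psi> n \<epsilon> \<eta> t0 t =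
     (LBINT s=ereal t0..ereal t. exp (2 * (\<epsilon> - 1) / real n * psi_along A \<psi> \<eta> s))"

definition future_complete :: "('m, 'n::finite) chart set \<Rightarrow> ('m \<Rightarrow> ('m, 'n) tvec \<Rightarrow> real) \<Rightarrow>
    nat \<Rightarrow> real \<Rightarrow> ereal \<Rightarrow> ereal \<Rightarrow> (real \<Rightarrow> 'm) \<Rightarrow> bool" where
  "future_complete A \<psi> n \<epsilon> a b \<eta> \<longleftrightarrow> (\<forall>t0\<in>einterval a b.
     filterlim (tau A \<psi> n \<epsilon> \<eta> t0 \<circ> real_of_ereal) at_top (at_left b))"

definition past_complete :: "('m, 'n::finite) chart set \<Rightarrow> ('m \<Rightarrow> ('m, 'n) tvec \<Rightarrow> real) \<Rightarrow>
    nat \<Rightarrow> real \<Rightarrow> ereal \<Rightarrow> ereal \<Rightarrow> (real \<Rightarrow> 'm) \<Rightarrow> bool" where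
  "past_complete A \<psi> n \<epsilon> a b \<eta> \<longleftrightarrow> (\<forall>t0\<in>einterval a b.
     filterlim (tau A \<psi> n \<epsilon> \<eta> t0 \<circ> real_of_ereal) at_bot (at_right a))"

definition eps_incomplete :: "('m, 'n::finite) chart set \<Rightarrow> ('m \<Rightarrow> ('m, 'n) tvec \<Rightarrow> real) \<Rightarrow>
    nat \<Rightarrow> real \<Rightarrow> ereal \<Rightarrow> ereal \<Rightarrow> (real \<Rightarrow> 'm) \<Rightarrow> bool" where
  "eps_incomplete A \<psi> n \<epsilon> a b \<eta> \<longleftrightarrow>
     \<not> future_complete A \<psi> n \<epsilon> a b \<eta> \<or> \<not> past_complete A \<psi> n \<epsilon> a b \<eta>"

definition eps_range :: "nat \<Rightarrow> ereal \<Rightarrow> real set" where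
  "eps_range n N =
     (if N = \<infinity> then {\<epsilon>. \<bar>\<epsilon>\<bar> < 1}
      else if N = ereal (real n) then UNIV
      else {\<epsilon>. \<bar>\<epsilon>\<bar> < sqrt (real_of_ereal N / (real_of_ereal N - real n))})"

end

theory Submission
  imports Defs
begin

text \<open>Suppose that the geodesic is complete in the parameter \<open>\<tau>\<close> and has no conjugate points. In a
  parallel orthonormal frame, let \<open>A\<close> be the Jacobi tensor that vanishes at a parameter \<open>s\<close>. It is
  invertible after \<open>s\<close>, so \<open>B = A' A\<inverse>\<close> is a symmetric solution of \<open>B' = - B\<^sup>2 - R\<close> up to the future end.
  Let \<open>u = trace B - \<psi>'\<close> and \<open>U = exp (2 (1 - \<epsilon>) \<psi> / n) u\<close>. The curvature bound and \<open>\<epsilon>\<^sup>2 < \<kappa> = N / (N - n)\<close>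
  give \<open>dU/d\<tau> \<le> - k U\<^sup>2\<close> and \<open>|B|\<^sup>2 \<le> - K U'\<close> with positive constants \<open>k\<close>, \<open>K\<close> that do not depend on \<open>s\<close>
  (\<open>K\<close> on a fixed compact interval). Completeness yields \<open>0 \<le> U \<le> 1 / (k (\<tau> - \<tau>(s)))\<close>, so on a compact
  interval both \<open>U\<close> and the integral of \<open>|B|\<^sup>2\<close> tend to \<open>0\<close> as \<open>s\<close> tends to the past end. Integrating the
  Riccati equation against a bump function then shows \<open>R = 0\<close> along the geodesic, against genericity.
  No limit of Jacobi tensors is needed.

  The tensor calculus behind the frame reduces to the spray: the identities for \<open>g\<close>, \<open>N\<close> and \<open>R\<close>, their
  behaviour under changes of coordinates included, are derivatives of the Euler--Lagrange identity
  for \<open>G\<close> and of the transformation law of \<open>G\<close>.\<close>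

section \<open>Calculus of smooth functions\<close>

text \<open>The exponents fit together as follows. Put p = \<psi>', so trace B = u + p; for finite N
  \<noteq> n, (\<kappa> - 1) / n = 1 / (N - n). Cauchy-Schwarz, n |B|^2 \<ge> (u + p)^2, and the
  curvature bound give - n u' \<ge> u^2 + 2 p u + \<kappa> p^2. The derivative of the factor exp (2
  (1 - \<epsilon>) \<psi> / n) replaces 2 p u by 2 \<epsilon> p u, and u^2 + 2 \<epsilon> p u +
  \<kappa> p^2 is positive definite exactly when \<epsilon>^2 < \<kappa>. The two halves of
  completeness have different tasks: at the future end it excludes U < 0, since 1 / U would have to
  cross zero; at the past end it makes the upper bound for U small. The obstacle is that B blows up
  at s, so pointwise bounds on B are not at hand; the integral of |B|^2 over a compact interval is
  under control, being at most K times the decrease of U. The indefinite metric enters these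
  estimates through a Euclidean part only: the curvature kills the velocity and is symmetric on its
  orthogonal complement, of dimension n.\<close>

definition dd :: "'a::euclidean_space \<Rightarrow> ('a \<Rightarrow> 'b::real_normed_vector) \<Rightarrow> 'a \<Rightarrow> 'b" where
  "dd p f x = frechet_derivative f (at x) p"

lemma has_derivative_dd: "f differentiable (at x) \<Longrightarrow> (f has_derivative (\<lambda>p. dd p f x)) (at x)"
  unfolding dd_def using frechet_derivative_works by blast

lemma dd_eqI: "(f has_derivative f') (at x) \<Longrightarrow> dd p f x = f' p"
  unfolding dd_def by (metis frechet_derivative_at)

text \<open>\<open>frechet_derivative\<close> picks from the set of all derivatives at the point,
  and this set depends only on the germ of the function; so the equality holds at points of
  non-differentiability as well.\<close>

lemma dd_cong:
  assumes "open S" "x \<in> S" "\<And>y. y \<in> S \<Longrightarrow> f y = g y"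
  shows "dd p f x = dd p g x"
proof -
  have "(f has_derivative D) (at x) \<longleftrightarrow> (g has_derivative D) (at x)" for D
    using has_derivative_transform_within_open[OF _ assms(1,2)] assms(3) by metis
  then show ?thesis unfolding dd_def frechet_derivative_def by simp
qed

lemma differentiable_cong_open:
  assumes "open S" "x \<in> S" "\<And>y. y \<in> S \<Longrightarrow> f y = g y" "f differentiable (at x)"
  shows "g differentiable (at x)"
  using assms has_derivative_transform_within_open unfolding differentiable_def by metis

lemma Ck_on_Suc_dd:
  "Ck_on (Suc k) S f \<longleftrightarrow> (\<forall>x\<in>S. f differentiable (at x)) \<and> (\<forall>i\<in>Basis. Ck_on k S (dd i f))"
  by (simp add: dd_def[abs_def])

lemma Ck_on_cong:
  assumes "open S" "\<And>y. y \<in> S \<Longrightarrow> f y = g y" "Ck_on k S f"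
  shows "Ck_on k S g"
  using assms(2,3)
proof (induction k arbitrary: f g)
  case 0
  then show ?case by (simp cong: continuous_on_cong)
next
  case (Suc k)
  have "Ck_on k S (dd i g)" if "i \<in> Basis" for i
  proof (rule Suc.IH[of "dd i f"])
    show "dd i f y = dd i g y" if "y \<in> S" for y
      by (rule dd_cong[OF assms(1) that Suc.prems(1)])
    show "Ck_on k S (dd i f)" using Suc.prems(2) that by (simp add: Ck_on_Suc_dd del: Ck_on.simps)
  qed
  moreover have "g differentiable (at x)" if "x \<in> S" for x
    using differentiable_cong_open[OF assms(1) that Suc.prems(1)] Suc.prems(2) that by auto
  ultimately show ?case by (simp add: Ck_on_Suc_dd del: Ck_on.simps)
qed

lemma Ck_on_subset: "Ck_on k T f \<Longrightarrow> S \<subseteq> T \<Longrightarrow> Ck_on k S f"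
proof (induction k arbitrary: f)
  case 0
  then show ?case by (auto intro: continuous_on_subset)
next
  case (Suc k)
  then show ?case by (auto simp: subset_eq)
qed

text \<open>\<open>smooth_on\<close> supplies a different smooth witness near each point. Every
  clause of \<open>Ck_on\<close> is local, so the orders can be checked near one point at a
  time.\<close>

lemma Ck_on_local:
  assumes "\<And>x. x \<in> S \<Longrightarrow> \<exists>W. open W \<and> x \<in> W \<and> Ck_on k (S \<inter> W) f"
  shows "Ck_on k S f"
  using assms
proof (induction k arbitrary: f)
  case 0
  show ?case
    unfolding Ck_on.simps continuous_on_eq_continuous_within
  proof
    fix x assume "x \<in> S"
    then obtain W where W: "open W" "x \<in> W" "continuous_on (S \<inter> W) f" using 0 by auto
    then have "continuous (at x within S \<inter> W) f"
      using \<open>x \<in> S\<close> by (auto simp: continuous_on_eq_continuous_within)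
    then show "continuous (at x within S) f"
      using at_within_nhd[of x W "S \<inter> W" S] W(1,2) by (simp add: Int_assoc)
  qed
next
  case (Suc k)
  have "Ck_on k S (dd i f)" if "i \<in> Basis" for i
  proof (rule Suc.IH)
    fix x assume "x \<in> S"
    then obtain W where "open W" "x \<in> W" "Ck_on (Suc k) (S \<inter> W) f" using Suc.prems by blast
    then show "\<exists>W. open W \<and> x \<in> W \<and> Ck_on k (S \<inter> W) (dd i f)"
      using that by (auto simp: Ck_on_Suc_dd simp del: Ck_on.simps)
  qed
  moreover have "f differentiable (at x)" if x: "x \<in> S" for x
  proof -
    obtain W where "open W" "x \<in> W" "Ck_on (Suc k) (S \<inter> W) f" using Suc.prems[OF x] by blast
    then show ?thesis using x by simp
  qed
  ultimately show ?case by (simp add: Ck_on_Suc_dd del: Ck_on.simps)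
qed

lemma smooth_on_open_Ck:
  assumes "open S" "smooth_on S f"
  shows "Ck_on k S f"
proof (rule Ck_on_local)
  fix x assume "x \<in> S"
  then obtain W g where W: "open W" "x \<in> W" "\<forall>k. Ck_on k W g" "\<forall>y\<in>S \<inter> W. f y = g y"
    using assms(2) unfolding smooth_on_def by metis
  have "Ck_on k (S \<inter> W) g" using W(3) Ck_on_subset by blast
  then have "Ck_on k (S \<inter> W) f"
    by (rule Ck_on_cong[rotated 2]) (use W assms(1) in auto)
  then show "\<exists>W. open W \<and> x \<in> W \<and> Ck_on k (S \<inter> W) f" using W by blast
qed

lemma Ck_on_SucD: "Ck_on (Suc k) S f \<Longrightarrow> Ck_on k S f"
proof (induction k arbitrary: f)
  case 0
  then show ?case
    by (auto intro!: continuous_at_imp_continuous_on differentiable_imp_continuous_within)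
next
  case (Suc k)
  have "Ck_on k S (dd i f)" if "i \<in> Basis" for i
    by (rule Suc.IH) (use Suc.prems that in \<open>simp add: Ck_on_Suc_dd[of "Suc k"] del: Ck_on.simps\<close>)
  then show ?case using Suc.prems by (simp add: Ck_on_Suc_dd del: Ck_on.simps)
qed

lemma Ck_on_const [simp]: "Ck_on k S (\<lambda>x. c)"
  by (induction k arbitrary: c) simp_all

lemma dd_bounded_linear:
  assumes "bounded_linear h" "f differentiable (at x)"
  shows "dd p (\<lambda>x. h (f x)) x = h (dd p f x)"
  by (rule dd_eqI) (rule bounded_linear.has_derivative[OF assms(1) has_derivative_dd[OF assms(2)]])

lemma Ck_on_bounded_linear:
  assumes "bounded_linear h" "open S" "Ck_on k S f"
  shows "Ck_on k S (\<lambda>x. h (f x))"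
  using assms(3)
proof (induction k arbitrary: f)
  case 0
  then show ?case using assms(1) bounded_linear.continuous_on by auto
next
  case (Suc k)
  have d: "\<And>x. x \<in> S \<Longrightarrow> f differentiable (at x)" using Suc.prems by simp
  have "Ck_on k S (dd i (\<lambda>x. h (f x)))" if "i \<in> Basis" for i
    by (rule Ck_on_cong[OF assms(2) dd_bounded_linear[OF assms(1) d, symmetric] Suc.IH])
      (use Suc.prems that in \<open>auto simp: Ck_on_Suc_dd simp del: Ck_on.simps\<close>)
  moreover have "(\<lambda>x. h (f x)) differentiable (at x)" if "x \<in> S" for x
    using bounded_linear.has_derivative[OF assms(1) has_derivative_dd[OF d[OF that]]]
    by (auto simp: differentiable_def)
  ultimately show ?case by (simp add: Ck_on_Suc_dd del: Ck_on.simps)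
qed

lemma dd_add:
  assumes "f differentiable (at x)" "g differentiable (at x)"
  shows "dd p (\<lambda>x. f x + g x) x = dd p f x + dd p g x"
  by (rule dd_eqI) (intro has_derivative_add has_derivative_dd assms)

lemma Ck_on_add:
  assumes "open S" "Ck_on k S f" "Ck_on k S g"
  shows "Ck_on k S (\<lambda>x. f x + g x)"
  using assms(2,3)
proof (induction k arbitrary: f g)
  case 0
  then show ?case by (auto intro: continuous_intros)
next
  case (Suc k)
  have d: "\<And>x. x \<in> S \<Longrightarrow> f differentiable (at x)" "\<And>x. x \<in> S \<Longrightarrow> g differentiable (at x)"
    using Suc.prems by simp_all
  have "Ck_on k S (dd i (\<lambda>x. f x + g x))" if "i \<in> Basis" for i
    by (rule Ck_on_cong[OF assms(1) dd_add[OF d, symmetric] Suc.IH])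
      (use Suc.prems that in \<open>auto simp: Ck_on_Suc_dd simp del: Ck_on.simps\<close>)
  moreover have "(\<lambda>x. f x + g x) differentiable (at x)" if "x \<in> S" for x
    using Suc.prems that by (auto intro: differentiable_add)
  ultimately show ?case by (simp add: Ck_on_Suc_dd del: Ck_on.simps)
qed

lemma Ck_on_sum:
  assumes "open S" "\<And>i. i \<in> I \<Longrightarrow> Ck_on k S (f i)"
  shows "Ck_on k S (\<lambda>x. \<Sum>i\<in>I. f i x)"
  using assms(2) by (induction I rule: infinite_finite_induct) (auto intro: Ck_on_add[OF assms(1)])

lemma (in bounded_bilinear) dd_prod:
  assumes "f differentiable (at x)" "g differentiable (at x)"
  shows "dd p (\<lambda>x. prod (f x) (g x)) x = prod (f x) (dd p g x) + prod (dd p f x) (g x)"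
  by (rule dd_eqI) (intro FDERIV has_derivative_dd assms)

lemma (in bounded_bilinear) Ck_on_prod:
  assumes "open S" "Ck_on k S f" "Ck_on k S g"
  shows "Ck_on k S (\<lambda>x. prod (f x) (g x))"
  using assms(2,3)
proof (induction k arbitrary: f g)
  case 0
  then show ?case by (auto intro: continuous_on)
next
  case (Suc k)
  have *: "Ck_on k S (\<lambda>x. prod (f x) (dd i g x) + prod (dd i f x) (g x))" if "i \<in> Basis" for i
    using Suc.prems that Suc.prems[THEN Ck_on_SucD]
    by (intro Ck_on_add[OF assms(1)] Suc.IH) (auto simp: Ck_on_Suc_dd simp del: Ck_on.simps)
  have d: "\<And>x. x \<in> S \<Longrightarrow> f differentiable (at x)" "\<And>x. x \<in> S \<Longrightarrow> g differentiable (at x)"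
    using Suc.prems by simp_all
  have "Ck_on k S (dd i (\<lambda>x. prod (f x) (g x)))" if "i \<in> Basis" for i
    by (rule Ck_on_cong[OF assms(1) dd_prod[OF d, symmetric] *[OF that]])
  moreover have "(\<lambda>x. prod (f x) (g x)) differentiable (at x)" if "x \<in> S" for x
    using FDERIV[OF has_derivative_dd[OF d(1)[OF that]] has_derivative_dd[OF d(2)[OF that]]]
    by (auto simp: differentiable_def)
  ultimately show ?case by (simp add: Ck_on_Suc_dd del: Ck_on.simps)
qed

text \<open>The derivative of 1 / f contains 1 / f itself, but only to one order less, which the
  induction hypothesis supplies.\<close>

lemma Ck_on_inverse:
  fixes f :: "'a::euclidean_space \<Rightarrow> real"
  assumes "open S" "Ck_on k S f" "\<And>x. x \<in> S \<Longrightarrow> f x \<noteq> 0"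
  shows "Ck_on k S (\<lambda>x. inverse (f x))"
  using assms(2)
proof (induction k)
  case 0
  then show ?case using assms(3) by (auto intro: continuous_on_inverse)
next
  case (Suc k)
  have D: "((\<lambda>x. inverse (f x)) has_derivative (\<lambda>p. - (inverse (f x) * dd p f x * inverse (f x)))) (at x)"
    if "x \<in> S" for x
    by (rule Deriv.has_derivative_inverse[where f = f and x = x, OF assms(3)[OF that] has_derivative_dd]) (use Suc.prems that in auto)
  have inv: "Ck_on k S (\<lambda>x. inverse (f x))" by (rule Suc.IH[OF Ck_on_SucD[OF Suc.prems]])
  have "Ck_on k S (dd i (\<lambda>x. inverse (f x)))" if i: "i \<in> Basis" for i
  proof (rule Ck_on_cong[OF assms(1)])
    have "Ck_on k S (dd i f)" using Suc.prems i by (simp add: Ck_on_Suc_dd del: Ck_on.simps)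
    note bounded_bilinear.Ck_on_prod[OF bounded_bilinear_mult assms(1)
        bounded_bilinear.Ck_on_prod[OF bounded_bilinear_mult assms(1) inv this] inv]
    from Ck_on_bounded_linear[OF bounded_linear_minus[OF bounded_linear_ident] assms(1) this]
    show "Ck_on k S (\<lambda>x. - (inverse (f x) * dd i f x * inverse (f x)))" .
    show "- (inverse (f x) * dd i f x * inverse (f x)) = dd i (\<lambda>x. inverse (f x)) x" if "x \<in> S" for x
      by (rule dd_eqI[OF D[OF that], symmetric])
  qed
  moreover have "(\<lambda>x. inverse (f x)) differentiable (at x)" if "x \<in> S" for x
    using D[OF that] by (auto simp: differentiable_def)
  ultimately show ?case by (simp add: Ck_on_Suc_dd del: Ck_on.simps)
qed

text \<open>Openness is built in because \<open>Ck_on\<close> differentiates in full neighbourhoods;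
  it then travels along with smoothness.\<close>

definition Cinf :: "'a::euclidean_space set \<Rightarrow> ('a \<Rightarrow> 'b::real_normed_vector) \<Rightarrow> bool" where
  "Cinf S f \<longleftrightarrow> open S \<and> (\<forall>k. Ck_on k S f)"

lemma Cinf_openD: "Cinf S f \<Longrightarrow> open S"
  by (simp add: Cinf_def)

lemma Cinf_differentiable: "Cinf S f \<Longrightarrow> x \<in> S \<Longrightarrow> f differentiable (at x)"
  by (auto simp: Cinf_def dest: spec[of _ "Suc 0"])

lemma Cinf_has_derivative: "Cinf S f \<Longrightarrow> x \<in> S \<Longrightarrow> (f has_derivative (\<lambda>p. dd p f x)) (at x)"
  by (intro has_derivative_dd Cinf_differentiable)

lemma Cinf_continuous_on: "Cinf S f \<Longrightarrow> continuous_on S f"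
  by (auto simp: Cinf_def dest: spec[of _ "0::nat"])

lemma linear_dd: "f differentiable (at x) \<Longrightarrow> linear (\<lambda>p. dd p f x)"
  using has_derivative_dd has_derivative_linear by blast

lemma Cinf_linear_dd: "Cinf S f \<Longrightarrow> x \<in> S \<Longrightarrow> linear (\<lambda>p. dd p f x)"
  by (simp add: Cinf_differentiable linear_dd)

lemma Cinf_cong: "Cinf S f \<Longrightarrow> (\<And>y. y \<in> S \<Longrightarrow> f y = g y) \<Longrightarrow> Cinf S g"
  unfolding Cinf_def using Ck_on_cong[of S f g] by simp

lemma Cinf_const [simp]: "open S \<Longrightarrow> Cinf S (\<lambda>x. c)"
  by (simp add: Cinf_def)

lemma Cinf_subset: "Cinf T f \<Longrightarrow> S \<subseteq> T \<Longrightarrow> open S \<Longrightarrow> Cinf S f"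
  unfolding Cinf_def using Ck_on_subset[of _ T f S] by simp

lemma Cinf_add: "Cinf S f \<Longrightarrow> Cinf S g \<Longrightarrow> Cinf S (\<lambda>x. f x + g x)"
  by (simp add: Cinf_def Ck_on_add)

lemma Cinf_bounded_linear: "bounded_linear h \<Longrightarrow> Cinf S f \<Longrightarrow> Cinf S (\<lambda>x. h (f x))"
  by (simp add: Cinf_def Ck_on_bounded_linear)

lemma Cinf_minus: "Cinf S f \<Longrightarrow> Cinf S (\<lambda>x. - f x)"
  by (rule Cinf_bounded_linear[OF bounded_linear_minus[OF bounded_linear_ident]])

lemma Cinf_diff: "Cinf S f \<Longrightarrow> Cinf S g \<Longrightarrow> Cinf S (\<lambda>x. f x - g x)"
  using Cinf_add[of S f "\<lambda>x. - g x"] Cinf_minus by auto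

lemma Cinf_sum: "open S \<Longrightarrow> (\<And>i. i \<in> I \<Longrightarrow> Cinf S (f i)) \<Longrightarrow> Cinf S (\<lambda>x. \<Sum>i\<in>I. f i x)"
  unfolding Cinf_def by (simp add: Ck_on_sum)

lemma Cinf_mult:
  fixes f g :: "'a::euclidean_space \<Rightarrow> real"
  shows "Cinf S f \<Longrightarrow> Cinf S g \<Longrightarrow> Cinf S (\<lambda>x. f x * g x)"
  by (simp add: Cinf_def bounded_bilinear.Ck_on_prod[OF bounded_bilinear_mult])

lemma Cinf_scaleR:
  shows "Cinf S f \<Longrightarrow> Cinf S g \<Longrightarrow> Cinf S (\<lambda>x. f x *\<^sub>R g x)"
  by (simp add: Cinf_def bounded_bilinear.Ck_on_prod[OF bounded_bilinear_scaleR])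

lemma Cinf_prod:
  fixes f :: "'i \<Rightarrow> 'a::euclidean_space \<Rightarrow> real"
  shows "open S \<Longrightarrow> (\<And>i. i \<in> I \<Longrightarrow> Cinf S (f i)) \<Longrightarrow> Cinf S (\<lambda>x. \<Prod>i\<in>I. f i x)"
  by (induction I rule: infinite_finite_induct) (auto intro: Cinf_mult)

lemma Cinf_inverse:
  fixes f :: "'a::euclidean_space \<Rightarrow> real"
  shows "Cinf S f \<Longrightarrow> (\<And>x. x \<in> S \<Longrightarrow> f x \<noteq> 0) \<Longrightarrow> Cinf S (\<lambda>x. inverse (f x))"
  by (simp add: Cinf_def Ck_on_inverse)

lemma Cinf_linear: "bounded_linear h \<Longrightarrow> open S \<Longrightarrow> Cinf S h"
proof -
  assume h: "bounded_linear h" and S: "open S"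
  have "Ck_on k S (\<lambda>x. x)" for k
  proof (cases k)
    case (Suc j)
    have "dd i (\<lambda>x. x) = (\<lambda>x. i)" for i :: 'a by (auto simp: dd_def)
    then show ?thesis unfolding Suc by (simp add: Ck_on_Suc_dd del: Ck_on.simps)
  qed auto
  then have "Cinf S (\<lambda>x. x)" using S by (simp add: Cinf_def)
  from Cinf_bounded_linear[OF h this] show "Cinf S h" by simp
qed

lemma Cinf_euclidean:
  fixes f :: "'a::euclidean_space \<Rightarrow> 'b::euclidean_space"
  assumes "open S" "\<And>i. i \<in> Basis \<Longrightarrow> Cinf S (\<lambda>x. f x \<bullet> i)"
  shows "Cinf S f"
proof -
  have "Cinf S (\<lambda>x. \<Sum>i\<in>Basis. (f x \<bullet> i) *\<^sub>R i)"
    by (intro Cinf_sum Cinf_scaleR assms Cinf_const)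
  then show ?thesis by (simp add: euclidean_representation)
qed

lemma Cinf_vec:
  fixes f :: "'a::euclidean_space \<Rightarrow> real ^ 'n"
  assumes "open S" "\<And>i. Cinf S (\<lambda>x. f x $ i)"
  shows "Cinf S f"
  by (rule Cinf_euclidean[OF assms(1)]) (auto simp: Basis_vec_def inner_axis assms)

lemma Cinf_vec_nth: "Cinf S f \<Longrightarrow> Cinf S (\<lambda>x. f x $ i)"
  by (rule Cinf_bounded_linear[OF bounded_linear_vec_nth])

lemma dd_sum_Basis:
  assumes "f differentiable (at x)"
  shows "dd p f x = (\<Sum>i\<in>Basis. (p \<bullet> i) *\<^sub>R dd i f x)"
proof -
  have "dd (\<Sum>i\<in>Basis. (p \<bullet> i) *\<^sub>R i) f x = (\<Sum>i\<in>Basis. (p \<bullet> i) *\<^sub>R dd i f x)"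
    unfolding linear_sum[OF linear_dd[OF assms]] linear_cmul[OF linear_dd[OF assms]] ..
  then show ?thesis by (simp add: euclidean_representation)
qed

text \<open>The direction moves with the point, as for the Euler field \<open>(0, v)\<close> and the
  spray \<open>(v, - 2 G)\<close>. Expanding it in the basis leaves sums of products of smooth
  functions.\<close>

lemma Cinf_dd_variable:
  assumes "Cinf S f" "Cinf S p"
  shows "Cinf S (\<lambda>x. dd (p x) f x)"
proof (rule Cinf_cong)
  have S: "open S" using assms Cinf_openD by blast
  have "Cinf S (dd i f)" if "i \<in> Basis" for i
    unfolding Cinf_def
  proof (intro conjI allI S)
    fix k
    have "Ck_on (Suc k) S f" using assms Cinf_def by blast
    then show "Ck_on k S (dd i f)" using that by (simp add: Ck_on_Suc_dd del: Ck_on.simps)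
  qed
  then show "Cinf S (\<lambda>x. \<Sum>i\<in>Basis. (p x \<bullet> i) *\<^sub>R dd i f x)"
    by (intro Cinf_sum S Cinf_scaleR Cinf_bounded_linear[OF bounded_linear_inner_left assms(2)])
  show "(\<Sum>i\<in>Basis. (p y \<bullet> i) *\<^sub>R dd i f y) = dd (p y) f y" if "y \<in> S" for y
    using dd_sum_Basis[OF Cinf_differentiable[OF assms(1) that], of "p y"] by simp
qed

lemma Cinf_dd: "Cinf S f \<Longrightarrow> Cinf S (dd p f)"
  using Cinf_dd_variable[of S f "\<lambda>_. p"] Cinf_openD[of S f] by simp

text \<open>A product rule in the pair (point, direction). Euler's relation, the transformation laws
  and the fields along a curve are differentiated with it.\<close>

lemma has_derivative_dd_variable:
  assumes "Cinf S f" "\<Phi> x \<in> S" "(\<Phi> has_derivative \<Phi>') (at x)" "(p has_derivative p') (at x)"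
  shows "((\<lambda>y. dd (p y) f (\<Phi> y)) has_derivative
    (\<lambda>q. dd (\<Phi>' q) (dd (p x) f) (\<Phi> x) + dd (p' q) f (\<Phi> x))) (at x)"
proof -
  have S: "open S" using assms Cinf_openD by blast
  obtain T where T: "open T" "x \<in> T" "\<Phi> ` T \<subseteq> S"
    using has_derivative_continuous[OF assms(3)] S assms(2)
    by (metis continuous_at_open image_subsetI)
  have "((\<lambda>y. \<Sum>i\<in>Basis. (p y \<bullet> i) *\<^sub>R dd i f (\<Phi> y)) has_derivative
     (\<lambda>q. \<Sum>i\<in>Basis. (p x \<bullet> i) *\<^sub>R dd (\<Phi>' q) (dd i f) (\<Phi> x) + (p' q \<bullet> i) *\<^sub>R dd i f (\<Phi> x))) (at x)"
    by (intro has_derivative_sum has_derivative_scaleR has_derivative_inner_left assms(4)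
        has_derivative_compose[OF assms(3) Cinf_has_derivative[OF Cinf_dd[OF assms(1)] assms(2)]])
  moreover have "(\<Sum>i\<in>Basis. (p x \<bullet> i) *\<^sub>R dd q (dd i f) (\<Phi> x) + (q' \<bullet> i) *\<^sub>R dd i f (\<Phi> x))
      = dd q (dd (p x) f) (\<Phi> x) + dd q' f (\<Phi> x)" for q q'
  proof -
    have "dd q (dd (p x) f) (\<Phi> x) = dd q (\<lambda>y. \<Sum>i\<in>Basis. (p x \<bullet> i) *\<^sub>R dd i f y) (\<Phi> x)"
      by (rule dd_cong[OF S assms(2)]) (rule dd_sum_Basis[OF Cinf_differentiable[OF assms(1)]])
    also have "\<dots> = (\<Sum>i\<in>Basis. (p x \<bullet> i) *\<^sub>R dd q (dd i f) (\<Phi> x))"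
      by (rule dd_eqI) (intro has_derivative_sum has_derivative_scaleR_right
        Cinf_has_derivative[OF Cinf_dd[OF assms(1)] assms(2)])
    finally show ?thesis
      using dd_sum_Basis[OF Cinf_differentiable[OF assms(1,2)], of "q'"] by (simp add: sum.distrib)
  qed
  ultimately have D: "((\<lambda>y. \<Sum>i\<in>Basis. (p y \<bullet> i) *\<^sub>R dd i f (\<Phi> y)) has_derivative
     (\<lambda>q. dd (\<Phi>' q) (dd (p x) f) (\<Phi> x) + dd (p' q) f (\<Phi> x))) (at x)" by simp
  show ?thesis
  proof (rule has_derivative_transform_within_open[OF D T(1,2)])
    fix y assume "y \<in> T"
    then have "\<Phi> y \<in> S" using T by blast
    then show "(\<Sum>i\<in>Basis. (p y \<bullet> i) *\<^sub>R dd i f (\<Phi> y)) = dd (p y) f (\<Phi> y)"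
      using dd_sum_Basis[OF Cinf_differentiable[OF assms(1)], of "\<Phi> y" "p y"] by simp
  qed
qed

section \<open>Symmetry of second derivatives\<close>

lemma dd_dd_line:
  fixes f :: "'a::euclidean_space \<Rightarrow> real"
  assumes "Cinf S f" "x + s *\<^sub>R p + c \<in> S"
  shows "((\<lambda>s. f (x + s *\<^sub>R p + c)) has_real_derivative dd p f (x + s *\<^sub>R p + c)) (at s)"
proof -
  have "((\<lambda>s. x + s *\<^sub>R p + c) has_derivative (\<lambda>h. h *\<^sub>R p)) (at s)"
    by (auto intro!: derivative_eq_intros)
  from has_derivative_compose[OF this Cinf_has_derivative[OF assms]]
  show ?thesis
    by (rule has_derivative_imp_has_field_derivative)
      (simp add: linear_cmul[OF Cinf_linear_dd[OF assms]])
qed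

text \<open>Both mixed derivatives are limits of the same second difference quotient, by applying
  the mean value theorem in the two variables.\<close>

lemma second_difference_mvt:
  fixes f :: "'a::euclidean_space \<Rightarrow> real"
  assumes f: "Cinf (ball x r) f" and h: "0 < h" "h * (norm p + norm q) < r"
  shows "\<exists>s t. 0 < s \<and> s < h \<and> 0 < t \<and> t < h \<and>
    f (x + h *\<^sub>R p + h *\<^sub>R q) - f (x + h *\<^sub>R p) - f (x + h *\<^sub>R q) + f x
      = h\<^sup>2 * dd q (dd p f) (x + s *\<^sub>R p + t *\<^sub>R q)"
proof -
  have inb: "x + s *\<^sub>R p + t *\<^sub>R q \<in> ball x r" if "0 \<le> s" "s \<le> h" "0 \<le> t" "t \<le> h" for s t
  proof -
    have "norm (s *\<^sub>R p + t *\<^sub>R q) \<le> s * norm p + t * norm q"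
      using norm_triangle_ineq[of "s *\<^sub>R p" "t *\<^sub>R q"] that by simp
    also have "\<dots> \<le> h * (norm p + norm q)"
      using that by (simp add: distrib_left add_mono mult_right_mono)
    finally have "norm (s *\<^sub>R p + t *\<^sub>R q) < r" using h by linarith
    then show ?thesis
      using norm_minus_cancel[of "s *\<^sub>R p + t *\<^sub>R q"] by (simp add: dist_norm add.assoc)
  qed
  define \<phi> where "\<phi> s = f (x + s *\<^sub>R p + h *\<^sub>R q) - f (x + s *\<^sub>R p + 0 *\<^sub>R q)" for s
  have "(\<phi> has_real_derivative dd p f (x + s *\<^sub>R p + h *\<^sub>R q) - dd p f (x + s *\<^sub>R p + 0 *\<^sub>R q)) (at s)"
    if "0 \<le> s" "s \<le> h" for s
    unfolding \<phi>_def by (intro DERIV_diff dd_dd_line[OF f] inb) (use that h in auto)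
  then obtain s where s: "0 < s" "s < h" "\<phi> h - \<phi> 0 =
      (h - 0) * (dd p f (x + s *\<^sub>R p + h *\<^sub>R q) - dd p f (x + s *\<^sub>R p + 0 *\<^sub>R q))"
    using MVT2[OF h(1), of \<phi> "\<lambda>s. dd p f (x + s *\<^sub>R p + h *\<^sub>R q) - dd p f (x + s *\<^sub>R p + 0 *\<^sub>R q)"]
    by blast
  have "((\<lambda>t. dd p f (x + s *\<^sub>R p + t *\<^sub>R q)) has_real_derivative dd q (dd p f) (x + s *\<^sub>R p + t *\<^sub>R q)) (at t)"
    if "0 \<le> t" "t \<le> h" for t
    using dd_dd_line[OF Cinf_dd[OF f], of x t q "s *\<^sub>R p" p] inb[of s t] that s
    by (simp add: algebra_simps)
  then obtain t where t: "0 < t" "t < h"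
    "dd p f (x + s *\<^sub>R p + h *\<^sub>R q) - dd p f (x + s *\<^sub>R p + 0 *\<^sub>R q) = (h - 0) * dd q (dd p f) (x + s *\<^sub>R p + t *\<^sub>R q)"
    using MVT2[OF h(1), of "\<lambda>t. dd p f (x + s *\<^sub>R p + t *\<^sub>R q)" "\<lambda>t. dd q (dd p f) (x + s *\<^sub>R p + t *\<^sub>R q)"]
    by blast
  have "\<phi> h - \<phi> 0 = h\<^sup>2 * dd q (dd p f) (x + s *\<^sub>R p + t *\<^sub>R q)"
    unfolding s(3) t(3) by (simp add: power2_eq_square)
  then have "f (x + h *\<^sub>R p + h *\<^sub>R q) - f (x + h *\<^sub>R p) - f (x + h *\<^sub>R q) + f x
      = h\<^sup>2 * dd q (dd p f) (x + s *\<^sub>R p + t *\<^sub>R q)" by (simp add: \<phi>_def)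
  then show ?thesis using s(1,2) t(1,2) by blast
qed

lemma dd_commute_real:
  fixes f :: "'a::euclidean_space \<Rightarrow> real"
  assumes "Cinf S f" "x \<in> S"
  shows "dd p (dd q f) x = dd q (dd p f) x"
proof (rule ccontr)
  assume ne: "dd p (dd q f) x \<noteq> dd q (dd p f) x"
  define e where "e = \<bar>dd p (dd q f) x - dd q (dd p f) x\<bar> / 2"
  have e: "e > 0" using ne by (simp add: e_def)
  obtain r where r: "r > 0" "ball x r \<subseteq> S"
    using assms Cinf_openD open_contains_ball by blast
  have f: "Cinf (ball x r) f" using Cinf_subset[OF assms(1) r(2)] by simp
  have c: "\<exists>d>0. \<forall>y\<in>ball x r. dist y x < d \<longrightarrow> dist (dd p (dd q f) y) (dd p (dd q f) x) < e" for p q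
    using Cinf_continuous_on[OF Cinf_dd[OF Cinf_dd[OF f]], of p q] r(1) e
    unfolding continuous_on_iff by (meson centre_in_ball)
  obtain d1 where d1: "d1 > 0" "\<forall>y\<in>ball x r. dist y x < d1 \<longrightarrow> dist (dd p (dd q f) y) (dd p (dd q f) x) < e"
    using c by blast
  obtain d2 where d2: "d2 > 0" "\<forall>y\<in>ball x r. dist y x < d2 \<longrightarrow> dist (dd q (dd p f) y) (dd q (dd p f) x) < e"
    using c by blast
  define d where "d = min r (min d1 d2)"
  have d: "d > 0" using r d1 d2 by (simp add: d_def)
  \<comment> \<open>All points that the mean value theorem can produce then lie within
    \<open>d\<close> of \<open>x\<close>; the summand 1 covers p = q = 0.\<close>
  define h where "h = d / (norm p + norm q + 1)"
  have np: "norm p + norm q + 1 > 0" by (simp add: add_nonneg_pos)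
  have h: "h > 0" using d np by (simp add: h_def)
  have "h * (norm p + norm q) < h * (norm p + norm q + 1)" using h by simp
  also have "\<dots> = d" using np by (simp add: h_def)
  finally have hd: "h * (norm p + norm q) < d" .
  have near: "dist (x + s *\<^sub>R p + t *\<^sub>R q) x < d" if "0 < s" "s < h" "0 < t" "t < h" for s t
  proof -
    have "dist (x + s *\<^sub>R p + t *\<^sub>R q) x = norm (s *\<^sub>R p + t *\<^sub>R q)" by (simp add: dist_norm algebra_simps)
    also have "\<dots> \<le> s * norm p + t * norm q"
      using norm_triangle_ineq[of "s *\<^sub>R p" "t *\<^sub>R q"] that by simp
    also have "\<dots> \<le> h * (norm p + norm q)"
      using that by (simp add: distrib_left add_mono mult_right_mono)
    finally show ?thesis using hd by simp
  qed
  obtain s t where st: "0 < s" "s < h" "0 < t" "t < h"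
    "f (x + h *\<^sub>R p + h *\<^sub>R q) - f (x + h *\<^sub>R p) - f (x + h *\<^sub>R q) + f x
      = h\<^sup>2 * dd q (dd p f) (x + s *\<^sub>R p + t *\<^sub>R q)"
    using second_difference_mvt[OF f h, of p q] hd by (auto simp: d_def)
  obtain s' t' where st': "0 < s'" "s' < h" "0 < t'" "t' < h"
    "f (x + h *\<^sub>R q + h *\<^sub>R p) - f (x + h *\<^sub>R q) - f (x + h *\<^sub>R p) + f x
      = h\<^sup>2 * dd p (dd q f) (x + s' *\<^sub>R q + t' *\<^sub>R p)"
    using second_difference_mvt[OF f h, of q p] hd by (auto simp: d_def add.commute)
  \<comment> \<open>The second difference is symmetric in p and q. So the two mixed derivatives
    agree at a pair of points near x, while each differs from its value at x by less than half of
    the assumed gap.\<close>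
  have comm: "x + h *\<^sub>R q + h *\<^sub>R p = x + h *\<^sub>R p + h *\<^sub>R q" by (simp add: algebra_simps)
  have "h\<^sup>2 * dd q (dd p f) (x + s *\<^sub>R p + t *\<^sub>R q) = h\<^sup>2 * dd p (dd q f) (x + s' *\<^sub>R q + t' *\<^sub>R p)"
    using st(5) st'(5) unfolding comm by linarith
  then have eq: "dd q (dd p f) (x + s *\<^sub>R p + t *\<^sub>R q) = dd p (dd q f) (x + t' *\<^sub>R p + s' *\<^sub>R q)"
    using h by (simp add: algebra_simps)
  have "dist (dd q (dd p f) (x + s *\<^sub>R p + t *\<^sub>R q)) (dd q (dd p f) x) < e"
    using near[OF st(1-4)] by (intro d2(2)[rule_format]) (simp_all add: d_def dist_commute)
  moreover have "dist (dd p (dd q f) (x + t' *\<^sub>R p + s' *\<^sub>R q)) (dd p (dd q f) x) < e"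
    using near[OF st'(3,4,1,2)] by (intro d1(2)[rule_format]) (simp_all add: d_def dist_commute)
  ultimately show False
    unfolding eq e_def dist_real_def by (smt (verit) field_sum_of_halves)
qed

lemma dd_commute:
  fixes f :: "'a::euclidean_space \<Rightarrow> 'b::euclidean_space"
  assumes "Cinf S f" "x \<in> S"
  shows "dd p (dd q f) x = dd q (dd p f) x"
proof (rule euclidean_eqI)
  fix i :: 'b assume "i \<in> Basis"
  have S: "open S" using assms Cinf_openD by blast
  have *: "dd p (dd q f) x \<bullet> i = dd p (dd q (\<lambda>x. f x \<bullet> i)) x" for p q
  proof -
    have "dd p (dd q (\<lambda>x. f x \<bullet> i)) x = dd p (\<lambda>x. dd q f x \<bullet> i) x"
      by (rule dd_cong[OF S assms(2)])
        (rule dd_bounded_linear[OF bounded_linear_inner_left Cinf_differentiable[OF assms(1)]])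
    also have "\<dots> = dd p (dd q f) x \<bullet> i"
      by (rule dd_bounded_linear[OF bounded_linear_inner_left
            Cinf_differentiable[OF Cinf_dd[OF assms(1)] assms(2)]])
    finally show ?thesis by simp
  qed
  show "dd p (dd q f) x \<bullet> i = dd q (dd p f) x \<bullet> i"
    unfolding * by (rule dd_commute_real[OF Cinf_bounded_linear[OF bounded_linear_inner_left assms(1)] assms(2)])
qed

text \<open>Linearity is immediate in the outer direction; symmetry of second derivatives carries it
  to the inner one.\<close>

lemma linear_dd_dd:
  fixes f :: "'a::euclidean_space \<Rightarrow> 'b::euclidean_space"
  assumes "Cinf S f" "x \<in> S"
  shows "linear (\<lambda>q. dd p (dd q f) x)"
  unfolding dd_commute[OF assms, of p] by (rule Cinf_linear_dd[OF Cinf_dd[OF assms(1)] assms(2)])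

lemma dd_commute3:
  fixes f :: "'a::euclidean_space \<Rightarrow> 'b::euclidean_space"
  assumes "Cinf S f" "x \<in> S"
  shows "dd r (dd p (dd q f)) x = dd r (dd q (dd p f)) x"
  by (rule dd_cong[OF Cinf_openD[OF assms(1)] assms(2)]) (rule dd_commute[OF assms(1)])

lemma linear_dd_dd_dd:
  fixes f :: "'a::euclidean_space \<Rightarrow> 'b::euclidean_space"
  assumes "Cinf S f" "x \<in> S"
  shows "linear (\<lambda>q. dd r (dd p (dd q f)) x)"
  unfolding dd_commute3[OF assms, of r p] by (rule linear_dd_dd[OF Cinf_dd[OF assms(1)] assms(2)])

lemma linear_sum_Basis:
  assumes "linear h"
  shows "h (p :: 'a::euclidean_space) = (\<Sum>i\<in>Basis. (p \<bullet> i) *\<^sub>R h i)"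
proof -
  have "h (\<Sum>i\<in>Basis. (p \<bullet> i) *\<^sub>R i) = (\<Sum>i\<in>Basis. (p \<bullet> i) *\<^sub>R h i)"
    using assms by (simp add: linear_sum linear_cmul)
  then show ?thesis by (simp add: euclidean_representation)
qed

text \<open>The version with two moving directions, for \<open>g\<close> along a geodesic and for
  the Hessian of a coordinate change.\<close>

lemma has_derivative_dd2_variable:
  fixes f :: "'a::euclidean_space \<Rightarrow> 'b::euclidean_space"
  assumes "Cinf S f" "\<Phi> x \<in> S" "(\<Phi> has_derivative \<Phi>') (at x)"
    "(a has_derivative a') (at x)" "(b has_derivative b') (at x)"
  shows "((\<lambda>y. dd (a y) (dd (b y) f) (\<Phi> y)) has_derivative
    (\<lambda>q. dd (\<Phi>' q) (dd (a x) (dd (b x) f)) (\<Phi> x) + dd (a' q) (dd (b x) f) (\<Phi> x)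
       + dd (a x) (dd (b' q) f) (\<Phi> x))) (at x)"
proof -
  have S: "open S" using assms Cinf_openD by blast
  obtain T where T: "open T" "x \<in> T" "\<Phi> ` T \<subseteq> S"
    using has_derivative_continuous[OF assms(3)] S assms(2)
    by (metis continuous_at_open image_subsetI)
  have "((\<lambda>y. \<Sum>j\<in>Basis. (b y \<bullet> j) *\<^sub>R dd (a y) (dd j f) (\<Phi> y)) has_derivative
     (\<lambda>q. \<Sum>j\<in>Basis. (b x \<bullet> j) *\<^sub>R (dd (\<Phi>' q) (dd (a x) (dd j f)) (\<Phi> x) + dd (a' q) (dd j f) (\<Phi> x))
        + (b' q \<bullet> j) *\<^sub>R dd (a x) (dd j f) (\<Phi> x))) (at x)"
    by (intro has_derivative_sum has_derivative_scaleR has_derivative_inner_left assms(5)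
        has_derivative_dd_variable[OF Cinf_dd[OF assms(1)] assms(2,3,4)])
  then have D: "((\<lambda>y. \<Sum>j\<in>Basis. (b y \<bullet> j) *\<^sub>R dd (a y) (dd j f) (\<Phi> y)) has_derivative
     (\<lambda>q. dd (\<Phi>' q) (dd (a x) (dd (b x) f)) (\<Phi> x) + dd (a' q) (dd (b x) f) (\<Phi> x)
       + dd (a x) (dd (b' q) f) (\<Phi> x))) (at x)"
    unfolding linear_sum_Basis[OF linear_dd_dd_dd[OF assms(1,2)], of _ _ "b x"]
      linear_sum_Basis[OF linear_dd_dd[OF assms(1,2)], of _ "b x"]
      linear_sum_Basis[OF linear_dd_dd[OF assms(1,2)], of _ "b' _"]
    by (simp add: sum.distrib scaleR_add_right)
  show ?thesis
  proof (rule has_derivative_transform_within_open[OF D T(1,2)])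
    fix y assume "y \<in> T"
    then have "\<Phi> y \<in> S" using T by blast
    then show "(\<Sum>j\<in>Basis. (b y \<bullet> j) *\<^sub>R dd (a y) (dd j f) (\<Phi> y)) = dd (a y) (dd (b y) f) (\<Phi> y)"
      using linear_sum_Basis[OF linear_dd_dd[OF assms(1)], of "\<Phi> y" "a y" "b y"] by simp
  qed
qed

section \<open>The spray and its curvature in coordinates\<close>

lemma linear_sum_axis:
  assumes "linear (h :: real ^ 'n \<Rightarrow> 'b::real_vector)"
  shows "h k = (\<Sum>i\<in>UNIV. (k $ i) *\<^sub>R h (axis i 1))"
proof -
  have "h k = h (\<Sum>i\<in>UNIV. (k $ i) *\<^sub>R axis i 1)"
    by (simp add: basis_expansion[of k, unfolded scalar_mult_eq_scaleR])
  also have "\<dots> = (\<Sum>i\<in>UNIV. (k $ i) *\<^sub>R h (axis i 1))"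
    using assms by (simp add: linear_sum linear_cmul)
  finally show ?thesis .
qed

lemma matrix_inv_right: "invertible M \<Longrightarrow> M ** matrix_inv M = mat 1"
  and matrix_inv_left: "invertible M \<Longrightarrow> matrix_inv M ** M = mat 1"
  for M :: "real ^ 'n ^ 'n"
  using someI_ex[of "\<lambda>A'. M ** A' = mat 1 \<and> A' ** M = mat 1"]
  by (auto simp: invertible_def matrix_inv_def)

text \<open>Cramer's rule exhibits the entries of the inverse as quotients of polynomials in the
  entries of M, which is how the inverse inherits smoothness.\<close>

lemma matrix_inv_Cramer:
  fixes M :: "real ^ 'n ^ 'n"
  assumes "invertible M"
  shows "matrix_inv M $ i $ j = det (\<chi> a b. if b = i then (axis j 1 :: real ^ 'n) $ a else M $ a $ b) / det M"
proof -
  have "M *v (matrix_inv M *v axis j 1) = axis j 1"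
    by (simp add: matrix_vector_mul_assoc matrix_inv_right[OF assms])
  moreover have "det M \<noteq> 0" using assms invertible_det_nz by blast
  ultimately have "matrix_inv M *v axis j 1 =
      (\<chi> k. det (\<chi> a b. if b = k then (axis j 1 :: real ^ 'n) $ a else M $ a $ b) / det M)"
    using cramer by blast
  then have "(matrix_inv M *v axis j 1) $ i =
      det (\<chi> a b. if b = i then (axis j 1 :: real ^ 'n) $ a else M $ a $ b) / det M" by simp
  then show ?thesis by (simp add: matrix_vector_mul_component inner_axis)
qed

lemma Cinf_det:
  fixes M :: "'a::euclidean_space \<Rightarrow> real ^ 'n ^ 'n"
  assumes "open S" "\<And>i j. Cinf S (\<lambda>x. M x $ i $ j)"
  shows "Cinf S (\<lambda>x. det (M x))"
  unfolding det_def by (intro Cinf_sum Cinf_mult Cinf_prod Cinf_const assms)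

lemma Cinf_matrix_inv:
  fixes M :: "'a::euclidean_space \<Rightarrow> real ^ 'n ^ 'n"
  assumes "open S" "\<And>i j. Cinf S (\<lambda>x. M x $ i $ j)" "\<And>x. x \<in> S \<Longrightarrow> invertible (M x)"
  shows "Cinf S (\<lambda>x. matrix_inv (M x) $ i $ j)"
proof (rule Cinf_cong)
  show "Cinf S (\<lambda>x. det (\<chi> a b. if b = i then (axis j 1 :: real ^ 'n) $ a else M x $ a $ b) * inverse (det (M x)))"
  proof (intro Cinf_mult Cinf_inverse Cinf_det assms)
    show "Cinf S (\<lambda>x. (\<chi> a b. if b = i then (axis j 1 :: real ^ 'n) $ a else M x $ a $ b) $ a $ b)" for a b
      by (cases "b = i") (simp_all add: assms)
    show "det (M x) \<noteq> 0" if "x \<in> S" for x using assms(3)[OF that] invertible_det_nz by blast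
  qed
  show "det (\<chi> a b. if b = i then (axis j 1 :: real ^ 'n) $ a else M y $ a $ b) * inverse (det (M y))
      = matrix_inv (M y) $ i $ j" if "y \<in> S" for y
    using matrix_inv_Cramer[OF assms(3)[OF that], of i j] by (simp add: divide_inverse)
qed

lemma dx_eq: "dx \<alpha> h = dd (axis \<alpha> 1, 0) h"
  by (simp add: fun_eq_iff dx_def dd_def)

lemma dv_eq: "dv \<alpha> h = dd (0, axis \<alpha> 1) h"
  by (simp add: fun_eq_iff dv_def dd_def)

lemma linear_Pair_snd: "linear (\<lambda>k. (0, k))"
  by (rule linearI) simp_all

lemma linear_Pair_fst: "linear (\<lambda>k. (k, 0))"
  by (rule linearI) simp_all

text \<open>The data of one chart. Of the Lorentz signature it retains invertibility of
  \<open>g_mat\<close>, by which the Euler-Lagrange identity determines the spray; the sign pattern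
  enters later, with the choice of a frame.\<close>

locale local_finsler =
  fixes l :: "(real ^ 'n::finite) \<times> (real ^ 'n) \<Rightarrow> real" and U :: "(real ^ 'n) set"
  assumes open_U: "open U"
    and smooth_l: "Cinf (U \<times> - {0}) l"
    and homogeneous_l: "\<And>y u k. y \<in> U \<Longrightarrow> k > 0 \<Longrightarrow> l (y, k *\<^sub>R u) = k\<^sup>2 * l (y, u)"
    and invertible_g: "\<And>z. z \<in> U \<times> - {0} \<Longrightarrow> invertible (g_mat l z)"
begin

definition W where "W = U \<times> - {0 :: real ^ 'n}"

lemma open_W: "open W" unfolding W_def using open_U by (intro open_Times) auto

lemma smooth_l_W: "Cinf W l" unfolding W_def by (rule smooth_l)

lemma invertible_g_W: "z \<in> W \<Longrightarrow> invertible (g_mat l z)" unfolding W_def by (rule invertible_g)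

text \<open>With \<open>z = (x, v)\<close>: \<open>g k k' z\<close> is \<open>g\<^sub>v(k, k')\<close>, \<open>NN w z\<close> and \<open>RR w z\<close> are the vectors with components
  \<open>N\<^sup>\<alpha>\<^sub>\<beta>(v) w\<^sup>\<beta>\<close> and \<open>R\<^sup>\<alpha>\<^sub>\<beta>(v) w\<^sup>\<beta>\<close>, and \<open>SS\<close> differentiates along the geodesic flow. The first
  component of a direction moves the base point, the second the fibre.\<close>

definition g where "g k k' = dd (0, k) (dd (0, k') l)"
definition b where "b h k = dd (h, 0) (dd (0, k) l)"
definition G where "G = spray l"
definition NN where "NN w = dd (0, w) G"
definition SS :: "((real ^ 'n) \<times> (real ^ 'n) \<Rightarrow> 'b::real_normed_vector) \<Rightarrow> (real ^ 'n) \<times> (real ^ 'n) \<Rightarrow> 'b" where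
  "SS f z = dd (snd z, - 2 *\<^sub>R G z) f z"
definition RR where "RR w z = 2 *\<^sub>R dd (w, 0) G z - SS (NN w) z - NN (NN w z) z"

lemmas smooth_ddl = Cinf_dd[OF smooth_l_W]
lemmas smooth_dddl = Cinf_dd[OF smooth_ddl]

lemma smooth_g: "Cinf W (g k k')" unfolding g_def by (rule smooth_dddl)
lemma smooth_b: "Cinf W (b k k')" unfolding b_def by (rule smooth_dddl)

lemma dd_l_commute: "z \<in> W \<Longrightarrow> dd p (dd q l) z = dd q (dd p l) z"
  by (rule dd_commute[OF smooth_l_W])

lemma dd_l_commute_fun: "z \<in> W \<Longrightarrow> dd r (dd p (dd q l)) z = dd r (dd q (dd p l)) z"
  by (rule dd_commute3[OF smooth_l_W])

lemma dd_l_commute_outer: "z \<in> W \<Longrightarrow> dd r (dd p (dd q l)) z = dd p (dd r (dd q l)) z"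
  by (rule dd_commute[OF smooth_ddl])

lemma g_sym: "z \<in> W \<Longrightarrow> g k k' z = g k' k z"
  unfolding g_def by (rule dd_l_commute)

text \<open>Homogeneity of degree \<open>m\<close> in the fibre, encoded by Euler's relation.\<close>

definition hom :: "real \<Rightarrow> ((real ^ 'n) \<times> (real ^ 'n) \<Rightarrow> real) \<Rightarrow> bool" where
  "hom m f \<longleftrightarrow> Cinf W f \<and> (\<forall>z\<in>W. dd (0, snd z) f z = m * f z)"

text \<open>The two expressions for l (y, k u) in \<open>homogeneous_l\<close> are differentiated in
  k at k = 1.\<close>

lemma hom_l: "hom 2 l"
  unfolding hom_def
proof (intro conjI ballI smooth_l_W)
  fix z assume z: "z \<in> W"
  obtain y u where yu: "z = (y, u)" by (cases z)
  have D: "((\<lambda>k. l (y, k *\<^sub>R u)) has_real_derivative dd (0, u) l z) (at 1)"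
  proof -
    have A: "((\<lambda>k. (y, k *\<^sub>R u)) has_derivative (\<lambda>h. (0, h *\<^sub>R u))) (at 1)"
      by (auto intro!: derivative_eq_intros)
    have B: "(l has_derivative (\<lambda>p. dd p l z)) (at (y, 1 *\<^sub>R u))"
      using Cinf_has_derivative[OF smooth_l_W z] yu by simp
    have "dd (0, h *\<^sub>R u) l z = dd (0, u) l z * h" for h
      using linear_cmul[OF Cinf_linear_dd[OF smooth_l_W z], of h "(0, u)"] by simp
    then show ?thesis using has_derivative_compose[OF A B]
      by (simp add: has_field_derivative_def)
  qed
  have "((\<lambda>k. k\<^sup>2 * l (y, u)) has_real_derivative 2 * l (y, u)) (at 1)"
    by (auto intro!: derivative_eq_intros)
  moreover have "eventually (\<lambda>k. k\<^sup>2 * l (y, u) = l (y, k *\<^sub>R u)) (nhds (1::real))"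
    by (rule eventually_mono[OF eventually_nhds_in_open[of "{0<..}" "1::real"]]) (use homogeneous_l z yu in \<open>auto simp: W_def\<close>)
  ultimately have "((\<lambda>k. l (y, k *\<^sub>R u)) has_real_derivative 2 * l (y, u)) (at 1)"
    by (subst (asm) DERIV_cong_ev) auto
  then show "dd (0, snd z) l z = 2 * l z"
    using DERIV_unique[OF D] yu by simp
qed

text \<open>Differentiate Euler's relation in the direction q: the Euler field moves too and
  contributes the last term. Hence fibre derivatives lower the degree by one and base derivatives
  keep it.\<close>

lemma hom_dd:
  assumes "hom m f" "z \<in> W"
  shows "dd (0, snd z) (dd q f) z = m * dd q f z - dd (0, snd q) f z"
proof -
  have f: "Cinf W f" using assms hom_def by blast
  have D: "((\<lambda>z. dd (0, snd z) f z) has_derivative (\<lambda>q. dd q (dd (0, snd z) f) z + dd (0, snd q) f z)) (at z)"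
    by (rule has_derivative_dd_variable[where \<Phi> = "\<lambda>z. z", OF f assms(2)])
      (auto intro!: derivative_eq_intros)
  moreover have "dd q (\<lambda>z. dd (0, snd z) f z) z = dd q (\<lambda>z. m * f z) z"
    by (rule dd_cong[OF open_W assms(2)]) (use assms hom_def in auto)
  moreover have "dd q (\<lambda>z. m * f z) z = m * dd q f z"
    by (rule dd_eqI) (intro has_derivative_mult_right Cinf_has_derivative[OF f assms(2)])
  ultimately have "dd q (dd (0, snd z) f) z + dd (0, snd q) f z = m * dd q f z"
    using dd_eqI[OF D, of q] by simp
  then show ?thesis using dd_commute[OF f assms(2), of "(0, snd z)" q] by simp
qed

lemma hom_dd_v: "hom m f \<Longrightarrow> hom (m - 1) (dd (0, k) f)"
  using hom_dd[of m f _ "(0, k)"] by (auto simp: hom_def Cinf_dd algebra_simps)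

lemma hom_dd_x:
  assumes "hom m f" shows "hom m (dd (h, 0) f)"
proof -
  have "dd (0, snd z) (dd (h, 0) f) z = m * dd (h, 0) f z" if "z \<in> W" for z
    using hom_dd[OF assms that, of "(h, 0)"] linear_0[OF Cinf_linear_dd, of W f z] assms that
    by (simp add: hom_def zero_prod_def)
  then show ?thesis using assms by (simp add: hom_def Cinf_dd)
qed

lemma homD: "hom m f \<Longrightarrow> z \<in> W \<Longrightarrow> dd (0, snd z) f z = m * f z"
  by (simp add: hom_def)

lemma g_radial: "z \<in> W \<Longrightarrow> g (snd z) k z = dd (0, k) l z"
  using homD[OF hom_dd_v[OF hom_l], of z k] by (simp add: g_def)

lemma g_radial_radial: "z \<in> W \<Longrightarrow> g (snd z) (snd z) z = 2 * l z"
  using g_radial[of z "snd z"] homD[OF hom_l, of z] by simp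

lemma linear_dd_snd: "Cinf S f \<Longrightarrow> z \<in> S \<Longrightarrow> linear (\<lambda>k. dd (0 :: real ^ 'n, k :: real ^ 'n) f z)"
  using linear_compose[OF linear_Pair_snd Cinf_linear_dd, of S f z] by (simp add: o_def)

lemma linear_dd_fst: "Cinf S f \<Longrightarrow> z \<in> S \<Longrightarrow> linear (\<lambda>h. dd (h :: real ^ 'n, 0 :: real ^ 'n) f z)"
  using linear_compose[OF linear_Pair_fst Cinf_linear_dd, of S f z] by (simp add: o_def)

lemma linear_g1: "z \<in> W \<Longrightarrow> linear (\<lambda>k. g k k' z)"
  unfolding g_def by (rule linear_dd_snd[OF smooth_ddl])

lemma linear_g2: 
  assumes "z \<in> W" shows "linear (\<lambda>k'. g k k' z)"
  unfolding g_sym[OF assms, of k] by (rule linear_g1[OF assms])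

lemma g_mat_entry: "g_mat l z $ \<alpha> $ \<beta> = g (axis \<alpha> 1) (axis \<beta> 1) z"
  by (simp add: g_mat_def dv_eq g_def)

lemma g_low_eq: "g_low l \<alpha> \<beta> = g (axis \<alpha> 1) (axis \<beta> 1)"
  by (rule ext) (rule g_mat_entry)

lemma inner_g_mat: 
  assumes "z \<in> W" shows "k \<bullet> (g_mat l z *v k') = g k k' z"
proof -
  have "k \<bullet> (g_mat l z *v k') = (\<Sum>i\<in>UNIV. k $ i * (\<Sum>j\<in>UNIV. k' $ j * g (axis i 1) (axis j 1) z))"
    by (simp add: inner_vec_def matrix_vector_mult_def g_mat_entry mult.commute)
  also have "\<dots> = (\<Sum>i\<in>UNIV. k $ i * g (axis i 1) k' z)"
    using linear_sum_axis[OF linear_g2[OF assms], of _ k'] by simp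
  also have "\<dots> = g k k' z"
    using linear_sum_axis[OF linear_g1[OF assms], of k k'] by simp
  finally show ?thesis .
qed

lemma g_nondegenerate:
  assumes "z \<in> W" "\<And>k. g k w z = g k w' z" shows "w = w'"
proof -
  have "g_mat l z *v w = g_mat l z *v w'"
    using assms(2) by (intro vector_eq_ldot[THEN iffD1]) (simp add: inner_g_mat[OF assms(1)])
  then have "matrix_inv (g_mat l z) *v (g_mat l z *v w) = matrix_inv (g_mat l z) *v (g_mat l z *v w')" by simp
  then show ?thesis
    by (simp add: matrix_vector_mul_assoc matrix_inv_left[OF invertible_g_W[OF assms(1)]])
qed

lemma smooth_g_up: "Cinf W (g_up l \<alpha> \<beta>)"
  by (rule Cinf_matrix_inv[OF open_W]) (simp_all add: g_low_eq smooth_g invertible_g_W)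

lemma smooth_spray: "Cinf W (spray l)"
proof (rule Cinf_vec[OF open_W])
  have snd: "Cinf W (\<lambda>z. snd z $ \<beta>)" for \<beta>
    by (rule Cinf_vec_nth[OF Cinf_linear[OF bounded_linear_snd open_W]])
  have G: "Cinf W (Gamma_tilde l \<alpha> \<beta> \<gamma>)" for \<alpha> \<beta> \<gamma>
    unfolding Gamma_tilde_def dx_eq g_low_eq
    by (intro Cinf_sum Cinf_mult Cinf_add Cinf_diff Cinf_const smooth_g_up Cinf_dd smooth_g open_W)
  show "Cinf W (\<lambda>z. spray l z $ \<alpha>)" for \<alpha>
    unfolding spray_def vec_lambda_beta by (intro Cinf_sum Cinf_mult Cinf_const snd G open_W)
qed

lemma smooth_G: "Cinf W G" by (simp add: G_def smooth_spray)
lemma smooth_NN: "Cinf W (NN w)" unfolding NN_def by (rule Cinf_dd[OF smooth_G])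

lemma smooth_spray_field:
  assumes "S \<subseteq> W" "open S"
  shows "Cinf S (\<lambda>z. (snd z, - 2 *\<^sub>R G z))"
proof -
  have "Cinf S (\<lambda>z. (snd z, 0 :: real ^ 'n) + (0 :: real ^ 'n, - 2 *\<^sub>R G z))"
  proof (rule Cinf_add)
    show "Cinf S (\<lambda>z. (snd z, 0 :: real ^ 'n))"
      by (rule Cinf_linear[OF _ assms(2)]) (intro bounded_linear_intros)
    show "Cinf S (\<lambda>z. (0 :: real ^ 'n, - 2 *\<^sub>R G z))"
      by (rule Cinf_bounded_linear[OF _ Cinf_subset[OF smooth_G assms], where h = "\<lambda>w. (0 :: real ^ 'n, - 2 *\<^sub>R w)"])
        (intro bounded_linear_intros)
  qed
  then show ?thesis by simp
qed

lemma smooth_SS: "Cinf S f \<Longrightarrow> S \<subseteq> W \<Longrightarrow> Cinf S (SS f)"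
  unfolding SS_def[abs_def] by (rule Cinf_dd_variable[OF _ smooth_spray_field[OF _ Cinf_openD]])

text \<open>Here \<open>snd z\<close> is a frozen vector. Symmetry of third derivatives moves it to
  the front, where Euler's relation for the degree 1 function \<open>dd (0, k) l\<close> applies. In
  a fibre direction everything cancels (\<open>dv_g_radial\<close>), in a base direction
  \<open>b\<close> remains (\<open>dx_g_radial\<close>).\<close>

lemma T3_radial:
  fixes p :: "(real ^ 'n) \<times> (real ^ 'n)"
  assumes "z \<in> W"
  shows "dd p (g k (snd z)) z = dd p (dd (0, k) l) z - dd (0, snd p) (dd (0, k) l) z"
proof -
  have "dd p (g k (snd z)) z = dd (0, snd z) (dd p (dd (0, k) l)) z"
    unfolding g_def dd_l_commute_fun[OF assms, of p "(0, k)"] by (rule dd_l_commute_outer[OF assms])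
  then show ?thesis using hom_dd[OF hom_dd_v[OF hom_l] assms, where q = p] by simp
qed

lemma dx_g_radial: "z \<in> W \<Longrightarrow> dd (h, 0) (g k (snd z)) z = b h k z"
  using T3_radial[of z "(h, 0)" k] linear_0[OF Cinf_linear_dd[OF smooth_ddl], of z]
  by (simp add: b_def zero_prod_def)

lemma dx_radial_g: "z \<in> W \<Longrightarrow> dd (h, 0) (g (snd z) k) z = b h k z"
  using dx_g_radial dd_cong[OF open_W, of z "g k (snd z)" "g (snd z) k" "(h, 0)"] g_sym by simp

lemma dv_g_radial: "z \<in> W \<Longrightarrow> dd (0, h) (g k (snd z)) z = 0"
  using T3_radial[of z "(0, h)" k] by simp

lemma b_radial: "z \<in> W \<Longrightarrow> b h (snd z) z = 2 * dd (h, 0) l z"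
  using dd_l_commute[of z "(h, 0)" "(0, snd z)"] homD[OF hom_dd_x[OF hom_l], of z h] by (simp add: b_def)

text \<open>Contract the three terms of \<open>Gamma_tilde\<close> twice with v: by homogeneity the
  first two become \<open>b v k\<close> each and the third \<open>2 * dd (k, 0) l\<close>. As
  \<open>g\<close> is nondegenerate, the identity determines \<open>G\<close>.\<close>

lemma spray_Euler_Lagrange:
  assumes z: "z \<in> W"
  shows "2 * g k (G z) z = b (snd z) k z - dd (k, 0) l z"
proof -
  define v where "v = snd z"
  have lin1: "linear (\<lambda>h. dd (h, 0) (g k k') z)" for k k' by (rule linear_dd_fst[OF smooth_g z])
  have lin2: "linear (\<lambda>k. dd p (g k k') z)" for p k'
    unfolding g_def dd_l_commute_fun[OF z, of p _ "(0, k')"]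
    using linear_compose[OF linear_Pair_snd linear_dd_dd_dd[OF smooth_l_W z]] by (simp add: o_def)
  have lin3: "linear (\<lambda>k'. dd p (g k k') z)" for p k
  proof -
    have "dd p (g k k') z = dd p (g k' k) z" for k' by (rule dd_cong[OF open_W z g_sym])
    then show ?thesis using lin2[of p k] by simp
  qed
  define w where "w = (\<chi> \<delta>. 2 * (b v (axis \<delta> 1) z - dd (axis \<delta> 1, 0) l z))"
  have w: "w $ \<delta> = (\<Sum>\<beta>\<in>UNIV. \<Sum>\<gamma>\<in>UNIV. (dx \<beta> (g_low l \<delta> \<gamma>) z + dx \<gamma> (g_low l \<beta> \<delta>) z - dx \<delta> (g_low l \<beta> \<gamma>) z)
      * v $ \<beta> * v $ \<gamma>)" for \<delta>
  proof -
    let ?T = "\<lambda>h k k'. dd (h, 0) (g k k') z"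
    have e1: "?T v k k' = (\<Sum>i\<in>UNIV. v $ i * ?T (axis i 1) k k')" for k k'
      using linear_sum_axis[OF lin1[of k k'], of v] by simp
    have e2: "?T h v k' = (\<Sum>i\<in>UNIV. v $ i * ?T h (axis i 1) k')" for h k'
      using linear_sum_axis[OF lin2[of "(h, 0)" k'], of v] by simp
    have e3: "?T h k v = (\<Sum>i\<in>UNIV. v $ i * ?T h k (axis i 1))" for h k
      using linear_sum_axis[OF lin3[of "(h, 0)" k], of v] by simp
    have 1: "(\<Sum>\<beta>\<in>UNIV. \<Sum>\<gamma>\<in>UNIV. ?T (axis \<beta> 1) (axis \<delta> 1) (axis \<gamma> 1) * v $ \<beta> * v $ \<gamma>) = ?T v (axis \<delta> 1) v"
      by (subst e1) (simp add: e3 sum_distrib_left mult.commute mult.left_commute)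
    have 2: "(\<Sum>\<beta>\<in>UNIV. \<Sum>\<gamma>\<in>UNIV. ?T (axis \<gamma> 1) (axis \<beta> 1) (axis \<delta> 1) * v $ \<beta> * v $ \<gamma>) = ?T v v (axis \<delta> 1)"
      by (subst e2) (simp add: e1 sum_distrib_left mult.commute mult.left_commute)
    have 3: "(\<Sum>\<beta>\<in>UNIV. \<Sum>\<gamma>\<in>UNIV. ?T (axis \<delta> 1) (axis \<beta> 1) (axis \<gamma> 1) * v $ \<beta> * v $ \<gamma>) = ?T (axis \<delta> 1) v v"
      by (subst e2) (simp add: e3 sum_distrib_left mult.commute mult.left_commute)
    show ?thesis
      unfolding dx_eq g_low_eq left_diff_distrib distrib_right sum_subtractf sum.distrib 1 2 3
      using dx_g_radial[OF z] dx_radial_g[OF z] b_radial[OF z] by (simp add: w_def v_def)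
  qed
  \<comment> \<open>The 4 undoes the two factors 1 / 2, one in \<open>spray_def\<close> and one in
    \<open>Gamma_tilde_def\<close>.\<close>
  have "4 *\<^sub>R G z = matrix_inv (g_mat l z) *v w"
  proof (rule vec_eq_iff[THEN iffD2], rule allI)
    fix \<alpha>
    have "4 * G z $ \<alpha> = (\<Sum>\<beta>\<in>UNIV. \<Sum>\<gamma>\<in>UNIV. \<Sum>\<delta>\<in>UNIV. g_up l \<alpha> \<delta> z * ((dx \<beta> (g_low l \<delta> \<gamma>) z + dx \<gamma> (g_low l \<beta> \<delta>) z - dx \<delta> (g_low l \<beta> \<gamma>) z)
      * v $ \<beta> * v $ \<gamma>))"
      by (simp add: G_def spray_def Gamma_tilde_def v_def sum_distrib_left sum_distrib_right mult.assoc)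
    also have "\<dots> = (\<Sum>\<beta>\<in>UNIV. \<Sum>\<delta>\<in>UNIV. \<Sum>\<gamma>\<in>UNIV. g_up l \<alpha> \<delta> z * ((dx \<beta> (g_low l \<delta> \<gamma>) z + dx \<gamma> (g_low l \<beta> \<delta>) z - dx \<delta> (g_low l \<beta> \<gamma>) z)
      * v $ \<beta> * v $ \<gamma>))"
      by (intro sum.cong refl sum.swap)
    also have "\<dots> = (\<Sum>\<delta>\<in>UNIV. \<Sum>\<beta>\<in>UNIV. \<Sum>\<gamma>\<in>UNIV. g_up l \<alpha> \<delta> z * ((dx \<beta> (g_low l \<delta> \<gamma>) z + dx \<gamma> (g_low l \<beta> \<delta>) z - dx \<delta> (g_low l \<beta> \<gamma>) z)
      * v $ \<beta> * v $ \<gamma>))"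
      by (rule sum.swap)
    also have "\<dots> = (\<Sum>\<delta>\<in>UNIV. g_up l \<alpha> \<delta> z * w $ \<delta>)"
      unfolding w by (simp add: sum_distrib_left)
    finally show "(4 *\<^sub>R G z) $ \<alpha> = (matrix_inv (g_mat l z) *v w) $ \<alpha>"
      by (simp add: matrix_vector_mult_def)
  qed
  then have "g_mat l z *v (4 *\<^sub>R G z) = w"
    by (simp add: matrix_vector_mul_assoc matrix_inv_right[OF invertible_g_W[OF z]])
  then have "k \<bullet> w = 4 * g k (G z) z"
    using inner_g_mat[OF z, of k "4 *\<^sub>R G z"] linear_cmul[OF linear_g2[OF z]] by simp
  moreover have "k \<bullet> w = 2 * (b v k z - dd (k, 0) l z)"
  proof -
    have lb: "linear (\<lambda>k. b v k z)"
      unfolding b_def using linear_compose[OF linear_Pair_snd linear_dd_dd[OF smooth_l_W z]]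
      by (simp add: o_def)
    show ?thesis
      using linear_sum_axis[OF lb, of k] linear_sum_axis[OF linear_dd_fst[OF smooth_l_W z], of k]
      by (simp add: w_def inner_vec_def right_diff_distrib sum_subtractf sum_distrib_left mult.left_commute)
  qed
  ultimately show ?thesis by (simp add: v_def)
qed


section \<open>Nonlinear connection and curvature as derivatives of the spray\<close>

lemma SS_eq:
  fixes f :: "(real ^ 'n) \<times> (real ^ 'n) \<Rightarrow> 'b::real_normed_vector"
  assumes "Cinf W f" "z \<in> W"
  shows "SS f z = dd (snd z, 0) f z - 2 *\<^sub>R dd (0, G z) f z"
proof -
  have "(snd z, - 2 *\<^sub>R G z) = (snd z, 0) - 2 *\<^sub>R (0, G z)" by simp
  then show ?thesis
    unfolding SS_def
    by (simp only: linear_diff[OF Cinf_linear_dd[OF assms]] linear_cmul[OF Cinf_linear_dd[OF assms]])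
qed

lemma linear_NN: "z \<in> W \<Longrightarrow> linear (\<lambda>w. NN w z)"
  unfolding NN_def by (rule linear_dd_snd[OF smooth_G])

text \<open>Fibre directions q give the formula for \<open>NN\<close> (\<open>g_NN\<close>), base
  directions the one for the base derivatives of \<open>G\<close> (\<open>g_dx_G\<close>).\<close>

lemma dd_Euler_Lagrange:
  assumes z: "z \<in> W"
  shows "2 * (dd q (dd (0, G z) (dd (0, k) l)) z + g k (dd q G z) z)
    = dd q (dd (snd z, 0) (dd (0, k) l)) z + b (snd q) k z - dd q (dd (k, 0) l) z"
proof -
  have 1: "((\<lambda>z. dd (0, G z) (dd (0, k) l) z) has_derivative
      (\<lambda>q. dd q (dd (0, G z) (dd (0, k) l)) z + dd (0, dd q G z) (dd (0, k) l) z)) (at z)"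
    by (rule has_derivative_dd_variable[where \<Phi> = "\<lambda>z. z", OF smooth_ddl z])
      (auto intro!: derivative_eq_intros Cinf_has_derivative[OF smooth_G z])
  have 2: "((\<lambda>z. dd (snd z, 0) (dd (0, k) l) z) has_derivative
      (\<lambda>q. dd q (dd (snd z, 0) (dd (0, k) l)) z + dd (snd q, 0) (dd (0, k) l) z)) (at z)"
    by (rule has_derivative_dd_variable[where \<Phi> = "\<lambda>z. z", OF smooth_ddl z])
      (auto intro!: derivative_eq_intros)
  have L: "dd q (\<lambda>z. 2 * dd (0, G z) (dd (0, k) l) z) z
      = 2 * (dd q (dd (0, G z) (dd (0, k) l)) z + dd (0, dd q G z) (dd (0, k) l) z)"
    by (rule dd_eqI[OF has_derivative_mult_right[OF 1]])
  have R: "dd q (\<lambda>z. dd (snd z, 0) (dd (0, k) l) z - dd (k, 0) l z) z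
      = dd q (dd (snd z, 0) (dd (0, k) l)) z + dd (snd q, 0) (dd (0, k) l) z - dd q (dd (k, 0) l) z"
    by (rule dd_eqI[OF has_derivative_diff[OF 2 Cinf_has_derivative[OF smooth_ddl z]]])
  have "dd q (\<lambda>z. 2 * dd (0, G z) (dd (0, k) l) z) z = dd q (\<lambda>z. dd (snd z, 0) (dd (0, k) l) z - dd (k, 0) l z) z"
  proof (rule dd_cong[OF open_W z])
    fix y assume y: "y \<in> W"
    show "2 * dd (0, G y) (dd (0, k) l) y = dd (snd y, 0) (dd (0, k) l) y - dd (k, 0) l y"
      using spray_Euler_Lagrange[OF y, of k] by (simp add: g_sym[OF y, of k] b_def) (simp add: g_def)
  qed
  then show ?thesis
    unfolding L R by (simp add: b_def g_sym[OF z, of k]) (simp add: g_def)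
qed

lemma SS_g:
  assumes z: "z \<in> W"
  shows "SS (g k k') z = dd (0, k') (dd (snd z, 0) (dd (0, k) l)) z - 2 * dd (0, k') (dd (0, G z) (dd (0, k) l)) z"
  unfolding SS_eq[OF smooth_g z]
  using dd_l_commute_fun[OF z] dd_l_commute_outer[OF z] by (simp add: g_def)

text \<open>The right-hand side splits into a part symmetric in k, k' and the antisymmetric
  difference of the two \<open>b\<close>. The first becomes metric compatibility,
  \<open>SS_g_compatible\<close>; the second drives the symmetry of the curvature.\<close>

lemma g_NN:
  assumes z: "z \<in> W"
  shows "2 * g k (NN k' z) z = SS (g k k') z + b k' k z - b k k' z"
  using dd_Euler_Lagrange[OF z, of "(0, k')" k] SS_g[OF z, of k k'] dd_l_commute[OF z, of "(0, k')" "(k, 0)"]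
  by (simp add: NN_def b_def)

lemma g_dx_G:
  assumes z: "z \<in> W"
  shows "2 * g k (dd (h, 0) G z) z = SS (b h k) z - dd (h, 0) (dd (k, 0) l) z"
proof -
  have "b 0 k z = 0"
    using linear_0[OF linear_dd_fst[OF smooth_ddl z]] by (simp add: b_def)
  moreover have "SS (b h k) z = dd (h, 0) (dd (snd z, 0) (dd (0, k) l)) z - 2 * dd (h, 0) (dd (0, G z) (dd (0, k) l)) z"
    unfolding SS_eq[OF smooth_b z] using dd_l_commute_outer[OF z] by (simp add: b_def)
  ultimately show ?thesis using dd_Euler_Lagrange[OF z, of "(h, 0)" k] by simp
qed

lemma SS_g_compatible:
  assumes z: "z \<in> W"
  shows "SS (g k k') z = g k (NN k' z) z + g (NN k z) k' z"
proof -
  have "SS (g k k') z = SS (g k' k) z"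
    unfolding SS_def by (rule dd_cong[OF open_W z g_sym])
  then show ?thesis
    using g_NN[OF z, of k k'] g_NN[OF z, of k' k] g_sym[OF z, of "NN k z" k'] by simp
qed

text \<open>This is Euler's relation for \<open>G\<close>, of degree 2. It is read off from
  \<open>g_NN\<close> at k' = v, where the derivatives of \<open>g\<close> collapse to
  \<open>b\<close>, and nondegeneracy removes the test vector k.\<close>

lemma NN_radial:
  assumes z: "z \<in> W"
  shows "NN (snd z) z = 2 *\<^sub>R G z"
proof (rule g_nondegenerate[OF z])
  fix k
  have "SS (g k (snd z)) z = b (snd z) k z"
    using SS_eq[OF smooth_g z, of k "snd z"] dx_g_radial[OF z] dv_g_radial[OF z] by simp
  then have "2 * g k (NN (snd z) z) z = 4 * g k (G z) z"
    using g_NN[OF z, of k "snd z"] b_radial[OF z] spray_Euler_Lagrange[OF z, of k] by simp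
  then show "g k (NN (snd z) z) z = g k (2 *\<^sub>R G z) z"
    using linear_cmul[OF linear_g2[OF z], of k 2 "G z"] by simp
qed

text \<open>Differentiate \<open>NN v = 2 G\<close> along the spray. The moving v contributes
  \<open>NN\<close> of \<open>- 2 G\<close>, and together with \<open>NN (NN v) = 2 NN G\<close> all
  terms of \<open>RR v\<close> cancel.\<close>

lemma RR_radial:
  assumes z: "z \<in> W"
  shows "RR (snd z) z = 0"
proof -
  define s where "s = (snd z, - 2 *\<^sub>R G z)"
  have D: "((\<lambda>z. dd (0, snd z) G z) has_derivative (\<lambda>q. dd q (dd (0, snd z) G) z + dd (0, snd q) G z)) (at z)"
    by (rule has_derivative_dd_variable[where \<Phi> = "\<lambda>z. z", OF smooth_G z])
      (auto intro!: derivative_eq_intros)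
  have "dd s (\<lambda>z. dd (0, snd z) G z) z = dd s (\<lambda>z. 2 *\<^sub>R G z) z"
    by (rule dd_cong[OF open_W z]) (use NN_radial in \<open>simp add: NN_def\<close>)
  moreover have "dd s (\<lambda>z. 2 *\<^sub>R G z) z = 2 *\<^sub>R dd s G z"
    by (rule dd_eqI) (intro has_derivative_scaleR_right Cinf_has_derivative[OF smooth_G z])
  ultimately have 1: "dd s (dd (0, snd z) G) z + dd (0, - 2 *\<^sub>R G z) G z = 2 *\<^sub>R dd s G z"
    using dd_eqI[OF D, of s] by (simp add: s_def)
  have 2: "dd s G z = dd (snd z, 0) G z - 2 *\<^sub>R NN (G z) z"
    using SS_eq[OF smooth_G z] by (simp add: SS_def s_def NN_def)
  have 3: "dd (0, - 2 *\<^sub>R G z) G z = - 2 *\<^sub>R NN (G z) z"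
    using linear_cmul[OF linear_NN[OF z], of "-2" "G z"] by (simp add: NN_def)
  have 4: "NN (NN (snd z) z) z = 2 *\<^sub>R NN (G z) z"
    unfolding NN_radial[OF z] using linear_cmul[OF linear_NN[OF z], of 2 "G z"] by simp
  have "SS (NN (snd z)) z - 2 *\<^sub>R NN (G z) z = 2 *\<^sub>R (dd (snd z, 0) G z - 2 *\<^sub>R NN (G z) z)"
    using 1 unfolding 2 3 by (simp add: SS_def s_def NN_def)
  then show ?thesis unfolding RR_def 4 by (simp add: vec_eq_iff algebra_simps)
qed

text \<open>Only the antisymmetric part of \<open>g k (NN h)\<close> is needed: by \<open>g_NN\<close> it is that of \<open>b\<close>.\<close>

lemma RR_symmetric:
  assumes z: "z \<in> W"
  shows "g k (RR h z) z = g (RR k z) h z"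
proof -
  define s where "s = (snd z, - 2 *\<^sub>R G z)"
  \<comment> \<open>\<open>F k h\<close> is \<open>g k (NN h)\<close>, written as a derivative of l
    in the moving direction \<open>NN h z\<close> so that the product rule applies.\<close>
  define F where "F k h z = dd (0, NN h z) (dd (0, k) l) z" for k h z
  have F: "F k h y = g k (NN h y) y" if "y \<in> W" for k h y
    using g_sym[OF that, of k "NN h y"] by (simp add: F_def g_def)
  have DF: "(F k h has_derivative (\<lambda>q. dd q (g (NN h z) k) z + g (dd q (NN h) z) k z)) (at z)" for k h
    unfolding F_def g_def
    by (rule has_derivative_dd_variable[where \<Phi> = "\<lambda>z. z", OF smooth_ddl z])
      (auto intro!: derivative_eq_intros Cinf_has_derivative[OF smooth_NN z])
  have SF: "dd s (F k h) z = g (NN h z) (NN k z) z + g (NN (NN h z) z) k z + g (SS (NN h) z) k z" for k h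
    using dd_eqI[OF DF, of s k h] SS_g_compatible[OF z, of "NN h z" k] by (simp add: SS_def s_def)
  have "dd s (\<lambda>y. F k h y - F h k y) z = dd s (\<lambda>y. b h k y - b k h y) z"
  proof (rule dd_cong[OF open_W z])
    fix y assume y: "y \<in> W"
    have "SS (g k h) y = SS (g h k) y"
      unfolding SS_def by (rule dd_cong[OF open_W y g_sym])
    then show "F k h y - F h k y = b h k y - b k h y"
      unfolding F[OF y] using g_NN[OF y, of k h] g_NN[OF y, of h k] by simp
  qed
  moreover have "dd s (\<lambda>y. F k h y - F h k y) z = dd s (F k h) z - dd s (F h k) z"
    using dd_eqI[OF has_derivative_diff[OF DF DF], of s] dd_eqI[OF DF] by simp
  moreover have "dd s (\<lambda>y. b h k y - b k h y) z = SS (b h k) z - SS (b k h) z"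
    using dd_eqI[OF has_derivative_diff[OF Cinf_has_derivative[OF smooth_b z] Cinf_has_derivative[OF smooth_b z]], of s]
    by (simp add: SS_def s_def)
  ultimately have A: "dd s (F k h) z - dd s (F h k) z = SS (b h k) z - SS (b k h) z" by simp
  have R: "g k (RR h z) z = SS (b h k) z - dd (h, 0) (dd (k, 0) l) z + g (NN h z) (NN k z) z - dd s (F k h) z" for k h
  proof -
    note lin = linear_g2[OF z, of k]
    have "g k (RR h z) z = 2 * g k (dd (h, 0) G z) z - g k (SS (NN h) z) z - g k (NN (NN h z) z) z"
      unfolding RR_def by (simp add: linear_diff[OF lin] linear_cmul[OF lin])
    then show ?thesis
      using SF[of k h] g_dx_G[OF z, of k h] g_sym[OF z, of k "SS (NN h) z"] g_sym[OF z, of k "NN (NN h z) z"] by simp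
  qed
  \<comment> \<open>Two terms of \<open>R\<close> are symmetric in h and k; the exchange of the
    other two, \<open>SS (b h k)\<close> and \<open>dd s (F k h)\<close>, is exactly
    \<open>A\<close>.\<close>
  have "g k (RR h z) z = g h (RR k z) z"
    unfolding R using A dd_l_commute[OF z, of "(h, 0)" "(k, 0)"] g_sym[OF z, of "NN h z" "NN k z"] by simp
  then show ?thesis using g_sym[OF z] by simp
qed

section \<open>Comparison with the index formulas for the connection and the curvature\<close>

lemma dd_vec_nth:
  fixes f :: "'a::euclidean_space \<Rightarrow> real ^ 'k"
  assumes "f differentiable (at x)"
  shows "dd p (\<lambda>x. f x $ i) x = dd p f x $ i"
  by (rule dd_bounded_linear[OF bounded_linear_vec_nth assms])

lemma N_conn_eq: "z \<in> W \<Longrightarrow> N_conn l \<alpha> \<beta> z = NN (axis \<beta> 1) z $ \<alpha>"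
  unfolding N_conn_def dv_eq NN_def G_def
  by (rule dd_vec_nth[OF Cinf_differentiable[OF smooth_spray]])

lemma sum_N_conn:
  assumes "z \<in> W" shows "(\<Sum>\<beta>\<in>UNIV. N_conn l \<alpha> \<beta> z * w $ \<beta>) = NN w z $ \<alpha>"
  using linear_sum_axis[OF linear_NN[OF assms], of w]
  by (simp add: N_conn_eq[OF assms] mult.commute)

lemma R_mat_eq:
  assumes z: "z \<in> W"
  shows "R_mat l z *v w = RR w z"
proof (rule vec_eq_iff[THEN iffD2], rule allI)
  fix \<alpha>
  have dN: "dd p (N_conn l \<alpha> \<beta>) z = dd p (NN (axis \<beta> 1)) z $ \<alpha>" for p \<beta>
  proof -
    have "dd p (N_conn l \<alpha> \<beta>) z = dd p (\<lambda>z. NN (axis \<beta> 1) z $ \<alpha>) z"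
      by (rule dd_cong[OF open_W z N_conn_eq])
    then show ?thesis by (simp add: dd_vec_nth[OF Cinf_differentiable[OF smooth_NN z]])
  qed
  have SN: "(\<Sum>\<gamma>\<in>UNIV. dx \<gamma> (N_conn l \<alpha> \<beta>) z * snd z $ \<gamma> - 2 * dv \<gamma> (N_conn l \<alpha> \<beta>) z * spray l z $ \<gamma>)
      = SS (NN (axis \<beta> 1)) z $ \<alpha>" for \<beta>
  proof -
    note lx = linear_sum_axis[OF linear_dd_fst[OF smooth_NN z], of "snd z" "axis \<beta> 1"]
    note lv = linear_sum_axis[OF linear_dd_snd[OF smooth_NN z], of "G z" "axis \<beta> 1"]
    show ?thesis
      unfolding SS_eq[OF smooth_NN z] lx lv dx_eq dv_eq dN
      by (simp add: sum_subtractf sum_distrib_left mult.commute mult.left_commute G_def)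
  qed
  have lSS: "linear (\<lambda>w. SS (NN w) z)"
    unfolding SS_def NN_def
    using linear_compose[OF linear_Pair_snd linear_dd_dd[OF smooth_G z]] by (simp add: o_def)
  have "(R_mat l z *v w) $ \<alpha> = (\<Sum>\<beta>\<in>UNIV. (2 * dd (axis \<beta> 1, 0) G z $ \<alpha> - SS (NN (axis \<beta> 1)) z $ \<alpha>
     - NN (NN (axis \<beta> 1) z) z $ \<alpha>) * w $ \<beta>)"
    unfolding matrix_vector_mult_def R_mat_def vec_lambda_beta SN N_conn_eq[OF z, of _ _, symmetric]
    using sum_N_conn[OF z, of \<alpha> "NN (axis _ 1) z"] dd_vec_nth[OF Cinf_differentiable[OF smooth_G z]]
    by (simp add: N_conn_eq[OF z] dx_eq G_def)
  also have "\<dots> = RR w z $ \<alpha>"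
    using linear_sum_axis[OF linear_dd_fst[OF smooth_G z], of w] linear_sum_axis[OF lSS, of w]
      linear_sum_axis[OF linear_compose[OF linear_NN[OF z] linear_NN[OF z], unfolded o_def], of w]
    by (simp add: RR_def left_diff_distrib right_diff_distrib sum_subtractf sum_distrib_left mult.commute mult.left_commute)
  finally show "(R_mat l z *v w) $ \<alpha> = RR w z $ \<alpha>" .
qed

text \<open>Contracted with v, the Chern connection reduces to the nonlinear one. After lowering the
  index, two of the three corrections by fibre derivatives of \<open>g\<close> have v in a slot and
  vanish; the third involves \<open>NN v = 2 G\<close> and completes the base derivative of
  \<open>g\<close> along v to the \<open>SS\<close> term of \<open>g_NN\<close>.\<close>

lemma Gamma_contraction:
  assumes z: "z \<in> W"
  shows "(\<Sum>\<beta>\<in>UNIV. \<Sum>\<gamma>\<in>UNIV. Gamma l \<alpha> \<beta> \<gamma> z * snd z $ \<beta> * Y $ \<gamma>) = NN Y z $ \<alpha>"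
proof -
  define v where "v = snd z"
  have lin1: "linear (\<lambda>h. dd (h, 0) (g k k') z)" for k k' by (rule linear_dd_fst[OF smooth_g z])
  have lin1': "linear (\<lambda>h. dd (0, h) (g k k') z)" for k k' by (rule linear_dd_snd[OF smooth_g z])
  have lin2: "linear (\<lambda>k. dd p (g k k') z)" for p k'
    unfolding g_def dd_l_commute_fun[OF z, of p _ "(0, k')"]
    using linear_compose[OF linear_Pair_snd linear_dd_dd_dd[OF smooth_l_W z]] by (simp add: o_def)
  have gs: "dd p (g k k') z = dd p (g k' k) z" for p k k' by (rule dd_cong[OF open_W z g_sym])
  have lin3: "linear (\<lambda>k'. dd p (g k k') z)" for p k
    unfolding gs[of p k] by (rule lin2)
  have lNN: "linear (\<lambda>w. dd (0, NN w z) (g k k') z)" for k k'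
    using linear_compose[OF linear_NN[OF z] lin1'] by (simp add: o_def)
  let ?T = "\<lambda>h k k'. dd (h, 0) (g k k') z"
  let ?V = "\<lambda>h k k'. dd (0, h) (g k k') z"
  have e1: "?T h k k' = (\<Sum>i\<in>UNIV. h $ i * ?T (axis i 1) k k')" for h k k'
    using linear_sum_axis[OF lin1[of k k'], of h] by simp
  have e2: "dd p (g k k') z = (\<Sum>i\<in>UNIV. k $ i * dd p (g (axis i 1) k') z)" for p k k'
    using linear_sum_axis[OF lin2[of p k'], of k] by simp
  have e3: "dd p (g k k') z = (\<Sum>i\<in>UNIV. k' $ i * dd p (g k (axis i 1)) z)" for p k k'
    using linear_sum_axis[OF lin3[of p k], of k'] by simp
  have e4: "?V (NN h z) k k' = (\<Sum>i\<in>UNIV. h $ i * ?V (NN (axis i 1) z) k k')" for h k k'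
    using linear_sum_axis[OF lNN[of k k'], of h] by simp
  have e5: "(\<Sum>\<mu>\<in>UNIV. dv \<mu> (g_low l \<alpha> \<beta>) z * N_conn l \<mu> \<gamma> z) = ?V (NN (axis \<gamma> 1) z) (axis \<alpha> 1) (axis \<beta> 1)" for \<alpha> \<beta> \<gamma>
    using linear_sum_axis[OF lin1', of "NN (axis \<gamma> 1) z" "axis \<alpha> 1" "axis \<beta> 1"]
    by (simp add: dv_eq g_low_eq N_conn_eq[OF z] mult.commute)
  define w where "w = g_mat l z *v NN Y z"
  have "w $ \<delta> = (\<Sum>\<beta>\<in>UNIV. \<Sum>\<gamma>\<in>UNIV. 1 / 2 * ((dx \<beta> (g_low l \<delta> \<gamma>) z + dx \<gamma> (g_low l \<beta> \<delta>) z - dx \<delta> (g_low l \<beta> \<gamma>) z)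
      - (\<Sum>\<mu>\<in>UNIV. dv \<mu> (g_low l \<delta> \<gamma>) z * N_conn l \<mu> \<beta> z + dv \<mu> (g_low l \<beta> \<delta>) z * N_conn l \<mu> \<gamma> z
      - dv \<mu> (g_low l \<beta> \<gamma>) z * N_conn l \<mu> \<delta> z)) * v $ \<beta> * Y $ \<gamma>)" for \<delta>
  proof -
    let ?d = "axis \<delta> 1 :: real ^ 'n"
    have 1: "(\<Sum>\<beta>\<in>UNIV. \<Sum>\<gamma>\<in>UNIV. ?T (axis \<beta> 1) ?d (axis \<gamma> 1) * v $ \<beta> * Y $ \<gamma>) = ?T v ?d Y"
      by (subst e1) (simp add: e3[of _ ?d Y] sum_distrib_left mult.commute mult.left_commute)
    have 2: "(\<Sum>\<beta>\<in>UNIV. \<Sum>\<gamma>\<in>UNIV. ?T (axis \<gamma> 1) (axis \<beta> 1) ?d * v $ \<beta> * Y $ \<gamma>) = ?T Y v ?d"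
      by (subst e2) (simp add: e1[of Y] sum_distrib_left mult.commute mult.left_commute)
    have 3: "(\<Sum>\<beta>\<in>UNIV. \<Sum>\<gamma>\<in>UNIV. ?T ?d (axis \<beta> 1) (axis \<gamma> 1) * v $ \<beta> * Y $ \<gamma>) = ?T ?d v Y"
      by (subst e2) (simp add: e3[of _ _ Y] sum_distrib_left mult.commute mult.left_commute)
    have 4: "(\<Sum>\<beta>\<in>UNIV. \<Sum>\<gamma>\<in>UNIV. ?V (NN (axis \<beta> 1) z) ?d (axis \<gamma> 1) * v $ \<beta> * Y $ \<gamma>) = ?V (NN v z) ?d Y"
      by (subst e4) (simp add: e3[of _ ?d Y] sum_distrib_left mult.commute mult.left_commute)
    have 5: "(\<Sum>\<beta>\<in>UNIV. \<Sum>\<gamma>\<in>UNIV. ?V (NN (axis \<gamma> 1) z) (axis \<beta> 1) ?d * v $ \<beta> * Y $ \<gamma>) = ?V (NN Y z) v ?d"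
      by (subst e2) (simp add: e4[of Y] sum_distrib_left mult.commute mult.left_commute)
    have 6: "(\<Sum>\<beta>\<in>UNIV. \<Sum>\<gamma>\<in>UNIV. ?V (NN ?d z) (axis \<beta> 1) (axis \<gamma> 1) * v $ \<beta> * Y $ \<gamma>) = ?V (NN ?d z) v Y"
      by (subst e2) (simp add: e3[of _ _ Y] sum_distrib_left mult.commute mult.left_commute)
    have "(\<Sum>\<beta>\<in>UNIV. \<Sum>\<gamma>\<in>UNIV. 1 / 2 * ((dx \<beta> (g_low l \<delta> \<gamma>) z + dx \<gamma> (g_low l \<beta> \<delta>) z - dx \<delta> (g_low l \<beta> \<gamma>) z)
      - (\<Sum>\<mu>\<in>UNIV. dv \<mu> (g_low l \<delta> \<gamma>) z * N_conn l \<mu> \<beta> z + dv \<mu> (g_low l \<beta> \<delta>) z * N_conn l \<mu> \<gamma> z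
      - dv \<mu> (g_low l \<beta> \<gamma>) z * N_conn l \<mu> \<delta> z)) * v $ \<beta> * Y $ \<gamma>)
      = 1 / 2 * ((?T v ?d Y + ?T Y v ?d - ?T ?d v Y) - (?V (NN v z) ?d Y + ?V (NN Y z) v ?d - ?V (NN ?d z) v Y))"
      unfolding sum.distrib sum_subtractf e5 1[symmetric] 2[symmetric] 3[symmetric] 4[symmetric] 5[symmetric] 6[symmetric]
      by (simp only: dx_eq g_low_eq left_diff_distrib distrib_right right_diff_distrib distrib_left sum.distrib sum_subtractf
          mult.assoc sum_distrib_left)
    also have "?V (NN v z) ?d Y = 2 * ?V (G z) ?d Y"
      using linear_cmul[OF lin1', of "2" "G z" ?d Y] unfolding v_def NN_radial[OF z] by simp
    also have "?V (NN Y z) v ?d = 0"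
      unfolding gs[of _ v] by (simp add: v_def dv_g_radial[OF z])
    also have "?V (NN ?d z) v Y = 0"
      unfolding gs[of _ v] by (simp add: v_def dv_g_radial[OF z])
    also have "1 / 2 * ((?T v ?d Y + ?T Y v ?d - ?T ?d v Y) - (2 * ?V (G z) ?d Y + 0 - 0)) = g ?d (NN Y z) z"
      using g_NN[OF z, of ?d Y] SS_eq[OF smooth_g z, of ?d Y] dx_radial_g[OF z]
      by (simp add: v_def)
    also have "\<dots> = w $ \<delta>"
      using inner_g_mat[OF z, of ?d "NN Y z"] by (simp add: w_def inner_axis' )
    finally show ?thesis by simp
  qed
  note w = this
  have "(\<Sum>\<beta>\<in>UNIV. \<Sum>\<gamma>\<in>UNIV. Gamma l \<alpha> \<beta> \<gamma> z * v $ \<beta> * Y $ \<gamma>) =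
    (\<Sum>\<beta>\<in>UNIV. \<Sum>\<gamma>\<in>UNIV. \<Sum>\<delta>\<in>UNIV. g_up l \<alpha> \<delta> z * (1 / 2 * ((dx \<beta> (g_low l \<delta> \<gamma>) z + dx \<gamma> (g_low l \<beta> \<delta>) z - dx \<delta> (g_low l \<beta> \<gamma>) z)
      - (\<Sum>\<mu>\<in>UNIV. dv \<mu> (g_low l \<delta> \<gamma>) z * N_conn l \<mu> \<beta> z + dv \<mu> (g_low l \<beta> \<delta>) z * N_conn l \<mu> \<gamma> z
      - dv \<mu> (g_low l \<beta> \<gamma>) z * N_conn l \<mu> \<delta> z)) * v $ \<beta> * Y $ \<gamma>))"
    unfolding Gamma_def Gamma_tilde_def
    by (intro sum.cong refl) (simp add: sum_distrib_left sum_distrib_right sum_subtractf[symmetric] algebra_simps)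
  also have "\<dots> = (\<Sum>\<delta>\<in>UNIV. g_up l \<alpha> \<delta> z * w $ \<delta>)"
    unfolding w sum_distrib_left
    by (subst sum.swap[of _ _ "UNIV :: 'n set"], subst (2) sum.swap) (rule refl)
  also have "\<dots> = (matrix_inv (g_mat l z) *v w) $ \<alpha>" by (simp add: matrix_vector_mult_def)
  also have "\<dots> = NN Y z $ \<alpha>"
    by (simp add: w_def matrix_vector_mul_assoc matrix_inv_left[OF invertible_g_W[OF z]])
  finally show ?thesis by (simp add: v_def)
qed

end

section \<open>Change of coordinates\<close>

locale finsler_change = A: local_finsler l U + B: local_finsler l' U'
  for l :: "(real ^ 'n::finite) \<times> (real ^ 'n) \<Rightarrow> real" and U and l' :: "(real ^ 'n::finite) \<times> (real ^ 'n) \<Rightarrow> real" and U' +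
  fixes \<phi> :: "real ^ 'n \<Rightarrow> real ^ 'n" and S :: "(real ^ 'n) set"
  assumes subset: "S \<subseteq> U" "\<phi> ` S \<subseteq> U'"
    and smooth_phi: "Cinf S \<phi>"
    and inj_phi: "\<And>x k. x \<in> S \<Longrightarrow> dd k \<phi> x = 0 \<Longrightarrow> k = 0"
    and l_phi: "\<And>x v. x \<in> S \<Longrightarrow> l (x, v) = l' (\<phi> x, dd v \<phi> x)"
begin

definition V where "V = S \<times> - {0 :: real ^ 'n}"
text \<open>\<open>\<Phi>\<close> is the tangent map of \<open>\<phi>\<close>, and \<open>D2\<close>
  the Hessian of \<open>\<phi>\<close>, which is the inhomogeneous term in the transformation
  laws.\<close>

definition \<Phi> where "\<Phi> z = (\<phi> (fst z), dd (snd z) \<phi> (fst z))"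
definition D2 where "D2 h k x = dd h (dd k \<phi>) x"

lemma open_S: "open S" using smooth_phi by (rule Cinf_openD)
lemma open_V: "open V" unfolding V_def using open_S by (intro open_Times) auto

lemma V_W: "z \<in> V \<Longrightarrow> z \<in> A.W"
  using subset by (auto simp: V_def A.W_def)

lemma fst_V: "z \<in> V \<Longrightarrow> fst z \<in> S" by (auto simp: V_def)

lemma Phi_W: "z \<in> V \<Longrightarrow> \<Phi> z \<in> B.W"
  using subset inj_phi by (auto simp: V_def B.W_def \<Phi>_def)

lemma linear_J: "x \<in> S \<Longrightarrow> linear (\<lambda>k. dd k \<phi> x)"
  by (rule Cinf_linear_dd[OF smooth_phi])

lemma surj_J:
  assumes "x \<in> S" shows "\<exists>k. w = dd k \<phi> x"
proof -
  have "inj (\<lambda>k. dd k \<phi> x)"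
    using linear_injective_0[OF linear_J[OF assms]] inj_phi[OF assms] by blast
  then have "surj (\<lambda>k. dd k \<phi> x)"
    using linear_injective_imp_surjective[OF linear_J[OF assms]] by simp
  then show ?thesis by (auto simp: surj_def)
qed

lemma D2_sym: "x \<in> S \<Longrightarrow> D2 h k x = D2 k h x"
  unfolding D2_def by (rule dd_commute[OF smooth_phi])

lemma linear_D2: "x \<in> S \<Longrightarrow> linear (\<lambda>k. D2 h k x)"
  unfolding D2_def by (rule linear_dd_dd[OF smooth_phi])

lemma linear_D2_left: "x \<in> S \<Longrightarrow> linear (\<lambda>h. D2 h k x)"
  unfolding D2_def by (rule Cinf_linear_dd[OF Cinf_dd[OF smooth_phi]])

lemma Phi_has_derivative:
  assumes z: "z \<in> V"
  shows "(\<Phi> has_derivative (\<lambda>q. (dd (fst q) \<phi> (fst z), D2 (fst q) (snd z) (fst z) + dd (snd q) \<phi> (fst z)))) (at z)"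
proof -
  have x: "fst z \<in> S" by (rule fst_V[OF z])
  have fst: "(fst has_derivative fst) (at z)" by (rule bounded_linear_imp_has_derivative[OF bounded_linear_fst])
  have snd: "(snd has_derivative snd) (at z)" by (rule bounded_linear_imp_has_derivative[OF bounded_linear_snd])
  show ?thesis
    unfolding \<Phi>_def D2_def
    by (intro has_derivative_Pair has_derivative_compose[OF fst Cinf_has_derivative[OF smooth_phi x]]
        has_derivative_dd_variable[OF smooth_phi x fst snd])
qed

lemma dd_v_l:
  assumes z: "z \<in> V"
  shows "dd (h, k) l z = dd (dd h \<phi> (fst z), D2 h (snd z) (fst z) + dd k \<phi> (fst z)) l' (\<Phi> z)"
proof -
  have "dd (h, k) l z = dd (h, k) (\<lambda>z. l' (\<Phi> z)) z"
    by (rule dd_cong[OF open_V z]) (use l_phi in \<open>auto simp: V_def \<Phi>_def\<close>)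
  also have "\<dots> = dd (dd h \<phi> (fst z), D2 h (snd z) (fst z) + dd k \<phi> (fst z)) l' (\<Phi> z)"
    using dd_eqI[OF has_derivative_compose[OF Phi_has_derivative[OF z] Cinf_has_derivative[OF B.smooth_l_W Phi_W[OF z]]], of "(h, k)"]
    by simp
  finally show ?thesis .
qed

lemma dd_dd_v_l:
  assumes z: "z \<in> V"
  shows "dd (h, k2) (dd (0, k) l) z
    = dd (dd h \<phi> (fst z), D2 h (snd z) (fst z) + dd k2 \<phi> (fst z)) (dd (0, dd k \<phi> (fst z)) l') (\<Phi> z)
      + dd (0, D2 h k (fst z)) l' (\<Phi> z)"
proof -
  have x: "fst z \<in> S" by (rule fst_V[OF z])
  have fst: "(fst has_derivative fst) (at z)" by (rule bounded_linear_imp_has_derivative[OF bounded_linear_fst])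
  have p: "((\<lambda>z. (0 :: real ^ 'n, dd k \<phi> (fst z))) has_derivative (\<lambda>q. (0, D2 (fst q) k (fst z)))) (at z)"
    unfolding D2_def
    by (intro has_derivative_Pair has_derivative_const
      has_derivative_compose[OF fst Cinf_has_derivative[OF Cinf_dd[OF smooth_phi] x]])
  have "dd (h, k2) (dd (0, k) l) z = dd (h, k2) (\<lambda>z. dd (0, dd k \<phi> (fst z)) l' (\<Phi> z)) z"
  proof (rule dd_cong[OF open_V z])
    fix y assume y: "y \<in> V"
    show "dd (0, k) l y = dd (0, dd k \<phi> (fst y)) l' (\<Phi> y)"
      using dd_v_l[OF y, of 0 k] linear_0[OF linear_J[OF fst_V[OF y]]] linear_0[OF linear_D2_left[OF fst_V[OF y]]]
      by simp
  qed
  then show ?thesis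
    using dd_eqI[OF has_derivative_dd_variable[where \<Phi> = \<Phi>, OF B.smooth_l_W Phi_W[OF z] Phi_has_derivative[OF z] p], of "(h, k2)"]
    by simp
qed

lemma g_change:
  assumes z: "z \<in> V"
  shows "A.g k k' z = B.g (dd k \<phi> (fst z)) (dd k' \<phi> (fst z)) (\<Phi> z)"
  using dd_dd_v_l[OF z, of 0 k k'] linear_0[OF linear_J[OF fst_V[OF z]]] linear_0[OF linear_D2_left[OF fst_V[OF z]]]
    linear_0[OF Cinf_linear_dd[OF B.smooth_l_W Phi_W[OF z]]]
  by (simp add: A.g_def B.g_def zero_prod_def)

text \<open>Both sprays satisfy their Euler-Lagrange identities, so it suffices to pair with the
  image w of an arbitrary k and use nondegeneracy. The mixed Hessian \<open>D2 v k\<close> enters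
  \<open>b\<close> and the base derivative of l alike and cancels by symmetry; \<open>D2 v v\<close>
  survives.\<close>

lemma G_change:
  assumes z: "z \<in> V"
  shows "B.G (\<Phi> z) = dd (A.G z) \<phi> (fst z) - (1 / 2) *\<^sub>R D2 (snd z) (snd z) (fst z)"
proof (rule B.g_nondegenerate[OF Phi_W[OF z]])
  fix w
  define x where "x = fst z"
  define v where "v = snd z"
  have x: "x \<in> S" unfolding x_def by (rule fst_V[OF z])
  obtain k where w: "w = dd k \<phi> x" using surj_J[OF x] by blast
  have sPhi: "snd (\<Phi> z) = dd v \<phi> x" by (simp add: \<Phi>_def x_def v_def)
  note zW = V_W[OF z] and z'W = Phi_W[OF z]
  have split: "dd (p, q) f (\<Phi> z) = dd (p, 0) f (\<Phi> z) + dd (0, q) f (\<Phi> z)" if "Cinf B.W f" for p q and f :: "_ \<Rightarrow> real"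
    using linear_add[OF Cinf_linear_dd[OF that z'W], of "(p, 0)" "(0, q)"] by simp
  have b1: "A.b v k z = dd (dd v \<phi> x, 0) (dd (0, w) l') (\<Phi> z) + dd (0, D2 v v x) (dd (0, w) l') (\<Phi> z) + dd (0, D2 v k x) l' (\<Phi> z)"
    using dd_dd_v_l[OF z, of v 0 k] split[of "dd (0, w) l'" "dd v \<phi> x" "D2 v v x", OF B.smooth_ddl] linear_0[OF linear_J[OF x]]
    by (simp add: A.b_def x_def v_def w)
  have b2: "dd (k, 0) l z = dd (w, 0) l' (\<Phi> z) + dd (0, D2 k v x) l' (\<Phi> z)"
    using dd_v_l[OF z, of k 0] split[of l' w "D2 k v x", OF B.smooth_l_W] linear_0[OF linear_J[OF x]]
    by (simp add: x_def v_def w)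
  have "2 * B.g w (dd (A.G z) \<phi> x) (\<Phi> z) = 2 * A.g k (A.G z) z"
    using g_change[OF z, of k "A.G z"] by (simp add: w x_def)
  also have "\<dots> = A.b v k z - dd (k, 0) l z"
    unfolding v_def by (rule A.spray_Euler_Lagrange[OF zW])
  also have "\<dots> = B.b (snd (\<Phi> z)) w (\<Phi> z) - dd (w, 0) l' (\<Phi> z) + B.g (D2 v v x) w (\<Phi> z)"
    unfolding b1 b2 D2_sym[OF x, of k v] by (simp add: B.b_def B.g_def sPhi)
  also have "\<dots> = 2 * B.g w (B.G (\<Phi> z)) (\<Phi> z) + B.g w (D2 v v x) (\<Phi> z)"
    using B.spray_Euler_Lagrange[OF z'W, of w] B.g_sym[OF z'W, of w "D2 v v x"] by simp
  finally have "B.g w (B.G (\<Phi> z)) (\<Phi> z) = B.g w (dd (A.G z) \<phi> x) (\<Phi> z) - 1 / 2 * B.g w (D2 v v x) (\<Phi> z)" by simp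
  also have "\<dots> = B.g w (dd (A.G z) \<phi> x - (1 / 2) *\<^sub>R D2 v v x) (\<Phi> z)"
    using linear_diff[OF B.linear_g2[OF z'W]] linear_cmul[OF B.linear_g2[OF z'W]] by simp
  finally show "B.g w (B.G (\<Phi> z)) (\<Phi> z) = B.g w (dd (A.G z) \<phi> (fst z) - (1 / 2) *\<^sub>R D2 (snd z) (snd z) (fst z)) (\<Phi> z)"
    by (simp add: x_def v_def)
qed

lemma dd_G_change:
  assumes z: "z \<in> V"
  shows "dd (dd (fst q) \<phi> (fst z), D2 (fst q) (snd z) (fst z) + dd (snd q) \<phi> (fst z)) B.G (\<Phi> z)
    = D2 (fst q) (A.G z) (fst z) + dd (dd q A.G z) \<phi> (fst z)
      - (1 / 2) *\<^sub>R dd (fst q) (dd (snd z) (dd (snd z) \<phi>)) (fst z) - D2 (snd q) (snd z) (fst z)"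
proof -
  have x: "fst z \<in> S" by (rule fst_V[OF z])
  have fst: "(fst has_derivative fst) (at z)" by (rule bounded_linear_imp_has_derivative[OF bounded_linear_fst])
  have snd: "(snd has_derivative snd) (at z)" by (rule bounded_linear_imp_has_derivative[OF bounded_linear_snd])
  have L: "((\<lambda>z. B.G (\<Phi> z)) has_derivative (\<lambda>q. dd (dd (fst q) \<phi> (fst z), D2 (fst q) (snd z) (fst z) + dd (snd q) \<phi> (fst z)) B.G (\<Phi> z))) (at z)"
    by (rule has_derivative_compose[OF Phi_has_derivative[OF z] Cinf_has_derivative[OF B.smooth_G Phi_W[OF z]]])
  have R1: "((\<lambda>z. dd (A.G z) \<phi> (fst z)) has_derivative (\<lambda>q. D2 (fst q) (A.G z) (fst z) + dd (dd q A.G z) \<phi> (fst z))) (at z)"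
    unfolding D2_def
    by (rule has_derivative_dd_variable[where \<Phi> = fst, OF smooth_phi x fst Cinf_has_derivative[OF A.smooth_G V_W[OF z]]])
  have R2: "((\<lambda>z. D2 (snd z) (snd z) (fst z)) has_derivative (\<lambda>q. dd (fst q) (dd (snd z) (dd (snd z) \<phi>)) (fst z)
      + D2 (snd q) (snd z) (fst z) + D2 (snd z) (snd q) (fst z))) (at z)"
    unfolding D2_def
    by (rule has_derivative_dd2_variable[where \<Phi> = fst, OF smooth_phi x fst snd snd])
  have "dd q (\<lambda>z. B.G (\<Phi> z)) z = dd q (\<lambda>z. dd (A.G z) \<phi> (fst z) - (1 / 2) *\<^sub>R D2 (snd z) (snd z) (fst z)) z"
    by (rule dd_cong[OF open_V z G_change])
  then show ?thesis
    unfolding dd_eqI[OF L] dd_eqI[OF has_derivative_diff[OF R1 has_derivative_scaleR_right[OF R2]]]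
      D2_sym[OF x, of "snd z" "snd q"]
    by (simp add: vec_eq_iff field_simps)
qed

lemma NN_change:
  assumes z: "z \<in> V"
  shows "B.NN (dd k \<phi> (fst z)) (\<Phi> z) = dd (A.NN k z) \<phi> (fst z) - D2 k (snd z) (fst z)"
proof -
  have x: "fst z \<in> S" by (rule fst_V[OF z])
  have "dd 0 (dd (snd z) (dd (snd z) \<phi>)) (fst z) = 0"
    by (rule linear_0[OF Cinf_linear_dd[OF Cinf_dd[OF Cinf_dd[OF smooth_phi]] x]])
  then show ?thesis
    using dd_G_change[OF z, of "(0, k)"] linear_0[OF linear_J[OF x]] linear_0[OF linear_D2_left[OF x]]
    by (simp add: A.NN_def B.NN_def)
qed

text \<open>No summand of \<open>RR\<close> is a tensor. In the sum, the third derivatives of \<phi>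
  cancel because they are symmetric, and the second derivatives cancel between the base derivative
  of \<open>G\<close>, the \<open>SS\<close> term and the square of \<open>NN\<close>.\<close>

lemma RR_change:
  assumes z: "z \<in> V"
  shows "B.RR (dd k \<phi> (fst z)) (\<Phi> z) = dd (A.RR k z) \<phi> (fst z)"
proof -
  define x where "x = fst z"
  define v where "v = snd z"
  define s where "s = (v, - 2 *\<^sub>R A.G z)"
  let ?J = "\<lambda>k. dd k \<phi> x"
  have x: "x \<in> S" unfolding x_def by (rule fst_V[OF z])
  have sPhi: "snd (\<Phi> z) = ?J v" by (simp add: \<Phi>_def x_def v_def)
  note zW = V_W[OF z] and z'W = Phi_W[OF z]
  have fst: "(fst has_derivative fst) (at z)" by (rule bounded_linear_imp_has_derivative[OF bounded_linear_fst])
  have snd: "(snd has_derivative snd) (at z)" by (rule bounded_linear_imp_has_derivative[OF bounded_linear_snd])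
  note Jlin = linear_diff[OF linear_J[OF x]] linear_cmul[OF linear_J[OF x]] linear_add[OF linear_J[OF x]]
  have split: "dd (p, q) B.G (\<Phi> z) = dd (p, 0) B.G (\<Phi> z) + B.NN q (\<Phi> z)" for p q
    using linear_add[OF Cinf_linear_dd[OF B.smooth_G z'W], of "(p, 0)" "(0, q)"] by (simp add: B.NN_def)
  have Gx: "dd (?J k, 0) B.G (\<Phi> z) + B.NN (D2 k v x) (\<Phi> z)
      = D2 k (A.G z) x + ?J (dd (k, 0) A.G z) - (1 / 2) *\<^sub>R dd k (dd v (dd v \<phi>)) x"
    using dd_G_change[OF z, of "(k, 0)"] linear_0[OF linear_J[OF x]] linear_0[OF linear_D2_left[OF x]] split[of "?J k" "D2 k v x"]
    by (simp add: x_def v_def)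
  have L: "((\<lambda>z. dd (0, dd k \<phi> (fst z)) B.G (\<Phi> z)) has_derivative
      (\<lambda>q. dd (?J (fst q), D2 (fst q) v x + ?J (snd q)) (dd (0, ?J k) B.G) (\<Phi> z)
         + dd (0, D2 (fst q) k x) B.G (\<Phi> z))) (at z)"
    unfolding D2_def x_def v_def
    by (rule has_derivative_dd_variable[where \<Phi> = \<Phi>, OF B.smooth_G z'W Phi_has_derivative[OF z, unfolded D2_def]])
      (intro has_derivative_Pair has_derivative_const
      has_derivative_compose[OF fst Cinf_has_derivative[OF Cinf_dd[OF smooth_phi] x[unfolded x_def]]])
  have R1: "((\<lambda>z. dd (A.NN k z) \<phi> (fst z)) has_derivative (\<lambda>q. D2 (fst q) (A.NN k z) x + ?J (dd q (A.NN k) z))) (at z)"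
    unfolding D2_def x_def
    by (rule has_derivative_dd_variable[where \<Phi> = fst, OF smooth_phi x[unfolded x_def] fst Cinf_has_derivative[OF A.smooth_NN zW]])
  have R2: "((\<lambda>z. D2 k (snd z) (fst z)) has_derivative (\<lambda>q. dd (fst q) (dd k (dd v \<phi>)) x
      + dd 0 (dd v \<phi>) x + D2 k (snd q) x)) (at z)"
    unfolding D2_def x_def v_def
    by (rule has_derivative_dd2_variable[where \<Phi> = fst, OF smooth_phi x[unfolded x_def] fst has_derivative_const snd])
  have z0: "dd 0 (dd v \<phi>) x = 0"
    by (rule linear_0[OF Cinf_linear_dd[OF Cinf_dd[OF smooth_phi] x]])
  have "dd s (\<lambda>z. dd (0, dd k \<phi> (fst z)) B.G (\<Phi> z)) z = dd s (\<lambda>z. dd (A.NN k z) \<phi> (fst z) - D2 k (snd z) (fst z)) z"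
    by (rule dd_cong[OF open_V z]) (use NN_change in \<open>simp add: B.NN_def\<close>)
  then have 1: "dd (?J v, D2 v v x - 2 *\<^sub>R ?J (A.G z)) (B.NN (?J k)) (\<Phi> z) + B.NN (D2 v k x) (\<Phi> z)
     = D2 v (A.NN k z) x + ?J (A.SS (A.NN k) z) - dd v (dd k (dd v \<phi>)) x + 2 *\<^sub>R D2 k (A.G z) x"
    unfolding dd_eqI[OF L] dd_eqI[OF has_derivative_diff[OF R1 R2]] z0
    using linear_cmul[OF linear_J[OF x], of "-2" "A.G z"] linear_cmul[OF linear_D2[OF x], of k "-2" "A.G z"]
    by (simp add: s_def B.NN_def A.SS_def v_def[symmetric])
  \<comment> \<open>The tangent map carries the spray to the spray, so the derivative of
    \<open>B.NN (?J k)\<close> in \<open>1\<close> is its derivative along the spray of the second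
    chart.\<close>
  have "(?J v, D2 v v x - 2 *\<^sub>R ?J (A.G z)) = (snd (\<Phi> z), - 2 *\<^sub>R B.G (\<Phi> z))"
    unfolding G_change[OF z] sPhi by (simp add: x_def v_def algebra_simps)
  with 1 have SN: "B.SS (B.NN (?J k)) (\<Phi> z) + B.NN (D2 v k x) (\<Phi> z)
     = D2 v (A.NN k z) x + ?J (A.SS (A.NN k) z) - dd v (dd k (dd v \<phi>)) x + 2 *\<^sub>R D2 k (A.G z) x"
    by (simp add: B.SS_def)
  have NN: "B.NN (B.NN (?J k) (\<Phi> z)) (\<Phi> z) = ?J (A.NN (A.NN k z) z) - D2 (A.NN k z) v x - B.NN (D2 k v x) (\<Phi> z)"
    using NN_change[OF z, of k] NN_change[OF z, of "A.NN k z"] linear_diff[OF B.linear_NN[OF z'W]]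
    by (simp add: x_def v_def)
  have D3: "dd v (dd k (dd v \<phi>)) x = dd k (dd v (dd v \<phi>)) x"
    by (rule dd_commute[OF Cinf_dd[OF smooth_phi] x])
  have "B.RR (?J k) (\<Phi> z) = 2 *\<^sub>R dd (?J k, 0) B.G (\<Phi> z) - B.SS (B.NN (?J k)) (\<Phi> z) - B.NN (B.NN (?J k) (\<Phi> z)) (\<Phi> z)"
    by (simp add: B.RR_def)
  also have "\<dots> = 2 *\<^sub>R (D2 k (A.G z) x + ?J (dd (k, 0) A.G z) - (1 / 2) *\<^sub>R dd k (dd v (dd v \<phi>)) x - B.NN (D2 k v x) (\<Phi> z))
     - (D2 v (A.NN k z) x + ?J (A.SS (A.NN k) z) - dd k (dd v (dd v \<phi>)) x + 2 *\<^sub>R D2 k (A.G z) x - B.NN (D2 k v x) (\<Phi> z))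
     - (?J (A.NN (A.NN k z) z) - D2 v (A.NN k z) x - B.NN (D2 k v x) (\<Phi> z))"
    unfolding NN Gx[symmetric] D2_sym[OF x, of _ v] using SN unfolding D3 D2_sym[OF x, of k v] D2_sym[OF x, of _ v]
    by (simp add: algebra_simps)
  also have "\<dots> = 2 *\<^sub>R ?J (dd (k, 0) A.G z) - ?J (A.SS (A.NN k) z) - ?J (A.NN (A.NN k z) z)"
    by (simp add: vec_eq_iff algebra_simps)
  also have "\<dots> = ?J (A.RR k z)"
    by (simp add: A.RR_def Jlin)
  finally show ?thesis by (simp add: x_def)
qed

end

section \<open>Ordinary differential equations\<close>

lemma einterval_mono: "p \<in> einterval a b \<Longrightarrow> q \<in> einterval a b \<Longrightarrow> p \<le> t \<Longrightarrow> t \<le> q \<Longrightarrow> t \<in> einterval a b"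
  by (auto simp: einterval_def intro: less_le_trans[of a "ereal p"] le_less_trans[of "ereal t" "ereal q"])

lemma einterval_Icc: "p \<in> einterval a b \<Longrightarrow> q \<in> einterval a b \<Longrightarrow> {p..q} \<subseteq> einterval a b"
  by (auto intro: einterval_mono[of p a b q])

text \<open>Continuous coefficients are bounded on compact subintervals only; this supplies one with
  both parameters in its interior, also when an end is infinite.\<close>

lemma einterval_extend:
  assumes "s \<in> einterval a b" "t \<in> einterval a b"
  obtains p q where "p \<in> einterval a b" "q \<in> einterval a b" "p < s" "s < q" "p < t" "t < q"
proof -
  have "min s t \<in> einterval a b" "max s t \<in> einterval a b"
    using assms by (simp_all add: min_def max_def)
  then have "\<exists>e>0. cball (min s t) e \<subseteq> einterval a b" "\<exists>e>0. cball (max s t) e \<subseteq> einterval a b"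
    using open_contains_cball[of "einterval a b"] by auto
  then obtain e1 e2 where e1: "e1 > 0" "cball (min s t) e1 \<subseteq> einterval a b"
    and e2: "e2 > 0" "cball (max s t) e2 \<subseteq> einterval a b" by blast
  have "min s t - e1 \<in> einterval a b" "max s t + e2 \<in> einterval a b"
    using e1 e2 by (auto simp: dist_real_def subset_iff)
  then show thesis using e1(1) e2(1) by (intro that[of "min s t - e1" "max s t + e2"]) auto
qed

text \<open>The squared norm of w does not increase after multiplication by exp (- 2 K r) and does
  not decrease after multiplication by exp (2 K r). The first settles the parameters after s, the
  second those before.\<close>

lemma gronwall_zero:
  fixes w :: "real \<Rightarrow> 'a::euclidean_space"
  assumes der: "\<And>t. p < t \<Longrightarrow> t < q \<Longrightarrow> (w has_vector_derivative w' t) (at t)"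
    and bound: "\<And>t. p < t \<Longrightarrow> t < q \<Longrightarrow> norm (w' t) \<le> K * norm (w t)"
    and zero: "p < s" "s < q" "w s = 0" and t: "p < t" "t < q"
  shows "w t = 0"
proof -
  have in1: "\<bar>w r \<bullet> w' r\<bar> \<le> K * (w r \<bullet> w r)" if r: "p < r" "r < q" for r
  proof -
    have "\<bar>w r \<bullet> w' r\<bar> \<le> norm (w r) * norm (w' r)" by (rule Cauchy_Schwarz_ineq2)
    also have "\<dots> \<le> norm (w r) * (K * norm (w r))" by (intro mult_left_mono bound r) simp
    also have "\<dots> = K * (w r \<bullet> w r)" by (simp add: dot_square_norm power2_eq_square)
    finally show ?thesis .
  qed
  have D: "((\<lambda>r. exp (c * r) * (w r \<bullet> w r)) has_real_derivative exp (c * r) * (c * (w r \<bullet> w r) + 2 * (w r \<bullet> w' r))) (at r)"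
    if r: "p < r" "r < q" for r c
  proof -
    have "((\<lambda>r. w r \<bullet> w r) has_vector_derivative (w r \<bullet> w' r + w' r \<bullet> w r)) (at r)"
      by (rule bounded_bilinear.has_vector_derivative[OF bounded_bilinear_inner der[OF r] der[OF r]])
    then have "((\<lambda>r. w r \<bullet> w r) has_real_derivative 2 * (w r \<bullet> w' r)) (at r)"
      by (simp add: has_real_derivative_iff_has_vector_derivative inner_commute)
    then show ?thesis by (auto intro!: derivative_eq_intros simp: algebra_simps)
  qed
  have "w t \<bullet> w t \<le> 0"
  proof (cases "s \<le> t")
    case True
    have "exp (- (2 * K) * t) * (w t \<bullet> w t) \<le> exp (- (2 * K) * s) * (w s \<bullet> w s)"
    proof (rule DERIV_nonpos_imp_nonincreasing[OF True, where f = "\<lambda>r. exp (- (2 * K) * r) * (w r \<bullet> w r)"])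
      fix r assume "s \<le> r" "r \<le> t"
      then have r: "p < r" "r < q" using zero t by auto
      have "exp (- (2 * K) * r) * (- (2 * K) * (w r \<bullet> w r) + 2 * (w r \<bullet> w' r)) \<le> 0"
        using in1[OF r] by (intro mult_nonneg_nonpos) auto
      with D[OF r, of "- (2 * K)"]
      show "\<exists>y. ((\<lambda>r. exp (- (2 * K) * r) * (w r \<bullet> w r)) has_real_derivative y) (at r) \<and> y \<le> 0"
        by (intro exI conjI)
    qed
    then show ?thesis using zero by (simp add: mult_le_0_iff)
  next
    case False
    have "exp (2 * K * t) * (w t \<bullet> w t) \<le> exp (2 * K * s) * (w s \<bullet> w s)"
    proof (rule DERIV_nonneg_imp_nondecreasing[where f = "\<lambda>r. exp (2 * K * r) * (w r \<bullet> w r)"])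
      fix r assume "t \<le> r" "r \<le> s"
      then have r: "p < r" "r < q" using zero t by auto
      have "exp (2 * K * r) * (2 * K * (w r \<bullet> w r) + 2 * (w r \<bullet> w' r)) \<ge> 0"
        using in1[OF r] by (intro mult_nonneg_nonneg) auto
      with D[OF r, of "2 * K"]
      show "\<exists>y. ((\<lambda>r. exp (2 * K * r) * (w r \<bullet> w r)) has_real_derivative y) (at r) \<and> 0 \<le> y"
        by (intro exI conjI)
    qed (use False in auto)
    then show ?thesis using zero by (simp add: mult_le_0_iff)
  qed
  then have "w t \<bullet> w t = 0" using inner_ge_zero[of "w t"] by linarith
  then show ?thesis by simp
qed

section \<open>Linear equations with continuous coefficients: uniqueness and the Picard
  series\<close>

locale linear_ode =
  fixes a b :: ereal and f :: "real \<Rightarrow> 'a::euclidean_space \<Rightarrow> 'a"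
  assumes linear_f: "\<And>t. t \<in> einterval a b \<Longrightarrow> linear (f t)"
    and continuous_f: "\<And>x. continuous_on (einterval a b) (\<lambda>t. f t x)"
begin

abbreviation "I \<equiv> einterval a b"

lemma f_expand: "t \<in> I \<Longrightarrow> f t x = (\<Sum>i\<in>Basis. (x \<bullet> i) *\<^sub>R f t i)"
  by (rule linear_sum_Basis[OF linear_f])

lemma f_bound:
  assumes "p \<in> I" "q \<in> I"
  shows "\<exists>K>0. \<forall>t x. p \<le> t \<longrightarrow> t \<le> q \<longrightarrow> norm (f t x) \<le> K * norm x"
proof -
  have "\<exists>B. \<forall>t\<in>{p..q}. norm (f t i) \<le> B" for i
  proof -
    have "continuous_on {p..q} (\<lambda>t. f t i)"
      by (rule continuous_on_subset[OF continuous_f einterval_Icc[OF assms]])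
    then have "bounded ((\<lambda>t. f t i) ` {p..q})"
      by (intro compact_imp_bounded compact_continuous_image compact_Icc)
    then show ?thesis by (auto simp: bounded_iff)
  qed
  then have "\<forall>i. \<exists>B. \<forall>t\<in>{p..q}. norm (f t i) \<le> B" by blast
  from choice[OF this] obtain B where B: "\<forall>i. \<forall>t\<in>{p..q}. norm (f t i) \<le> B i" by blast
  \<comment> \<open>The summand 1 makes the constant positive, as the division by it in
    \<open>picard_sum\<close> requires.\<close>
  have "norm (f t x) \<le> (1 + (\<Sum>i\<in>Basis. \<bar>B i\<bar>)) * norm x" if t: "p \<le> t" "t \<le> q" for t x
  proof -
    have "norm (f t x) \<le> (\<Sum>i\<in>Basis. norm ((x \<bullet> i) *\<^sub>R f t i))"
      unfolding f_expand[OF einterval_mono[OF assms t], of x] by (rule norm_sum)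
    also have "\<dots> \<le> (\<Sum>i\<in>Basis. norm x * \<bar>B i\<bar>)"
    proof (rule sum_mono)
      fix i :: 'a assume i: "i \<in> Basis"
      have "norm (f t i) \<le> \<bar>B i\<bar>" using B t abs_ge_self[of "B i"] by (meson order_trans atLeastAtMost_iff)
      then show "norm ((x \<bullet> i) *\<^sub>R f t i) \<le> norm x * \<bar>B i\<bar>"
        using Basis_le_norm[OF i, of x] by (simp add: mult_mono)
    qed
    also have "\<dots> = (\<Sum>i\<in>Basis. \<bar>B i\<bar>) * norm x"
      unfolding sum_distrib_right by (simp add: mult.commute)
    also have "\<dots> \<le> (1 + (\<Sum>i\<in>Basis. \<bar>B i\<bar>)) * norm x" by (intro mult_right_mono) auto
    finally show ?thesis .
  qed
  then show ?thesis
    by (intro exI[of _ "1 + (\<Sum>i\<in>Basis. \<bar>B i\<bar>)"] conjI allI impI add_pos_nonneg sum_nonneg) simp_all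
qed

lemma unique:
  assumes "\<And>t. t \<in> I \<Longrightarrow> (x has_vector_derivative f t (x t)) (at t)"
    and "\<And>t. t \<in> I \<Longrightarrow> (y has_vector_derivative f t (y t)) (at t)"
    and "s \<in> I" "x s = y s" "t \<in> I"
  shows "x t = y t"
proof -
  obtain p q where pq: "p \<in> I" "q \<in> I" "p < s" "s < q" "p < t" "t < q"
    by (rule einterval_extend[OF assms(3,5)])
  obtain K where "K > 0" and K: "\<And>t x. p \<le> t \<Longrightarrow> t \<le> q \<Longrightarrow> norm (f t x) \<le> K * norm x"
    using f_bound[OF pq(1,2)] by blast
  have I: "r \<in> I" if "p < r" "r < q" for r using einterval_mono[OF pq(1,2)] that by simp
  have "x t - y t = 0"
  proof (rule gronwall_zero[where w = "\<lambda>t. x t - y t" and p = p and q = q and s = s and K = K])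
    fix r assume r: "p < r" "r < q"
    show "((\<lambda>t. x t - y t) has_vector_derivative f r (x r) - f r (y r)) (at r)"
      by (intro has_vector_derivative_diff assms I r)
    show "norm (f r (x r) - f r (y r)) \<le> K * norm (x r - y r)"
      using K[of r "x r - y r"] r linear_diff[OF linear_f[OF I[OF r]]] by simp
  qed (use pq assms(4) in auto)
  then show ?thesis by simp
qed

text \<open>Choosing an antiderivative on the whole interval treats both sides of s at once; an
  integral from s to t would need a convention for t < s.\<close>

definition prim :: "real \<Rightarrow> (real \<Rightarrow> 'a) \<Rightarrow> real \<Rightarrow> 'a" where
  "prim s h = (SOME F. F s = 0 \<and> (\<forall>t\<in>I. (F has_vector_derivative h t) (at t)))"

lemma prim:
  assumes "s \<in> I" "continuous_on I h"
  shows "prim s h s = 0 \<and> (\<forall>t\<in>I. (prim s h has_vector_derivative h t) (at t))"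
proof -
  have ab: "a < b" using assms(1) by (auto simp: einterval_def)
  have "isCont h x" if "a < ereal x" "ereal x < b" for x
    using assms(2) that unfolding continuous_on_eq_continuous_at[OF open_einterval] by (simp add: einterval_def)
  then obtain F where F: "\<forall>x :: real. a < ereal x \<longrightarrow> ereal x < b \<longrightarrow> (F has_vector_derivative h x) (at x)"
    using einterval_antiderivative[OF ab, of h] by blast
  then have "\<forall>t\<in>I. ((\<lambda>t. F t - F s) has_vector_derivative h t) (at t)"
    using has_vector_derivative_diff[OF _ has_vector_derivative_const[of "F s"], of F] by (simp add: einterval_def)
  then have "\<exists>F. F s = 0 \<and> (\<forall>t\<in>I. (F has_vector_derivative h t) (at t))"
    by (intro exI[of _ "\<lambda>t. F t - F s"]) simp
  then show ?thesis unfolding prim_def by (rule someI_ex)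
qed

text \<open>These are the increments of the Picard iteration, not the iterates: by linearity each
  one comes from the previous increment alone, and the solution is their sum.\<close>

primrec picard :: "real \<Rightarrow> 'a \<Rightarrow> nat \<Rightarrow> real \<Rightarrow> 'a" where
  "picard s x 0 = (\<lambda>t. x)"
| "picard s x (Suc k) = prim s (\<lambda>t. f t (picard s x k t))"

lemma continuous_f_comp:
  assumes "continuous_on I u" shows "continuous_on I (\<lambda>t. f t (u t))"
proof -
  have "continuous_on I (\<lambda>t. \<Sum>i\<in>Basis. (u t \<bullet> i) *\<^sub>R f t i)"
    by (intro continuous_intros assms continuous_f)
  then show ?thesis by (rule continuous_on_eq) (simp add: f_expand)
qed

lemma picard_props:
  assumes "s \<in> I"
  shows "continuous_on I (picard s x k)"
    and "\<And>t. t \<in> I \<Longrightarrow> (picard s x (Suc k) has_vector_derivative f t (picard s x k t)) (at t)"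
    and "picard s x (Suc k) s = 0"
proof -
  show c: "continuous_on I (picard s x k)" for k
  proof (induction k)
    case (Suc k)
    show ?case
      using prim[OF assms continuous_f_comp[OF Suc]]
      by (auto intro!: continuous_at_imp_continuous_on has_vector_derivative_continuous)
  qed simp
  show "\<And>t. t \<in> I \<Longrightarrow> (picard s x (Suc k) has_vector_derivative f t (picard s x k t)) (at t)"
    and "picard s x (Suc k) s = 0"
    using prim[OF assms continuous_f_comp[OF c[of k]]] by simp_all
qed

text \<open>The weight \<open>exp (2 * K * \<bar>t - s\<bar>)\<close> makes each Picard step contract by the factor \<open>1 / 2\<close>.\<close>

lemma picard_bound:
  assumes s: "p \<in> I" "q \<in> I" "p \<le> s" "s \<le> q"
    and K: "K > 0" "\<And>t x. p \<le> t \<Longrightarrow> t \<le> q \<Longrightarrow> norm (f t x) \<le> K * norm x"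
    and t: "p \<le> t" "t \<le> q"
  shows "norm (picard s x k t) \<le> norm x * (1 / 2) ^ k * exp (2 * K * \<bar>t - s\<bar>)"
  using t
proof (induction k arbitrary: t)
  case 0
  then show ?case using K(1) mult_left_mono[of 1 "exp (2 * K * \<bar>t - s\<bar>)" "norm x"] by simp
next
  case (Suc k)
  have sI: "s \<in> I" using einterval_mono[OF s] .
  have I: "r \<in> I" if "p \<le> r" "r \<le> q" for r using einterval_mono[OF s(1,2)] that by simp
  \<comment> \<open>K times the bound of order k equals 2 K c times the weight, which is the size of
    the derivative of c times the weight. This produces the halving.\<close>
  define c where "c = norm x * (1 / 2) ^ Suc k"
  have c0: "c \<ge> 0" by (simp add: c_def)
  note D = picard_props(2)[OF sI, of _ x k]
  have C: "continuous_on {u..v} (picard s x (Suc k))" if "p \<le> u" "v \<le> q" for u v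
    by (rule continuous_on_subset[OF picard_props(1)[OF sI]]) (use I that in auto)
  have B: "norm (f r (picard s x k r)) \<le> c * (2 * K) * exp (2 * K * \<bar>r - s\<bar>)" if r: "p \<le> r" "r \<le> q" for r
    using order_trans[OF K(2)[OF r, of "picard s x k r"] mult_left_mono[OF Suc.IH[OF r], of K]] K(1)
    by (simp add: c_def mult_ac)
  consider "t = s" | "s < t" | "t < s" by linarith
  then show ?case
  proof cases
    case 1
    then show ?thesis using picard_props(3)[OF sI, of x k] by simp
  next
    case 2
    have "norm (picard s x (Suc k) t - picard s x (Suc k) s) \<le> c * exp (2 * K * (t - s)) - c * exp (2 * K * (s - s))"
    proof (rule differentiable_bound_general[OF 2 C _ D, where \<phi>' = "\<lambda>r. c * (2 * K) * exp (2 * K * \<bar>r - s\<bar>)"])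
      show "((\<lambda>r. c * exp (2 * K * (r - s))) has_vector_derivative c * (2 * K) * exp (2 * K * \<bar>r - s\<bar>)) (at r)"
        if "s < r" "r < t" for r
        unfolding has_real_derivative_iff_has_vector_derivative[symmetric]
        using that by (auto intro!: derivative_eq_intros)
      show "norm (f r (picard s x k r)) \<le> c * (2 * K) * exp (2 * K * \<bar>r - s\<bar>)" if "s < r" "r < t" for r
        using B[of r] that s Suc.prems by simp
    qed (use s Suc.prems 2 I in \<open>auto intro!: continuous_intros\<close>)
    then show ?thesis unfolding picard_props(3)[OF sI] c_def[symmetric] using 2 c0 by simp
  next
    case 3
    have "norm (picard s x (Suc k) s - picard s x (Suc k) t) \<le> - c * exp (2 * K * (s - s)) - (- c * exp (2 * K * (s - t)))"
    proof (rule differentiable_bound_general[OF 3 C _ D, where \<phi>' = "\<lambda>r. c * (2 * K) * exp (2 * K * \<bar>r - s\<bar>)"])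
      show "((\<lambda>r. - c * exp (2 * K * (s - r))) has_vector_derivative c * (2 * K) * exp (2 * K * \<bar>r - s\<bar>)) (at r)"
        if "t < r" "r < s" for r
        unfolding has_real_derivative_iff_has_vector_derivative[symmetric]
        using that by (auto intro!: derivative_eq_intros)
      show "norm (f r (picard s x k r)) \<le> c * (2 * K) * exp (2 * K * \<bar>r - s\<bar>)" if "t < r" "r < s" for r
        using B[of r] that s Suc.prems by simp
    qed (use s Suc.prems 3 I in \<open>auto intro!: continuous_intros\<close>)
    then show ?thesis unfolding picard_props(3)[OF sI] c_def[symmetric] using 3 c0 by simp
  qed
qed

text \<open>On a compact interval the weight in \<open>picard_bound\<close> is at most exp (2 K (q -
  p)), so the series is dominated by a geometric one. Its termwise derivative converges uniformly
  because it is f applied to partial sums.\<close>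

lemma picard_sum:
  assumes s: "s \<in> I" and t: "t \<in> I"
  shows "summable (\<lambda>k. picard s x k t)"
    "((\<lambda>t. \<Sum>k. picard s x k t) has_vector_derivative f t (\<Sum>k. picard s x k t)) (at t)"
proof -
  obtain p q where pq: "p \<in> I" "q \<in> I" "p < s" "s < q" "p < t" "t < q"
    by (rule einterval_extend[OF s t])
  obtain K where K: "K > 0" "\<And>t x. p \<le> t \<Longrightarrow> t \<le> q \<Longrightarrow> norm (f t x) \<le> K * norm x"
    using f_bound[OF pq(1,2)] by blast
  have I: "r \<in> I" if "p \<le> r" "r \<le> q" for r using einterval_mono[OF pq(1,2)] that by simp
  define M where "M = norm x * exp (2 * K * (q - p))"
  have bound: "norm (picard s x k r) \<le> M * (1 / 2) ^ k" if "r \<in> {p..q}" for r k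
  proof -
    have "norm (picard s x k r) \<le> norm x * (1 / 2) ^ k * exp (2 * K * \<bar>r - s\<bar>)"
      by (rule picard_bound[where p = p and q = q]) (use pq that K in auto)
    also have "\<dots> \<le> norm x * (1 / 2) ^ k * exp (2 * K * (q - p))"
      using pq that K(1) by (intro mult_left_mono) auto
    finally show ?thesis by (simp add: M_def mult_ac)
  qed
  have sM: "summable (\<lambda>k. M * (1 / 2 :: real) ^ k)" by (intro summable_mult summable_geometric) simp
  have sum: "summable (\<lambda>k. picard s x k r)" if "r \<in> {p..q}" for r
    by (rule summable_comparison_test[OF _ sM]) (use bound[OF that] in auto)
  show "summable (\<lambda>k. picard s x k t)" using sum pq by simp
  have unif: "uniform_limit {p..q} (\<lambda>n r. \<Sum>k<n. picard s x k r) (\<lambda>r. \<Sum>k. picard s x k r) sequentially"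
    by (rule Weierstrass_m_test[OF _ sM]) (use bound in auto)
  define f' where "f' k r h = (case k of 0 \<Rightarrow> 0 | Suc j \<Rightarrow> h *\<^sub>R f r (picard s x j r))" for k r h
  have D: "(picard s x k has_derivative f' k r) (at r within {p..q})" if "r \<in> {p..q}" for k r
  proof (cases k)
    case 0
    then show ?thesis by (simp add: f'_def[abs_def])
  next
    case (Suc j)
    have "(picard s x (Suc j) has_vector_derivative f r (picard s x j r)) (at r)"
      using picard_props(2)[OF s] I that by simp
    then show ?thesis
      unfolding Suc by (auto simp: f'_def[abs_def] has_vector_derivative_def intro: has_derivative_at_withinI)
  qed
  have "\<exists>g. \<forall>r\<in>{p..q}. (\<lambda>k. picard s x k r) sums g r \<and>
      (g has_derivative (\<lambda>h. h *\<^sub>R f r (\<Sum>k. picard s x k r))) (at r within {p..q})"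
  proof (rule has_derivative_series[OF _ D])
    fix e :: real assume e: "e > 0"
    have *: "\<forall>\<^sub>F n in sequentially. \<forall>r\<in>{p..q}. dist (\<Sum>k<n. picard s x k r) (\<Sum>k. picard s x k r) < e / K"
      using unif e K(1) by (simp add: uniform_limit_iff)
    have ev: "\<forall>\<^sub>F n in sequentially. \<forall>r\<in>{p..q}. dist (\<Sum>k<n - 1. picard s x k r) (\<Sum>k. picard s x k r) < e / K"
    proof -
      obtain N where N: "\<And>n. n \<ge> N \<Longrightarrow> \<forall>r\<in>{p..q}. dist (\<Sum>k<n. picard s x k r) (\<Sum>k. picard s x k r) < e / K"
        using * unfolding eventually_sequentially by blast
      show ?thesis unfolding eventually_sequentially
        by (rule exI[of _ "Suc N"]) (auto intro!: N[rule_format])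
    qed
    \<comment> \<open>The constant term 0 has derivative zero and every other term differentiates to
      f of its predecessor: the derivative of n terms is f of the sum of n - 1.\<close>
    have fsum: "(\<Sum>k<n. f' k r h) = h *\<^sub>R f r (\<Sum>k<n - 1. picard s x k r)" if "r \<in> {p..q}" "n > 0" for n r h
    proof -
      obtain m where m: "n = Suc m" using \<open>n > 0\<close> gr0_conv_Suc by blast
      have lin: "linear (f r)" using linear_f I that by simp
      show ?thesis
        unfolding m sum.lessThan_Suc_shift
        by (simp add: f'_def linear_sum[OF lin] scaleR_sum_right)
    qed
    show "\<forall>\<^sub>F n in sequentially. \<forall>r\<in>{p..q}. \<forall>h. norm ((\<Sum>k<n. f' k r h) - h *\<^sub>R f r (\<Sum>k. picard s x k r)) \<le> e * norm h"
      using ev eventually_gt_at_top[of 0]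
    proof eventually_elim
      case (elim n)
      show ?case
      proof (intro ballI allI)
        fix r h assume r: "r \<in> {p..q}"
        have lin: "linear (f r)" using linear_f I r by simp
        have "norm (h *\<^sub>R f r (\<Sum>k<n - 1. picard s x k r) - h *\<^sub>R f r (\<Sum>k. picard s x k r))
          = norm h * norm (f r ((\<Sum>k<n - 1. picard s x k r) - (\<Sum>k. picard s x k r)))"
          by (simp add: linear_diff[OF lin] flip: scaleR_diff_right)
        also have "\<dots> \<le> norm h * (K * norm ((\<Sum>k<n - 1. picard s x k r) - (\<Sum>k. picard s x k r)))"
          by (intro mult_left_mono K) (use r in auto)
        also have "\<dots> \<le> norm h * (K * (e / K))"
          using elim r K(1) by (intro mult_left_mono) (auto simp: dist_norm less_imp_le)
        also have "\<dots> = e * norm h" using K(1) by simp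
        finally show "norm ((\<Sum>k<n. f' k r h) - h *\<^sub>R f r (\<Sum>k. picard s x k r)) \<le> e * norm h"
          using fsum[OF r elim(2)] by simp
      qed
    qed
  next
    show "t \<in> {p..q}" using pq by simp
    show "(\<lambda>k. picard s x k t) sums (\<Sum>k. picard s x k t)" using sum[of t] pq by (simp add: summable_sums)
  qed simp
  then obtain g where g: "\<And>r. r \<in> {p..q} \<Longrightarrow> (\<lambda>k. picard s x k r) sums g r"
    "(g has_derivative (\<lambda>h. h *\<^sub>R f t (\<Sum>k. picard s x k t))) (at t within {p..q})"
    using pq by fastforce
  have "(g has_derivative (\<lambda>h. h *\<^sub>R f t (\<Sum>k. picard s x k t))) (at t)"
    using g(2) pq by (simp add: at_within_Icc_at)
  then have "((\<lambda>r. \<Sum>k. picard s x k r) has_derivative (\<lambda>h. h *\<^sub>R f t (\<Sum>k. picard s x k t))) (at t)"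
    by (rule has_derivative_transform_within_open[of _ _ _ _ "{p<..<q}"])
      (use pq sums_unique[OF g(1)] in auto)
  then show "((\<lambda>t. \<Sum>k. picard s x k t) has_vector_derivative f t (\<Sum>k. picard s x k t)) (at t)"
    by (simp add: has_vector_derivative_def)
qed

theorem existence:
  assumes "s \<in> I"
  obtains y where "y s = x" "\<And>t. t \<in> I \<Longrightarrow> (y has_vector_derivative f t (y t)) (at t)"
proof (rule that[of "\<lambda>t. \<Sum>k. picard s x k t"])
  have "(\<lambda>k. picard s x k s) = (\<lambda>k. if k = 0 then x else 0)"
  proof
    fix k show "picard s x k s = (if k = 0 then x else 0)"
      using picard_props(3)[OF assms, of x] by (cases k) auto
  qed
  then show "(\<Sum>k. picard s x k s) = x"
    using suminf_finite[of "{0}" "\<lambda>k. if k = 0 then x else 0"] by simp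
qed (rule picard_sum(2)[OF assms])

end

text \<open>Continuous first derivatives on a compact ball give a Lipschitz constant, and Gronwall
  applies as long as both solutions stay in the ball. The statement is about germs, and so is the
  uniqueness of \<open>geodesic_from\<close>.\<close>

lemma autonomous_ode_unique:
  fixes F :: "'a::euclidean_space \<Rightarrow> 'a"
  assumes F: "Cinf S F" and z0: "x s = y s" "x s \<in> S"
    and x: "\<And>t. t \<in> J \<Longrightarrow> (x has_vector_derivative F (x t)) (at t)"
    and y: "\<And>t. t \<in> J \<Longrightarrow> (y has_vector_derivative F (y t)) (at t)"
    and J: "open J" "s \<in> J"
  shows "\<forall>\<^sub>F t in nhds s. x t = y t"
proof -
  obtain r where r: "r > 0" "cball (x s) r \<subseteq> S"
    using Cinf_openD[OF F] z0 open_contains_cball by blast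
  have "\<exists>B. \<forall>z\<in>cball (x s) r. norm (dd i F z) \<le> B" for i
  proof -
    have "continuous_on (cball (x s) r) (dd i F)"
      by (rule continuous_on_subset[OF Cinf_continuous_on[OF Cinf_dd[OF F]] r(2)])
    then have "bounded (dd i F ` cball (x s) r)"
      by (intro compact_imp_bounded compact_continuous_image compact_cball)
    then show ?thesis by (auto simp: bounded_iff)
  qed
  then have "\<forall>i. \<exists>B. \<forall>z\<in>cball (x s) r. norm (dd i F z) \<le> B" by blast
  from choice[OF this] obtain B where B: "\<forall>i. \<forall>z\<in>cball (x s) r. norm (dd i F z) \<le> B i" by blast
  define K where "K = (\<Sum>i\<in>(Basis :: 'a set). \<bar>B i\<bar>)"
  have lip: "norm (F u - F v) \<le> K * norm (u - v)" if uv: "u \<in> cball (x s) r" "v \<in> cball (x s) r" for u v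
  proof (rule differentiable_bound[OF convex_cball _ _ uv])
    fix z assume z: "z \<in> cball (x s) r"
    then have zS: "z \<in> S" using r by blast
    show "(F has_derivative (\<lambda>p. dd p F z)) (at z within cball (x s) r)"
      by (rule has_derivative_at_withinI[OF Cinf_has_derivative[OF F zS]])
    show "onorm (\<lambda>p. dd p F z) \<le> K"
    proof (rule onorm_bound)
      show "0 \<le> K" by (auto simp: K_def intro: sum_nonneg)
      fix p :: 'a
      have "norm (dd p F z) \<le> (\<Sum>i\<in>Basis. norm ((p \<bullet> i) *\<^sub>R dd i F z))"
        unfolding dd_sum_Basis[OF Cinf_differentiable[OF F zS], of p] by (rule norm_sum)
      also have "\<dots> \<le> (\<Sum>i\<in>Basis. norm p * \<bar>B i\<bar>)"
      proof (rule sum_mono)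
        fix i :: 'a assume i: "i \<in> Basis"
        have "norm (dd i F z) \<le> \<bar>B i\<bar>" using B z abs_ge_self[of "B i"] by (meson order_trans)
        then show "norm ((p \<bullet> i) *\<^sub>R dd i F z) \<le> norm p * \<bar>B i\<bar>"
          using Basis_le_norm[OF i, of p] by (simp add: mult_mono)
      qed
      also have "\<dots> = K * norm p" unfolding K_def sum_distrib_right by (simp add: mult.commute)
      finally show "norm (dd p F z) \<le> K * norm p" .
    qed
  qed
  have ev: "\<forall>\<^sub>F t in nhds s. u t \<in> ball (x s) r" if "u s = x s" "(u has_vector_derivative F (u s)) (at s)" for u
  proof -
    have "isCont u s" using has_vector_derivative_continuous[OF that(2)] .
    then have "(u \<longlongrightarrow> x s) (nhds s)"
      using that(1) by (simp add: tendsto_nhds_iff isCont_def)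
    then show ?thesis by (rule topological_tendstoD) (use r in auto)
  qed
  have "\<forall>\<^sub>F t in nhds s. t \<in> J \<and> x t \<in> ball (x s) r \<and> y t \<in> ball (x s) r"
    using ev[of x] ev[of y] x[OF J(2)] y[OF J(2)] z0(1) eventually_nhds_in_open[OF J]
    by (simp add: eventually_conj_iff)
  then obtain d where d: "d > 0" "\<And>t. dist t s < d \<Longrightarrow> t \<in> J \<and> x t \<in> ball (x s) r \<and> y t \<in> ball (x s) r"
    unfolding eventually_nhds_metric by blast
  have "x t - y t = 0" if t: "dist t s < d" for t
  proof (rule gronwall_zero[where w = "\<lambda>t. x t - y t" and p = "s - d" and q = "s + d" and s = s and K = K])
    fix u assume "s - d < u" "u < s + d"
    then have u: "u \<in> J" "x u \<in> ball (x s) r" "y u \<in> ball (x s) r" using d(2)[of u] by (auto simp: dist_real_def)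
    show "((\<lambda>t. x t - y t) has_vector_derivative F (x u) - F (y u)) (at u)"
      by (intro has_vector_derivative_diff x y u)
    show "norm (F (x u) - F (y u)) \<le> K * norm (x u - y u)"
      using u by (intro lip) auto
  qed (use d t z0 in \<open>auto simp: dist_real_def\<close>)
  then show ?thesis unfolding eventually_nhds_metric using d(1) by auto
qed

section \<open>The matrix Riccati equation\<close>

lemma bounded_bilinear_matrix_mult:
  "bounded_bilinear (\<lambda>(A :: real ^ 'm ^ 'k) (B :: real ^ 'p ^ 'm). A ** B)"
  unfolding bilinear_conv_bounded_bilinear[symmetric] bilinear_def
  by (intro conjI allI linearI)
    (simp_all add: vec_eq_iff matrix_matrix_mult_def sum.distrib sum_distrib_left algebra_simps)

lemma bounded_bilinear_matrix_vector_mult: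
  "bounded_bilinear (\<lambda>(A :: real ^ 'm ^ 'k) (x :: real ^ 'm). A *v x)"
  unfolding bilinear_conv_bounded_bilinear[symmetric] bilinear_def
  by (intro conjI allI linearI)
    (simp_all add: vec_eq_iff matrix_vector_mult_def sum.distrib sum_distrib_left algebra_simps)

lemma bounded_linear_transpose: "bounded_linear (\<lambda>A :: real ^ 'm ^ 'k. transpose A)"
  unfolding linear_conv_bounded_linear[symmetric]
  by (intro linearI) (simp_all add: vec_eq_iff transpose_def)

lemma bounded_linear_trace: "bounded_linear (\<lambda>A :: real ^ 'k ^ 'k. trace A)"
  unfolding linear_conv_bounded_linear[symmetric]
  by (intro linearI) (simp_all add: trace_def sum.distrib sum_distrib_left)

lemmas has_vector_derivative_matrix_mult =
  bounded_bilinear.has_vector_derivative[OF bounded_bilinear_matrix_mult]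
lemmas has_vector_derivative_matrix_vector_mult =
  bounded_bilinear.has_vector_derivative[OF bounded_bilinear_matrix_vector_mult]
lemmas has_vector_derivative_transpose =
  bounded_linear.has_vector_derivative[OF bounded_linear_transpose]
lemmas has_vector_derivative_vec_nth =
  bounded_linear.has_vector_derivative[OF bounded_linear_vec_nth]

lemma matrix_mult_minus_left: "- A ** B = - (A ** B)"
  for A :: "real ^ 'm ^ 'k::finite" and B :: "real ^ 'p::finite ^ 'm"
  by (rule bounded_bilinear.minus_left[OF bounded_bilinear_matrix_mult])

lemma matrix_mult_minus_right: "A ** - B = - (A ** B)"
  for A :: "real ^ 'm ^ 'k::finite" and B :: "real ^ 'p::finite ^ 'm"
  by (rule bounded_bilinear.minus_right[OF bounded_bilinear_matrix_mult])

lemma constant_on_einterval: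
  fixes f :: "real \<Rightarrow> 'a::real_normed_vector"
  assumes "\<And>t. t \<in> einterval a b \<Longrightarrow> (f has_vector_derivative 0) (at t)"
    and "s \<in> einterval a b" "t \<in> einterval a b"
  shows "f s = f t"
proof -
  have "convex (einterval a b)"
    unfolding is_interval_convex_1[symmetric] is_interval_1 by (meson einterval_mono)
  then obtain c where "\<And>x. x \<in> einterval a b \<Longrightarrow> f x = c"
    using has_vector_derivative_zero_constant[of "einterval a b" f] assms(1) has_vector_derivative_at_within
    by blast
  then show ?thesis using assms by simp
qed

text \<open>Smoothness of the matrix inverse gives that a derivative exists; its value then follows
  by differentiating the product of the inverse with A, which is constant.\<close>

lemma has_vector_derivative_matrix_inv:
  fixes A :: "real \<Rightarrow> real ^ 'n ^ 'n"
  assumes A: "(A has_vector_derivative A') (at t)"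
    and S: "open S" "t \<in> S" "\<And>r. r \<in> S \<Longrightarrow> invertible (A r)"
  shows "((\<lambda>r. matrix_inv (A r)) has_vector_derivative - (matrix_inv (A t) ** A' ** matrix_inv (A t))) (at t)"
proof -
  have op: "open {M :: real ^ 'n ^ 'n. det M \<noteq> 0}"
    by (intro open_Collect_neq continuous_on_const Cinf_continuous_on Cinf_det open_UNIV
        Cinf_linear[OF bounded_linear_compose[OF bounded_linear_vec_nth bounded_linear_vec_nth]])
  have comp: "Cinf {M :: real ^ 'n ^ 'n. det M \<noteq> 0} (\<lambda>M. M $ i $ j)" for i j
    using Cinf_linear[OF bounded_linear_compose[OF bounded_linear_vec_nth bounded_linear_vec_nth] op] .
  have inv: "Cinf {M :: real ^ 'n ^ 'n. det M \<noteq> 0} (\<lambda>M. matrix_inv M $ i $ j)" for i j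
    by (rule Cinf_matrix_inv[OF op comp]) (simp add: invertible_det_nz)
  have "Cinf {M :: real ^ 'n ^ 'n. det M \<noteq> 0} matrix_inv"
  proof (rule Cinf_euclidean[OF op])
    fix e :: "real ^ 'n ^ 'n" assume "e \<in> Basis"
    then obtain i j where "e = axis i (axis j 1)" by (auto simp: Basis_vec_def)
    then show "Cinf {M :: real ^ 'n ^ 'n. det M \<noteq> 0} (\<lambda>M. matrix_inv M \<bullet> e)"
      using inv[of i j] by (simp add: inner_axis)
  qed
  then have "(matrix_inv has_derivative (\<lambda>p. dd p matrix_inv (A t))) (at (A t))"
    by (rule Cinf_has_derivative) (use S(3)[OF S(2)] in \<open>simp add: invertible_det_nz\<close>)
  from has_derivative_compose[OF A[unfolded has_vector_derivative_def] this]
  have "((\<lambda>r. matrix_inv (A r)) has_derivative (\<lambda>h. dd (h *\<^sub>R A') matrix_inv (A t))) (at t)" .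
  then obtain C' where C: "((\<lambda>r. matrix_inv (A r)) has_vector_derivative C') (at t)"
    unfolding differentiable_def[symmetric] vector_derivative_works[symmetric]
    by (meson differentiableI vector_derivative_works)
  have "((\<lambda>r. matrix_inv (A r) ** A r) has_vector_derivative matrix_inv (A t) ** A' + C' ** A t) (at t)"
    by (rule has_vector_derivative_matrix_mult[OF C A])
  moreover have "((\<lambda>r. matrix_inv (A r) ** A r) has_vector_derivative 0) (at t)"
    by (rule has_vector_derivative_transform_within_open[OF has_vector_derivative_const[of "mat 1"] S(1,2)])
      (simp add: matrix_inv_left[OF S(3)])
  ultimately have "matrix_inv (A t) ** A' + C' ** A t = 0" by (rule vector_derivative_unique_at)
  then have "C' ** A t = - (matrix_inv (A t) ** A')" by (simp add: eq_neg_iff_add_eq_0 add.commute)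
  then have "C' ** A t ** matrix_inv (A t) = - (matrix_inv (A t) ** A') ** matrix_inv (A t)" by simp
  then have "C' = - (matrix_inv (A t) ** A' ** matrix_inv (A t))"
    by (simp add: matrix_mul_assoc[symmetric] matrix_inv_right[OF S(3)[OF S(2)]] matrix_mult_minus_left)
  then show ?thesis using C by simp
qed

text \<open>R stands for the curvature in a parallel orthonormal frame with velocity
  \<open>axis i0 1\<close>. By symmetry, row and column i0 vanish, so the velocity can stay in the
  frame without affecting the equations on its complement.\<close>

locale jacobi_system =
  fixes a b :: ereal and R :: "real \<Rightarrow> real ^ 'n ^ 'n" and i0 :: 'n
  assumes continuous_R: "continuous_on (einterval a b) R"
    and sym_R: "\<And>t. t \<in> einterval a b \<Longrightarrow> transpose (R t) = R t"
    and R_axis: "\<And>t. t \<in> einterval a b \<Longrightarrow> R t *v axis i0 1 = 0"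
begin

abbreviation "J \<equiv> einterval a b"

definition E0 :: "real ^ 'n ^ 'n" where "E0 = (\<chi> i j. if i = i0 \<and> j = i0 then 1 else 0)"

lemma E0_mult: "E0 *v w = axis i0 (w $ i0)"
proof -
  have "(\<Sum>j\<in>UNIV. (if i = i0 \<and> j = i0 then 1 else 0) * w $ j) = (if i = i0 then w $ i0 else 0)" for i
    by (cases "i = i0") (simp_all add: if_distrib[where f = "\<lambda>x. x * _"] sum.delta cong: if_cong)
  then show ?thesis by (simp add: vec_eq_iff matrix_vector_mult_def E0_def axis_def)
qed

lemma R_row: "t \<in> J \<Longrightarrow> (R t *v w) $ i0 = 0"
proof -
  assume t: "t \<in> J"
  have "(R t *v w) $ i0 = axis i0 1 \<bullet> (R t *v w)" by (simp add: inner_axis')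
  also have "\<dots> = (transpose (R t) *v axis i0 1) \<bullet> w" by (simp add: dot_lmul_matrix)
  also have "\<dots> = 0" by (simp only: sym_R[OF t] R_axis[OF t] inner_zero_left)
  finally show ?thesis .
qed

text \<open>The Jacobi tensor with initial values \<open>E0\<close> and \<open>1 - E0\<close>: it vanishes at \<open>s\<close> on the
  complement of \<open>axis i0 1\<close>, and stays equal to \<open>1\<close> on \<open>axis i0 1\<close>.\<close>

lemma jacobi_tensor_exists:
  assumes "s \<in> J"
  shows "\<exists>A A1. A s = E0 \<and> A1 s = mat 1 - E0 \<and>
    (\<forall>t\<in>J. (A has_vector_derivative A1 t) (at t) \<and> (A1 has_vector_derivative - (R t ** A t)) (at t))"
proof -
  define f where "f t = (\<lambda>(X :: real ^ 'n ^ 'n, Y :: real ^ 'n ^ 'n). (Y, - (R t ** X)))" for t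
  interpret ode: linear_ode a b f
  proof (rule linear_ode.intro)
    show "linear (f t)" for t
      by (rule linearI) (auto simp: f_def bounded_bilinear.add_right[OF bounded_bilinear_matrix_mult]
        bounded_bilinear.scaleR_right[OF bounded_bilinear_matrix_mult])
    show "continuous_on J (\<lambda>t. f t x)" for x
      unfolding f_def split_beta
      by (intro continuous_intros continuous_R bounded_bilinear.continuous_on[OF bounded_bilinear_matrix_mult])
  qed
  obtain y where y: "y s = (E0, mat 1 - E0)" "\<And>t. t \<in> J \<Longrightarrow> (y has_vector_derivative f t (y t)) (at t)"
    using ode.existence[OF assms, of "(E0, mat 1 - E0)"] by blast
  show ?thesis
  proof (rule exI[of _ "\<lambda>t. fst (y t)"], rule exI[of _ "\<lambda>t. snd (y t)"], intro conjI ballI)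
    fix t assume t: "t \<in> J"
    show "((\<lambda>t. fst (y t)) has_vector_derivative snd (y t)) (at t)"
      using bounded_linear.has_vector_derivative[OF bounded_linear_fst y(2)[OF t]] by (simp add: f_def split_beta)
    show "((\<lambda>t. snd (y t)) has_vector_derivative - (R t ** fst (y t))) (at t)"
      using bounded_linear.has_vector_derivative[OF bounded_linear_snd y(2)[OF t]] by (simp add: f_def split_beta)
  qed (simp_all add: y)
qed

text \<open>Row i0 of A is constant, so a kernel vector w of A t has component zero at i0. Then A w
  is a solution vanishing at s and at t, which \<open>no_conj\<close> forbids unless it is zero.
  Symmetry of \<open>A1 t ** C t\<close> comes from the Wronskian of A with itself, which is
  constant and zero at s.\<close>

lemma riccati_solution:
  assumes s: "s \<in> J"
    and no_conj: "\<And>y y1 t. \<lbrakk>\<And>r. r \<in> J \<Longrightarrow> (y has_vector_derivative y1 r) (at r);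
       \<And>r. r \<in> J \<Longrightarrow> (y1 has_vector_derivative - (R r *v y r)) (at r);
       y s = 0; t \<in> J; s < t; y t = 0\<rbrakk> \<Longrightarrow> \<forall>r\<in>J. y r = 0"
  shows "\<exists>B. \<forall>t\<in>J. s < t \<longrightarrow> (B has_vector_derivative - (B t ** B t) - R t) (at t) \<and>
    transpose (B t) = B t \<and> (\<forall>w. (B t *v w) $ i0 = 0)"
proof -
  obtain A A1 where As: "A s = E0" "A1 s = mat 1 - E0"
    and dA: "\<And>t. t \<in> J \<Longrightarrow> (A has_vector_derivative A1 t) (at t)"
    and dA1: "\<And>t. t \<in> J \<Longrightarrow> (A1 has_vector_derivative - (R t ** A t)) (at t)"
    using jacobi_tensor_exists[OF s] by blast
  have dAw: "((\<lambda>t. A t *v w) has_vector_derivative A1 t *v w) (at t)" if "t \<in> J" for t w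
    using has_vector_derivative_matrix_vector_mult[OF dA[OF that] has_vector_derivative_const[of w]] by simp
  have dA1w: "((\<lambda>t. A1 t *v w) has_vector_derivative - (R t *v (A t *v w))) (at t)" if "t \<in> J" for t w
    using has_vector_derivative_matrix_vector_mult[OF dA1[OF that] has_vector_derivative_const[of w]]
    by (simp add: matrix_vector_mul_assoc bounded_bilinear.minus_left[OF bounded_bilinear_matrix_vector_mult])
  have row1: "(A1 t *v w) $ i0 = 0" if "t \<in> J" for t w
  proof -
    have "(A1 s *v w) $ i0 = (A1 t *v w) $ i0"
      by (rule constant_on_einterval[OF _ s that])
        (use has_vector_derivative_vec_nth[OF dA1w, of _ w i0] R_row in simp)
    then show ?thesis by (simp add: As matrix_vector_mult_diff_rdistrib E0_mult)
  qed
  have row0: "(A t *v w) $ i0 = w $ i0" if "t \<in> J" for t w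
  proof -
    have "(A s *v w) $ i0 = (A t *v w) $ i0"
      by (rule constant_on_einterval[OF _ s that])
        (use has_vector_derivative_vec_nth[OF dAw, of _ w i0] row1 in simp)
    then show ?thesis by (simp add: As E0_mult)
  qed
  have inv: "invertible (A t)" if t: "t \<in> J" "s < t" for t
    unfolding invertible_left_inverse matrix_left_invertible_ker
  proof (intro allI impI)
    fix w assume w: "A t *v w = 0"
    then have "w $ i0 = 0" using row0[OF t(1), of w] by simp
    then have As0: "A s *v w = 0" by (simp add: As E0_mult axis_def vec_eq_iff)
    have y0: "\<forall>r\<in>J. A r *v w = 0"
      by (rule no_conj[OF dAw dA1w As0 t w])
    have "((\<lambda>r. A r *v w) has_vector_derivative 0) (at s)"
      by (rule has_vector_derivative_transform_within_open[OF has_vector_derivative_const open_einterval s])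
        (use y0 in simp)
    then have "A1 s *v w = 0" using vector_derivative_unique_at[OF dAw[OF s]] by blast
    \<comment> \<open>Both initial values kill w, and they add up to the identity.\<close>
    then show "w = 0"
      using As0 by (simp add: As matrix_vector_mult_diff_rdistrib)
  qed
  have wronskian: "transpose (A t) ** A1 t = transpose (A1 t) ** A t" if t: "t \<in> J" for t
  proof -
    let ?W = "\<lambda>t. transpose (A t) ** A1 t - transpose (A1 t) ** A t"
    have "(?W has_vector_derivative 0) (at t)" if t: "t \<in> J" for t
    proof -
      have "transpose (A t) ** - (R t ** A t) + transpose (A1 t) ** A1 t
          - (transpose (A1 t) ** A1 t + transpose (- (R t ** A t)) ** A t) = 0"
        using sym_R[OF t] linear_neg[OF bounded_linear.linear[OF bounded_linear_transpose], of "R t ** A t"]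
        by (simp add: matrix_mult_minus_left matrix_mult_minus_right matrix_transpose_mul matrix_mul_assoc)
      then show ?thesis
        using has_vector_derivative_diff[OF
          has_vector_derivative_matrix_mult[OF has_vector_derivative_transpose[OF dA[OF t]] dA1[OF t]]
          has_vector_derivative_matrix_mult[OF has_vector_derivative_transpose[OF dA1[OF t]] dA[OF t]]]
        by simp
    qed
    from constant_on_einterval[OF this t s] have "?W t = ?W s" .
    \<comment> \<open>The initial values E0 and 1 - E0 are symmetric and commute.\<close>
    also have "\<dots> = 0"
    proof -
      have "transpose E0 = E0" by (simp add: E0_def transpose_def vec_eq_iff conj_commute)
      moreover have "transpose (mat 1 - E0) = mat 1 - transpose E0"
        by (simp add: transpose_def vec_eq_iff mat_def)
      ultimately show ?thesis
        by (simp add: As bounded_bilinear.diff_left[OF bounded_bilinear_matrix_mult]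
          bounded_bilinear.diff_right[OF bounded_bilinear_matrix_mult])
    qed
    finally show ?thesis by simp
  qed
  define C where "C t = matrix_inv (A t)" for t
  have AC: "A t ** C t = mat 1" "C t ** A t = mat 1" if "t \<in> J" "s < t" for t
    using matrix_inv_right[OF inv[OF that]] matrix_inv_left[OF inv[OF that]] by (simp_all add: C_def)
  have dC: "(C has_vector_derivative - (C t ** A1 t ** C t)) (at t)" if t: "t \<in> J" "s < t" for t
    unfolding C_def
    by (rule has_vector_derivative_matrix_inv[OF dA[OF t(1)], where S = "J \<inter> {s<..}"])
      (use t inv in auto)
  show ?thesis
  proof (rule exI[of _ "\<lambda>t. A1 t ** C t"], intro ballI impI conjI allI)
    fix t assume t: "t \<in> J" "s < t"
    have "((\<lambda>t. A1 t ** C t) has_vector_derivative A1 t ** - (C t ** A1 t ** C t) + - (R t ** A t) ** C t) (at t)"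
      by (rule has_vector_derivative_matrix_mult[OF dA1[OF t(1)] dC[OF t]])
    moreover have "A1 t ** - (C t ** A1 t ** C t) + - (R t ** A t) ** C t = - ((A1 t ** C t) ** (A1 t ** C t)) - R t"
      by (simp add: matrix_mult_minus_left matrix_mult_minus_right matrix_mul_assoc)
        (simp add: matrix_mul_assoc[symmetric] AC[OF t])
    ultimately show "((\<lambda>t. A1 t ** C t) has_vector_derivative - ((A1 t ** C t) ** (A1 t ** C t)) - R t) (at t)" by simp
    have "transpose (A1 t ** C t) = transpose (C t) ** (transpose (A1 t) ** A t) ** C t"
      by (simp add: matrix_transpose_mul matrix_mul_assoc[symmetric] AC[OF t])
    also have "\<dots> = transpose (A t ** C t) ** (A1 t ** C t)"
      by (simp add: wronskian[OF t(1), symmetric] matrix_transpose_mul matrix_mul_assoc)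
    finally show "transpose (A1 t ** C t) = A1 t ** C t" by (simp add: AC[OF t])
    show "((A1 t ** C t) *v w) $ i0 = 0" for w
      using row1[OF t(1), of "C t *v w"] by (simp add: matrix_vector_mul_assoc)
  qed
qed

end

section \<open>Trace inequalities and scalar comparison\<close>

lemma trace_square_symmetric:
  fixes B :: "real ^ 'n ^ 'n"
  assumes "transpose B = B"
  shows "trace (B ** B) = B \<bullet> B"
proof -
  have "B $ j $ i = B $ i $ j" for i j
    using assms by (metis (no_types, lifting) transpose_def vec_lambda_beta)
  then show ?thesis by (simp add: trace_def matrix_matrix_mult_def inner_vec_def)
qed

text \<open>The vanishing entry at i0 leaves n diagonal entries, so Cauchy-Schwarz yields the
  constant n although the matrix has size n + 1.\<close>

lemma trace_squared_le:
  fixes B :: "real ^ 'n ^ 'n"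
  assumes "B $ i0 $ i0 = 0" "CARD('n) = n + 1"
  shows "(trace B)\<^sup>2 \<le> real n * (B \<bullet> B)"
proof -
  have "trace B = (\<Sum>i\<in>UNIV - {i0}. B $ i $ i)"
    unfolding trace_def using assms(1) by (subst sum.remove[of UNIV i0]) auto
  then have "(trace B)\<^sup>2 \<le> (\<Sum>i\<in>UNIV - {i0}. (B $ i $ i)\<^sup>2) * card (UNIV - {i0})"
    using sum_squared_le_sum_of_squares[of "\<lambda>i. B $ i $ i" "UNIV - {i0}"] by simp
  also have "card (UNIV - {i0}) = n" using assms(2) by (simp add: card_Diff_singleton)
  also have "(\<Sum>i\<in>UNIV - {i0}. (B $ i $ i)\<^sup>2) \<le> (\<Sum>i\<in>UNIV. (B $ i $ i)\<^sup>2)"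
    by (rule sum_mono2) auto
  also have "\<dots> \<le> B \<bullet> B"
  proof -
    have "(B $ i $ i)\<^sup>2 \<le> (\<Sum>j\<in>UNIV. (B $ i $ j)\<^sup>2)" for i by (rule member_le_sum) auto
    then show ?thesis by (simp add: inner_vec_def sum_mono power2_eq_square)
  qed
  finally show ?thesis by (simp add: mult.commute mult_right_mono)
qed

lemma norm_matrix_vector_mult_sq:
  fixes B :: "real ^ 'n ^ 'm"
  shows "(B *v e) \<bullet> (B *v e) \<le> (B \<bullet> B) * (e \<bullet> e)"
proof -
  have "(B *v e) $ i = B $ i \<bullet> e" for i by (simp add: matrix_vector_mult_def inner_vec_def)
  then have "((B *v e) $ i)\<^sup>2 \<le> (B $ i \<bullet> B $ i) * (e \<bullet> e)" for i
    using Cauchy_Schwarz_ineq[of "B $ i" e] by (simp add: power2_eq_square)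
  then have "(\<Sum>i\<in>UNIV. ((B *v e) $ i)\<^sup>2) \<le> (\<Sum>i\<in>UNIV. (B $ i \<bullet> B $ i) * (e \<bullet> e))" by (rule sum_mono)
  then show ?thesis by (simp add: inner_vec_def[of B] inner_vec_def[of "B *v e"] power2_eq_square sum_distrib_right)
qed

text \<open>Both constants are sharp, and positive exactly when \<open>\<epsilon>\<^sup>2 < \<kappa>\<close>.\<close>

lemma quadratic_form_bounds:
  fixes u p \<epsilon> \<kappa> :: real
  assumes "\<epsilon>\<^sup>2 < \<kappa>"
  shows "u\<^sup>2 + 2 * \<epsilon> * p * u + \<kappa> * p\<^sup>2 \<ge> (1 - \<epsilon>\<^sup>2 / \<kappa>) * u\<^sup>2"
    and "u\<^sup>2 + 2 * \<epsilon> * p * u + \<kappa> * p\<^sup>2 \<ge> (\<kappa> - \<epsilon>\<^sup>2) / (1 + \<kappa> - 2 * \<epsilon>) * (u + p)\<^sup>2"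
proof -
  have k: "\<kappa> > 0" using assms zero_le_power2[of \<epsilon>] by linarith
  have "u\<^sup>2 + 2 * \<epsilon> * p * u + \<kappa> * p\<^sup>2 - (1 - \<epsilon>\<^sup>2 / \<kappa>) * u\<^sup>2 = \<kappa> * (p + \<epsilon> * u / \<kappa>)\<^sup>2"
    using k by (simp add: field_simps power2_eq_square)
  also have "\<dots> \<ge> 0" using k by simp
  finally show "u\<^sup>2 + 2 * \<epsilon> * p * u + \<kappa> * p\<^sup>2 \<ge> (1 - \<epsilon>\<^sup>2 / \<kappa>) * u\<^sup>2" by simp
  have "(1 - \<epsilon>)\<^sup>2 \<ge> 0" by simp
  \<comment> \<open>The left-hand side is the square of 1 - \<epsilon> plus the positive number
    \<kappa> - \<epsilon>^2.\<close>
  then have d: "1 + \<kappa> - 2 * \<epsilon> > 0" using assms by (simp add: power2_diff)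
  have "(1 + \<kappa> - 2 * \<epsilon>) * (u\<^sup>2 + 2 * \<epsilon> * p * u + \<kappa> * p\<^sup>2) - (\<kappa> - \<epsilon>\<^sup>2) * (u + p)\<^sup>2
    = ((1 - \<epsilon>) * u + (\<epsilon> - \<kappa>) * p)\<^sup>2"
    by (simp add: algebra_simps power2_eq_square)
  also have "\<dots> \<ge> 0" by simp
  finally show "u\<^sup>2 + 2 * \<epsilon> * p * u + \<kappa> * p\<^sup>2 \<ge> (\<kappa> - \<epsilon>\<^sup>2) / (1 + \<kappa> - 2 * \<epsilon>) * (u + p)\<^sup>2"
    using d by (simp add: divide_le_eq mult.commute)
qed

text \<open>As long as \<open>U\<close> does not vanish, \<open>1 / U\<close> grows at least as fast as \<open>k * \<tau>\<close>.\<close>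

lemma scalar_riccati:
  fixes U \<tau> :: "real \<Rightarrow> real"
  assumes dU: "\<And>t. t \<in> einterval a b \<Longrightarrow> s < t \<Longrightarrow> (U has_real_derivative U' t) (at t)"
    and d\<tau>: "\<And>t. t \<in> einterval a b \<Longrightarrow> (\<tau> has_real_derivative \<tau>' t) (at t)"
    and \<tau>': "\<And>t. t \<in> einterval a b \<Longrightarrow> \<tau>' t > 0"
    and k: "k > 0"
    and ineq: "\<And>t. t \<in> einterval a b \<Longrightarrow> s < t \<Longrightarrow> U' t \<le> - k * \<tau>' t * (U t)\<^sup>2"
    and top: "\<And>c t. t \<in> einterval a b \<Longrightarrow> \<exists>r\<in>einterval a b. t < r \<and> \<tau> r > c"
    and s: "s \<in> einterval a b"
  shows "t \<in> einterval a b \<Longrightarrow> s < t \<Longrightarrow> U t \<ge> 0"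
    and "r \<in> einterval a b \<Longrightarrow> t \<in> einterval a b \<Longrightarrow> s < r \<Longrightarrow> r < t \<Longrightarrow> k * (\<tau> t - \<tau> r) * U t \<le> 1"
proof -
  have dec: "U t \<le> U r" if "r \<in> einterval a b" "t \<in> einterval a b" "s < r" "r \<le> t" for r t
  proof (rule DERIV_nonpos_imp_nonincreasing[OF that(4), where f = U])
    fix x assume "r \<le> x" "x \<le> t"
    then have x: "x \<in> einterval a b" "s < x" using einterval_mono[of r a b t x] that by auto
    have "U' x \<le> 0" using ineq[OF x] \<tau>'[OF x(1)] k by (smt (verit) mult_nonneg_nonneg mult_minus_left zero_le_power2)
    then show "\<exists>y. (U has_real_derivative y) (at x) \<and> y \<le> 0" using dU[OF x] by blast
  qed
  have inc: "inverse (U r) + k * (\<tau> t - \<tau> r) \<le> inverse (U t)"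
    if rt: "r \<in> einterval a b" "t \<in> einterval a b" "s < r" "r \<le> t" and nz: "\<And>x. r \<le> x \<Longrightarrow> x \<le> t \<Longrightarrow> U x \<noteq> 0" for r t
  proof -
    have "inverse (U r) - k * \<tau> r \<le> inverse (U t) - k * \<tau> t"
    proof (rule DERIV_nonneg_imp_nondecreasing[OF rt(4), where f = "\<lambda>x. inverse (U x) - k * \<tau> x"])
      fix x assume x': "r \<le> x" "x \<le> t"
      then have x: "x \<in> einterval a b" "s < x" using einterval_mono[of r a b t x] rt by auto
      have D: "((\<lambda>x. inverse (U x) - k * \<tau> x) has_real_derivative - (inverse (U x) * U' x * inverse (U x)) - k * \<tau>' x) (at x)"
        by (intro DERIV_diff DERIV_cmult DERIV_inverse' dU d\<tau> x nz x')
      have "U' x * (inverse (U x))\<^sup>2 \<le> - k * \<tau>' x * (U x)\<^sup>2 * (inverse (U x))\<^sup>2"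
        by (intro mult_right_mono ineq x) simp
      also have "\<dots> = - k * \<tau>' x" using nz[OF x'] by (simp add: power_mult_distrib[symmetric] mult.assoc)
      finally have "- (inverse (U x) * U' x * inverse (U x)) - k * \<tau>' x \<ge> 0"
        by (simp add: power2_eq_square mult_ac)
      with D show "\<exists>y. ((\<lambda>x. inverse (U x) - k * \<tau> x) has_real_derivative y) (at x) \<and> 0 \<le> y" by blast
    qed
    then show ?thesis by (simp add: algebra_simps)
  qed
  show "U t \<ge> 0" if t: "t \<in> einterval a b" "s < t" for t
  proof (rule ccontr)
    assume "\<not> U t \<ge> 0"
    then have neg: "U t < 0" by simp
    \<comment> \<open>At this r the estimate \<open>inc\<close> would make 1 / U positive, while U,
      being nonincreasing, is still negative.\<close>
    obtain r where r: "r \<in> einterval a b" "t < r" "\<tau> r > \<tau> t - inverse (U t) / k"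
      using top[OF t(1)] by blast
    have "U x < 0" if "t \<le> x" "x \<le> r" for x
      using dec[of t x] einterval_mono[OF t(1) r(1)] that t neg by fastforce
    then have "inverse (U t) + k * (\<tau> r - \<tau> t) \<le> inverse (U r)" "inverse (U r) < 0"
      using inc[OF t(1) r(1) t(2)] r(2) by (auto simp: less_imp_neq)
    moreover have "k * (\<tau> r - \<tau> t) > - inverse (U t)"
      using mult_strict_left_mono[OF r(3) k] k by (simp add: right_diff_distrib)
    ultimately show False by linarith
  qed
  note nonneg = this
  show "k * (\<tau> t - \<tau> r) * U t \<le> 1" if rt: "r \<in> einterval a b" "t \<in> einterval a b" "s < r" "r < t" for r t
  proof (cases "U t = 0")
    case False
    have pos: "U t > 0" using nonneg[of t] False rt by simp
    have ge: "U x \<ge> U t" if "r \<le> x" "x \<le> t" for x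
      using dec[of x t] einterval_mono[OF rt(1,2)] that rt by auto
    have "inverse (U r) + k * (\<tau> t - \<tau> r) \<le> inverse (U t)"
      by (rule inc) (use rt ge pos in fastforce)+
    moreover have "inverse (U r) > 0" using ge[of r] pos rt by simp
    ultimately have "k * (\<tau> t - \<tau> r) \<le> inverse (U t)" by linarith
    then have "k * (\<tau> t - \<tau> r) * U t \<le> inverse (U t) * U t" using pos by (intro mult_right_mono) auto
    then show ?thesis using pos by simp
  qed simp
qed

text \<open>Test \<open>x' \<le> - \<rho> - C * U'\<close> with the bump function \<open>(t - t1) * (t2 - t)\<close>: the decrease of \<open>U\<close>, which is
  at most \<open>\<delta>\<close>, controls every term except the one with \<open>\<rho>\<close>.\<close>

lemma comparison_with_small_riccati:
  fixes x \<phi> R :: "real \<Rightarrow> real"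
  assumes T: "t1 < t2" and \<rho>: "\<rho> > 0"
    and small: "\<And>\<delta>. \<delta> > 0 \<Longrightarrow> \<exists>x x' U U'. (\<forall>t. t1 \<le> t \<and> t \<le> t2 \<longrightarrow>
       (x has_real_derivative x' t) (at t) \<and> (U has_real_derivative U' t) (at t) \<and>
       (x t)\<^sup>2 \<le> - C * U' t \<and> x' t \<le> - \<rho> - C * U' t \<and> U t \<ge> 0) \<and> U t1 \<le> \<delta>"
    and C: "C \<ge> 0"
  shows False
proof -
  define d where "d = t2 - t1"
  have d: "d > 0" using T by (simp add: d_def)
  \<comment> \<open>The bump function has integral d^3 / 6, so the \<rho> term weighs \<rho> d^3 /
    6. The constants \<alpha> and \<delta> are chosen such that \<alpha> d and M \<delta> cost at
    most \<rho> d^3 / 24 each, half of it together; M + 1 guards against M = 0.\<close>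
  define \<alpha> where "\<alpha> = \<rho> * d\<^sup>2 / 24"
  have \<alpha>: "\<alpha> > 0" using d \<rho> by (simp add: \<alpha>_def)
  \<comment> \<open>M gathers the multiples of - U': d^2 C from \<phi> x', because \<phi> \<le> d^2,
    and d^2 C / (4 \<alpha>) from splitting \<phi>' x into \<alpha> plus the square of \<phi>' x
    over 4 \<alpha>.\<close>
  define M where "M = (d\<^sup>2 / (4 * \<alpha>) + d\<^sup>2) * C"
  have M: "M \<ge> 0" using d \<alpha> C by (simp add: M_def)
  define \<delta> where "\<delta> = \<rho> * d ^ 3 / 24 / (M + 1)"
  have "\<delta> > 0" using d \<rho> M by (simp add: \<delta>_def)
  from small[OF this] obtain x x' U U' where
    H: "\<forall>t. t1 \<le> t \<and> t \<le> t2 \<longrightarrow> (x has_real_derivative x' t) (at t) \<and> (U has_real_derivative U' t) (at t) \<and>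
       (x t)\<^sup>2 \<le> - C * U' t \<and> x' t \<le> - \<rho> - C * U' t \<and> U t \<ge> 0"
    and U1: "U t1 \<le> \<delta>" by blast
  have D: "(x has_real_derivative x' t) (at t)" "(U has_real_derivative U' t) (at t)"
    and B: "(x t)\<^sup>2 \<le> - C * U' t" "x' t \<le> - \<rho> - C * U' t" "U t \<ge> 0"
    if "t1 \<le> t" "t \<le> t2" for t using H that by blast+
  define \<phi> where "\<phi> t = (t - t1) * (t2 - t)" for t
  \<comment> \<open>A primitive of \<phi>. It lets the integrated inequality be stated as
    monotonicity of H, and \<phi> removes x from the values of H at both ends.\<close>
  define \<Phi> where "\<Phi> t = - (t ^ 3) / 3 + (t1 + t2) * t\<^sup>2 / 2 - t1 * t2 * t" for t
  define H where "H t = \<phi> t * x t + M * U t - \<alpha> * t + \<rho> * \<Phi> t" for t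
  have "H t2 \<le> H t1"
  proof (rule DERIV_nonpos_imp_nonincreasing[OF less_imp_le[OF T]])
    fix t assume t: "t1 \<le> t" "t \<le> t2"
    have d\<phi>: "(\<phi> has_real_derivative (t1 + t2 - 2 * t)) (at t)"
      unfolding \<phi>_def by (auto intro!: derivative_eq_intros)
    have d\<Phi>: "(\<Phi> has_real_derivative \<phi> t) (at t)"
      unfolding \<Phi>_def \<phi>_def by (auto intro!: derivative_eq_intros simp: power2_eq_square algebra_simps)
    have DH: "(H has_real_derivative (\<phi> t * x' t + (t1 + t2 - 2 * t) * x t + M * U' t - \<alpha> + \<rho> * \<phi> t)) (at t)"
      unfolding H_def by (auto intro!: derivative_eq_intros d\<phi> d\<Phi> D t)
    have \<phi>: "0 \<le> \<phi> t" "\<phi> t \<le> d\<^sup>2"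
      using t unfolding \<phi>_def d_def power2_eq_square by (auto intro: mult_mono)
    have neg: "- C * U' t \<ge> 0" using B(1)[OF t] zero_le_power2[of "x t"] by linarith
    have "\<phi> t * x' t \<le> \<phi> t * (- \<rho> - C * U' t)" by (rule mult_left_mono[OF B(2)[OF t] \<phi>(1)])
    also have "\<dots> = - \<rho> * \<phi> t + \<phi> t * (- C * U' t)" by (simp add: algebra_simps)
    also have "\<phi> t * (- C * U' t) \<le> d\<^sup>2 * (- C * U' t)" by (rule mult_right_mono[OF \<phi>(2) neg])
    finally have 1: "\<phi> t * x' t \<le> - \<rho> * \<phi> t + d\<^sup>2 * (- C * U' t)" by simp
    have "(t1 + t2 - 2 * t)\<^sup>2 \<le> d\<^sup>2"
      using t by (intro abs_le_square_iff[THEN iffD1]) (auto simp: d_def)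
    then have "(t1 + t2 - 2 * t)\<^sup>2 * (x t)\<^sup>2 \<le> d\<^sup>2 * (- C * U' t)"
      using B(1)[OF t] by (intro mult_mono) auto
    moreover have "4 * \<alpha> * ((t1 + t2 - 2 * t) * x t) \<le> 4 * \<alpha>\<^sup>2 + (t1 + t2 - 2 * t)\<^sup>2 * (x t)\<^sup>2"
    proof -
      have "4 * \<alpha> * q \<le> 4 * \<alpha>\<^sup>2 + q\<^sup>2" for q
        using zero_le_power2[of "2 * \<alpha> - q"] by (simp add: power2_diff power_mult_distrib)
      from this[of "(t1 + t2 - 2 * t) * x t"] show ?thesis by (simp only: power_mult_distrib)
    qed
    ultimately have "4 * \<alpha> * ((t1 + t2 - 2 * t) * x t) \<le> 4 * \<alpha>\<^sup>2 + d\<^sup>2 * (- C * U' t)" by linarith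
    then have 2: "(t1 + t2 - 2 * t) * x t \<le> \<alpha> + d\<^sup>2 / (4 * \<alpha>) * (- C * U' t)"
      using \<alpha> by (simp add: field_simps power2_eq_square)
    have "M * U' t = - (d\<^sup>2 / (4 * \<alpha>) * (- C * U' t)) - d\<^sup>2 * (- C * U' t)"
      by (simp add: M_def algebra_simps)
    with 1 2 have "\<phi> t * x' t + (t1 + t2 - 2 * t) * x t + M * U' t - \<alpha> + \<rho> * \<phi> t \<le> 0" by linarith
    with DH show "\<exists>y. (H has_real_derivative y) (at t) \<and> y \<le> 0" by blast
  qed
  moreover have "\<phi> t1 = 0" "\<phi> t2 = 0" by (simp_all add: \<phi>_def)
  moreover have "M * U t2 \<ge> 0" using M B(3)[of t2] T by simp
  moreover have "M * U t1 \<le> M * \<delta>" using M U1 by (rule mult_left_mono[rotated])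
  ultimately have "\<rho> * (\<Phi> t2 - \<Phi> t1) \<le> M * \<delta> + \<alpha> * d"
    unfolding H_def by (simp add: d_def algebra_simps)
  moreover have "\<Phi> t2 - \<Phi> t1 = d ^ 3 / 6"
    by (simp add: \<Phi>_def d_def power2_eq_square power3_eq_cube field_simps)
  moreover have "\<alpha> * d = \<rho> * d ^ 3 / 24" by (simp add: \<alpha>_def power2_eq_square power3_eq_cube)
  moreover have "M * \<delta> \<le> \<rho> * d ^ 3 / 24"
  proof -
    have "M * \<delta> \<le> (M + 1) * \<delta>" using \<open>\<delta> > 0\<close> by simp
    also have "\<dots> = \<rho> * d ^ 3 / 24"
    proof -
      have "M + 1 \<noteq> 0" using M by simp
      from nonzero_mult_div_cancel_left[OF this, of "\<rho> * d ^ 3 / 24"] show ?thesis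
        unfolding \<delta>_def by (simp only: times_divide_eq_right)
    qed
    finally show ?thesis .
  qed
  ultimately have "\<rho> * d ^ 3 * (1 / 6) \<le> \<rho> * d ^ 3 * (1 / 12)" by simp
  moreover have "\<rho> * d ^ 3 > 0" using \<rho> d by simp
  ultimately show False by simp
qed

text \<open>Polarisation. It allows the curvature to be tested on one vector e, where the matrix
  Riccati equation becomes scalar.\<close>

lemma symmetric_matrix_eq_0:
  fixes M :: "real ^ 'n ^ 'n"
  assumes "transpose M = M" "\<And>e. e \<bullet> (M *v e) = 0"
  shows "M = 0"
proof -
  have "x \<bullet> (M *v y) = 0" for x y
  proof -
    have "y \<bullet> (M *v x) = (transpose M *v y) \<bullet> x" by (simp add: dot_lmul_matrix)
    then have "y \<bullet> (M *v x) = x \<bullet> (M *v y)" using assms(1) by (simp add: inner_commute)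
    then show ?thesis
      using assms(2)[of "x + y"] assms(2)[of x] assms(2)[of y]
      by (simp add: matrix_vector_right_distrib inner_add_left inner_add_right)
  qed
  then have "M *v y = 0" for y using inner_eq_zero_iff by blast
  then show ?thesis by (simp add: matrix_eq)
qed

section \<open>The weighted Riccati inequality and rigidity\<close>

context jacobi_system
begin

text \<open>With q the quadratic form of \<open>quadratic_form_bounds\<close> at p = \<psi>1, the
  estimate \<open>main\<close> bounds - n U', up to the exponential factor, below by n |B|^2 -
  (trace B)^2 + q. Dropping the nonnegative difference of the first two terms gives the inequality
  in U^2; keeping a share of it gives the bound on |B|^2.\<close>

lemma weighted_riccati:
  fixes \<psi> \<psi>1 \<psi>2 :: "real \<Rightarrow> real"
  assumes s: "s \<in> J"
    and no_conj: "\<And>y y1 t. \<lbrakk>\<And>r. r \<in> J \<Longrightarrow> (y has_vector_derivative y1 r) (at r);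
       \<And>r. r \<in> J \<Longrightarrow> (y1 has_vector_derivative - (R r *v y r)) (at r);
       y s = 0; t \<in> J; s < t; y t = 0\<rbrakk> \<Longrightarrow> \<forall>r\<in>J. y r = 0"
    and card: "CARD('n) = n + 1" "n \<ge> 1"
    and \<psi>: "\<And>t. t \<in> J \<Longrightarrow> (\<psi> has_real_derivative \<psi>1 t) (at t)"
    and \<psi>1: "\<And>t. t \<in> J \<Longrightarrow> (\<psi>1 has_real_derivative \<psi>2 t) (at t)"
    and ric: "\<And>t. t \<in> J \<Longrightarrow> trace (R t) \<ge> - \<psi>2 t + (\<kappa> - 1) / n * (\<psi>1 t)\<^sup>2"
    and \<kappa>: "\<epsilon>\<^sup>2 < \<kappa>"
  shows "\<exists>B U U'. \<forall>t\<in>J. s < t \<longrightarrow> (B has_vector_derivative - (B t ** B t) - R t) (at t) \<and> transpose (B t) = B t \<and>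
    (U has_real_derivative U' t) (at t) \<and>
    U' t \<le> - ((1 - \<epsilon>\<^sup>2 / \<kappa>) / n) * exp (2 * (\<epsilon> - 1) / n * \<psi> t) * (U t)\<^sup>2 \<and>
    (\<kappa> - \<epsilon>\<^sup>2) / (1 + \<kappa> - 2 * \<epsilon>) * exp (2 * (1 - \<epsilon>) / n * \<psi> t) * (B t \<bullet> B t) \<le> - U' t"
proof -
  from riccati_solution[OF s no_conj]
  obtain B where B: "\<forall>t\<in>J. s < t \<longrightarrow> (B has_vector_derivative - (B t ** B t) - R t) (at t) \<and>
    transpose (B t) = B t \<and> (\<forall>w. (B t *v w) $ i0 = 0)" by (rule exE)
  have dB: "(B has_vector_derivative - (B t ** B t) - R t) (at t)"
    and symB: "transpose (B t) = B t"
    and rowB: "(B t *v w) $ i0 = 0" if "t \<in> J" "s < t" for t w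
    using B that by auto
  define E where "E t = 2 * (1 - \<epsilon>) / n * \<psi> t" for t
  define u where "u t = trace (B t) - \<psi>1 t" for t
  define U where "U t = exp (E t) * u t" for t
  define U' where "U' t = exp (E t) * (- (B t \<bullet> B t) - trace (R t) - \<psi>2 t) + exp (E t) * (2 * (1 - \<epsilon>) / n * \<psi>1 t) * u t" for t
  define c1 where "c1 = (\<kappa> - \<epsilon>\<^sup>2) / (1 + \<kappa> - 2 * \<epsilon>)"
  have n: "real n > 0" using card by simp
  have "(1 - \<epsilon>)\<^sup>2 \<ge> 0" by simp
  then have d: "1 + \<kappa> - 2 * \<epsilon> > 0" "\<kappa> - \<epsilon>\<^sup>2 \<le> 1 + \<kappa> - 2 * \<epsilon>" using \<kappa> by (simp_all add: power2_diff)
  have c1: "c1 \<le> 1" using d by (simp add: c1_def)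
  show ?thesis
  proof (rule exI[of _ B], rule exI[of _ U], rule exI[of _ U'], intro ballI impI)
    fix t assume t: "t \<in> J" "s < t"
    have dtr: "((\<lambda>t. trace (B t)) has_real_derivative - (B t \<bullet> B t) - trace (R t)) (at t)"
      using bounded_linear.has_vector_derivative[OF bounded_linear_trace dB[OF t]]
      by (simp add: has_real_derivative_iff_has_vector_derivative
        linear_diff[OF bounded_linear.linear[OF bounded_linear_trace]]
        linear_neg[OF bounded_linear.linear[OF bounded_linear_trace]] trace_square_symmetric[OF symB[OF t]])
    have dE: "(E has_real_derivative 2 * (1 - \<epsilon>) / n * \<psi>1 t) (at t)"
      unfolding E_def by (rule DERIV_cmult[OF \<psi>[OF t(1)]])
    have dexp: "((\<lambda>t. exp (E t)) has_real_derivative exp (E t) * (2 * (1 - \<epsilon>) / n * \<psi>1 t)) (at t)"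
      by (rule DERIV_fun_exp[OF dE])
    have du: "(u has_real_derivative - (B t \<bullet> B t) - trace (R t) - \<psi>2 t) (at t)"
      unfolding u_def by (rule DERIV_diff[OF dtr \<psi>1[OF t(1)]])
    have dU: "(U has_real_derivative U' t) (at t)"
      unfolding U_def U'_def using DERIV_mult'[OF dexp du] by simp
    have B00: "B t $ i0 $ i0 = 0"
      using rowB[OF t, of "axis i0 1"] by (simp add: matrix_vector_mul_component inner_axis)
    have tr: "(trace (B t))\<^sup>2 \<le> real n * (B t \<bullet> B t)" by (rule trace_squared_le[OF B00 card(1)])
    define p where "p = \<psi>1 t"
    define q where "q = (u t)\<^sup>2 + 2 * \<epsilon> * p * u t + \<kappa> * p\<^sup>2"
    have q: "q \<ge> (1 - \<epsilon>\<^sup>2 / \<kappa>) * (u t)\<^sup>2" "q \<ge> c1 * (trace (B t))\<^sup>2"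
      unfolding q_def c1_def using quadratic_form_bounds[OF \<kappa>, of "u t" p]
      by (simp_all add: u_def p_def)
    have "n * (B t \<bullet> B t + trace (R t) + \<psi>2 t - 2 * (1 - \<epsilon>) / n * p * u t)
        \<ge> n * (B t \<bullet> B t + (\<kappa> - 1) / n * p\<^sup>2 - 2 * (1 - \<epsilon>) / n * p * u t)"
      using ric[OF t(1)] n by (intro mult_left_mono) (simp_all add: p_def)
    also have "n * (B t \<bullet> B t + (\<kappa> - 1) / n * p\<^sup>2 - 2 * (1 - \<epsilon>) / n * p * u t)
        = n * (B t \<bullet> B t) - (trace (B t))\<^sup>2 + q"
    proof -
      have "trace (B t) = u t + p" by (simp add: u_def p_def)
      then show ?thesis using n by (simp add: q_def field_simps power2_eq_square)
    qed
    finally have main: "n * (B t \<bullet> B t + trace (R t) + \<psi>2 t - 2 * (1 - \<epsilon>) / n * p * u t)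
        \<ge> n * (B t \<bullet> B t) - (trace (B t))\<^sup>2 + q" .
    have U'_eq: "- U' t = exp (E t) * (B t \<bullet> B t + trace (R t) + \<psi>2 t - 2 * (1 - \<epsilon>) / n * p * u t)"
      by (simp add: U'_def p_def algebra_simps)
    have "n * (B t \<bullet> B t + trace (R t) + \<psi>2 t - 2 * (1 - \<epsilon>) / n * p * u t) \<ge> (1 - \<epsilon>\<^sup>2 / \<kappa>) * (u t)\<^sup>2"
      using main tr q(1) by linarith
    then have "B t \<bullet> B t + trace (R t) + \<psi>2 t - 2 * (1 - \<epsilon>) / n * p * u t \<ge> (1 - \<epsilon>\<^sup>2 / \<kappa>) / n * (u t)\<^sup>2"
      using n by (simp add: divide_le_eq mult.commute)
    then have "- U' t \<ge> exp (E t) * ((1 - \<epsilon>\<^sup>2 / \<kappa>) / n * (u t)\<^sup>2)"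
      unfolding U'_eq by (rule mult_left_mono) simp
    also have "exp (E t) * ((1 - \<epsilon>\<^sup>2 / \<kappa>) / n * (u t)\<^sup>2) = (1 - \<epsilon>\<^sup>2 / \<kappa>) / n * exp (2 * (\<epsilon> - 1) / n * \<psi> t) * (U t)\<^sup>2"
    proof -
      have "exp (2 * (\<epsilon> - 1) / n * \<psi> t) * (exp (E t) * exp (E t)) = exp (E t)"
        unfolding exp_add[symmetric] using n by (simp add: E_def add_divide_distrib[symmetric] field_simps)
      then show ?thesis by (simp add: U_def power2_eq_square mult_ac)
    qed
    finally have i1: "U' t \<le> - ((1 - \<epsilon>\<^sup>2 / \<kappa>) / n) * exp (2 * (\<epsilon> - 1) / n * \<psi> t) * (U t)\<^sup>2" by simp
    \<comment> \<open>As q pays for c1 (trace B)^2, only (1 - c1) (trace B)^2 must be charged to n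
      |B|^2, and this leaves c1 n |B|^2. The bound c1 \<le> 1 keeps the factor nonnegative.\<close>
    have "(1 - c1) * (trace (B t))\<^sup>2 \<le> (1 - c1) * (real n * (B t \<bullet> B t))"
      using c1 tr by (intro mult_left_mono) auto
    then have "c1 * (n * (B t \<bullet> B t)) \<le> n * (B t \<bullet> B t) - (trace (B t))\<^sup>2 + q"
      using q(2) by (simp add: algebra_simps)
    with main have "n * (c1 * (B t \<bullet> B t)) \<le> n * (B t \<bullet> B t + trace (R t) + \<psi>2 t - 2 * (1 - \<epsilon>) / n * p * u t)"
      by (simp add: mult.left_commute)
    then have "c1 * (B t \<bullet> B t) \<le> B t \<bullet> B t + trace (R t) + \<psi>2 t - 2 * (1 - \<epsilon>) / n * p * u t"
      using n by (simp only: mult_le_cancel_left_pos)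
    then have "exp (E t) * (c1 * (B t \<bullet> B t)) \<le> - U' t"
      unfolding U'_eq by (rule mult_left_mono) simp
    then have i2: "c1 * exp (E t) * (B t \<bullet> B t) \<le> - U' t" by (simp add: mult_ac)
    show "(B has_vector_derivative - (B t ** B t) - R t) (at t) \<and> transpose (B t) = B t \<and>
      (U has_real_derivative U' t) (at t) \<and>
      U' t \<le> - ((1 - \<epsilon>\<^sup>2 / \<kappa>) / n) * exp (2 * (\<epsilon> - 1) / n * \<psi> t) * (U t)\<^sup>2 \<and>
      (\<kappa> - \<epsilon>\<^sup>2) / (1 + \<kappa> - 2 * \<epsilon>) * exp (2 * (1 - \<epsilon>) / n * \<psi> t) * (B t \<bullet> B t) \<le> - U' t"
      using dB[OF t] symB[OF t] dU i1 i2 by (simp add: c1_def E_def)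
  qed
qed

theorem rigidity:
  fixes \<psi> \<psi>1 \<psi>2 \<tau> :: "real \<Rightarrow> real"
  assumes no_conj: "\<And>y y1 s t. \<lbrakk>\<And>r. r \<in> J \<Longrightarrow> (y has_vector_derivative y1 r) (at r);
       \<And>r. r \<in> J \<Longrightarrow> (y1 has_vector_derivative - (R r *v y r)) (at r);
       s \<in> J; y s = 0; t \<in> J; s < t; y t = 0\<rbrakk> \<Longrightarrow> \<forall>r\<in>J. y r = 0"
    and card: "CARD('n) = n + 1" "n \<ge> 1"
    and \<psi>: "\<And>t. t \<in> J \<Longrightarrow> (\<psi> has_real_derivative \<psi>1 t) (at t)"
    and \<psi>1: "\<And>t. t \<in> J \<Longrightarrow> (\<psi>1 has_real_derivative \<psi>2 t) (at t)"
    and ric: "\<And>t. t \<in> J \<Longrightarrow> trace (R t) \<ge> - \<psi>2 t + (\<kappa> - 1) / n * (\<psi>1 t)\<^sup>2"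
    and \<kappa>: "\<epsilon>\<^sup>2 < \<kappa>"
    and \<tau>: "\<And>t. t \<in> J \<Longrightarrow> (\<tau> has_real_derivative exp (2 * (\<epsilon> - 1) / n * \<psi> t)) (at t)"
    and top: "\<And>c t. t \<in> J \<Longrightarrow> \<exists>r\<in>J. t < r \<and> \<tau> r > c"
    and bot: "\<And>c t. t \<in> J \<Longrightarrow> \<exists>r\<in>J. r < t \<and> \<tau> r < c"
    and t0: "t0 \<in> J"
  shows "R t0 = 0"
proof (rule ccontr)
  assume "R t0 \<noteq> 0"
  then obtain e where e: "e \<bullet> (R t0 *v e) \<noteq> 0"
    using symmetric_matrix_eq_0[OF sym_R[OF t0]] by blast
  \<comment> \<open>The sign makes f positive at t0. The quadratic term of the Riccati equation then
    appears with either sign, which is harmless because it is bounded in absolute value by a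
    multiple of - U'.\<close>
  define \<sigma> where "\<sigma> = sgn (e \<bullet> (R t0 *v e))"
  define f where "f t = \<sigma> * (e \<bullet> (R t *v e))" for t
  define \<rho> where "\<rho> = f t0 / 2"
  have \<sigma>: "\<bar>\<sigma>\<bar> = 1" using e by (simp add: \<sigma>_def sgn_if)
  have \<rho>: "\<rho> > 0" using e by (simp add: \<rho>_def f_def \<sigma>_def sgn_if mult_less_0_iff zero_less_mult_iff)
  have "continuous_on J f"
    unfolding f_def
    by (intro continuous_intros continuous_R bounded_bilinear.continuous_on[OF bounded_bilinear_matrix_vector_mult])
  then have "isCont f t0" using t0 continuous_on_eq_continuous_at[OF open_einterval] by blast
  then have "\<forall>\<^sub>F t in nhds t0. f t > \<rho>"
    using \<rho> by (intro order_tendstoD(1)[of f "f t0"]) (auto simp: \<rho>_def isCont_def tendsto_nhds_iff)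
  then have "\<forall>\<^sub>F t in nhds t0. f t > \<rho> \<and> t \<in> J"
    using eventually_nhds_in_open[OF open_einterval t0] by (simp add: eventually_conj_iff)
  then obtain d where d: "d > 0" "\<And>t. dist t t0 < d \<Longrightarrow> f t > \<rho> \<and> t \<in> J"
    unfolding eventually_nhds_metric by blast
  define t2 where "t2 = t0 + d / 2"
  have t2: "t0 < t2" using d by (simp add: t2_def)
  have near: "f t > \<rho>" "t \<in> J" if "t0 \<le> t" "t \<le> t2" for t
    using d(2)[of t] that d(1) by (auto simp: dist_real_def t2_def)
  define k where "k = (1 - \<epsilon>\<^sup>2 / \<kappa>) / n"
  have \<kappa>0: "\<kappa> > 0" using \<kappa> zero_le_power2[of \<epsilon>] by linarith
  have k: "k > 0" using \<kappa> \<kappa>0 card by (simp add: k_def)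
  define c1 where "c1 = (\<kappa> - \<epsilon>\<^sup>2) / (1 + \<kappa> - 2 * \<epsilon>)"
  have "(1 - \<epsilon>)\<^sup>2 \<ge> 0" by simp
  then have "1 + \<kappa> - 2 * \<epsilon> > 0" using \<kappa> by (simp add: power2_diff)
  then have c1: "c1 > 0" using \<kappa> by (simp add: c1_def)
  \<comment> \<open>The minimum of the weight over the fixed compact interval yields K independent
    of s, while B and U depend on s.\<close>
  have "continuous_on {t0..t2} (\<lambda>t. exp (2 * (1 - \<epsilon>) / n * \<psi> t))"
    by (intro continuous_intros continuous_at_imp_continuous_on) (auto intro!: DERIV_isCont[OF \<psi>] near(2))
  from continuous_attains_inf[OF compact_Icc _ this] t2
  obtain m where m: "m \<in> {t0..t2}" "\<forall>t\<in>{t0..t2}. exp (2 * (1 - \<epsilon>) / n * \<psi> m) \<le> exp (2 * (1 - \<epsilon>) / n * \<psi> t)"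
    by (auto simp del: exp_le_cancel_iff)
  define K where "K = 1 / (c1 * exp (2 * (1 - \<epsilon>) / n * \<psi> m))"
  have K: "K > 0" using c1 by (simp add: K_def)
  define q where "q = e \<bullet> e"
  \<comment> \<open>Two estimates are served at once: q K bounds the square of B e in x', and q^2 K
    bounds the square of x = \<sigma> e B e.\<close>
  define C where "C = (q + q * q) * K"
  have q: "q \<ge> 0" by (simp add: q_def)
  show False
  proof (rule comparison_with_small_riccati[OF t2 \<rho>, of C])
    show "C \<ge> 0" using q K by (simp add: C_def)
    fix \<delta> :: real assume \<delta>: "\<delta> > 0"
    \<comment> \<open>Past completeness makes \<tau> t0 - \<tau> r large enough to force U t0 \<le>
      \<delta>. The tensor starts at an earlier s because the estimate for U holds strictly after
      its singular parameter.\<close>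
    obtain r where r: "r \<in> J" "r < t0" "\<tau> r < \<tau> t0 - 1 / (k * \<delta>)" using bot[OF t0] by blast
    obtain s where s: "s \<in> J" "s < r" using bot[OF r(1)] by blast
    obtain B U U' where BU: "\<forall>t\<in>J. s < t \<longrightarrow> (B has_vector_derivative - (B t ** B t) - R t) (at t) \<and> transpose (B t) = B t \<and>
      (U has_real_derivative U' t) (at t) \<and>
      U' t \<le> - k * exp (2 * (\<epsilon> - 1) / n * \<psi> t) * (U t)\<^sup>2 \<and>
      c1 * exp (2 * (1 - \<epsilon>) / n * \<psi> t) * (B t \<bullet> B t) \<le> - U' t"
    proof -
      have "\<exists>B U U'. \<forall>t\<in>J. s < t \<longrightarrow> (B has_vector_derivative - (B t ** B t) - R t) (at t) \<and> transpose (B t) = B t \<and>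
      (U has_real_derivative U' t) (at t) \<and>
      U' t \<le> - k * exp (2 * (\<epsilon> - 1) / n * \<psi> t) * (U t)\<^sup>2 \<and>
      c1 * exp (2 * (1 - \<epsilon>) / n * \<psi> t) * (B t \<bullet> B t) \<le> - U' t"
        unfolding k_def c1_def
      proof (rule weighted_riccati[OF s(1) _ card])
        fix y y1 t
        assume "\<And>r. r \<in> J \<Longrightarrow> (y has_vector_derivative y1 r) (at r)"
          "\<And>r. r \<in> J \<Longrightarrow> (y1 has_vector_derivative - (R r *v y r)) (at r)"
          "y s = 0" "t \<in> J" "s < t" "y t = 0"
        then show "\<forall>r\<in>J. y r = 0" using no_conj[OF _ _ s(1), of y y1 t] by blast
      qed (assumption | rule \<psi> \<psi>1 ric \<kappa>)+
      then show thesis using that by blast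
    qed
    have dB: "(B has_vector_derivative - (B t ** B t) - R t) (at t)" and symB: "transpose (B t) = B t"
      and dU: "(U has_real_derivative U' t) (at t)"
      and i1: "U' t \<le> - k * exp (2 * (\<epsilon> - 1) / n * \<psi> t) * (U t)\<^sup>2"
      and i2: "c1 * exp (2 * (1 - \<epsilon>) / n * \<psi> t) * (B t \<bullet> B t) \<le> - U' t"
      if "t \<in> J" "s < t" for t using BU that by blast+
    note riccati = scalar_riccati[where a = a and b = b and s = s and U = U and U' = U' and k = k and \<tau> = \<tau>
        and \<tau>' = "\<lambda>t. exp (2 * (\<epsilon> - 1) / n * \<psi> t)"]
    have U0: "U t \<ge> 0" if "t \<in> J" "s < t" for t
      by (rule riccati(1)) (assumption | rule exp_gt_zero dU \<tau> k i1 top s(1) that)+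
    define x where "x t = \<sigma> * (e \<bullet> (B t *v e))" for t
    define x' where "x' t = \<sigma> * (e \<bullet> ((- (B t ** B t) - R t) *v e))" for t
    show "\<exists>x x' U U'. (\<forall>t. t0 \<le> t \<and> t \<le> t2 \<longrightarrow>
       (x has_real_derivative x' t) (at t) \<and> (U has_real_derivative U' t) (at t) \<and>
       (x t)\<^sup>2 \<le> - C * U' t \<and> x' t \<le> - \<rho> - C * U' t \<and> U t \<ge> 0) \<and> U t0 \<le> \<delta>"
    proof (rule exI[of _ x], rule exI[of _ x'], rule exI[of _ U], rule exI[of _ U'], intro conjI allI impI)
      fix t assume "t0 \<le> t \<and> t \<le> t2"
      then have t': "t0 \<le> t" "t \<le> t2" by auto
      then have t: "t \<in> J" "s < t" using near(2) s(2) r(2) by auto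
      have "((\<lambda>t. B t *v e) has_vector_derivative (- (B t ** B t) - R t) *v e) (at t)"
        using has_vector_derivative_matrix_vector_mult[OF dB[OF t] has_vector_derivative_const[of e]] by simp
      from bounded_linear.has_vector_derivative[OF bounded_linear_inner_right[of e] this]
      show "(x has_real_derivative x' t) (at t)"
        unfolding x_def x'_def
        by (intro DERIV_cmult) (simp add: has_real_derivative_iff_has_vector_derivative)
      show "(U has_real_derivative U' t) (at t)" "U t \<ge> 0" by (rule dU[OF t], rule U0[OF t])
      have "c1 * exp (2 * (1 - \<epsilon>) / n * \<psi> m) * (B t \<bullet> B t) \<le> c1 * exp (2 * (1 - \<epsilon>) / n * \<psi> t) * (B t \<bullet> B t)"
        using m(2) t' c1 by (intro mult_right_mono mult_left_mono) auto
      also have "\<dots> \<le> - U' t" by (rule i2[OF t])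
      finally have "K * (c1 * exp (2 * (1 - \<epsilon>) / n * \<psi> m) * (B t \<bullet> B t)) \<le> K * (- U' t)"
        using K by (intro mult_left_mono) auto
      then have BK: "B t \<bullet> B t \<le> K * (- U' t)"
        using c1 by (simp add: K_def)
      have Be: "(B t *v e) \<bullet> (B t *v e) \<le> q * (K * (- U' t))"
        using norm_matrix_vector_mult_sq[of "B t" e] mult_right_mono[OF BK q] by (simp add: q_def mult.commute)
      have nn: "K * (- U' t) \<ge> 0" using BK inner_ge_zero[of "B t"] by linarith
      have "(x t)\<^sup>2 = (e \<bullet> (B t *v e))\<^sup>2" using \<sigma> by (simp add: x_def power_mult_distrib flip: power2_abs[of \<sigma>])
      also have "\<dots> \<le> q * ((B t *v e) \<bullet> (B t *v e))"
        unfolding q_def by (rule Cauchy_Schwarz_ineq)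
      also have "\<dots> \<le> q * (q * (K * (- U' t)))" by (rule mult_left_mono[OF Be q])
      also have "\<dots> \<le> - C * U' t"
      proof -
        have "q * (K * (- U' t)) \<ge> 0" by (rule mult_nonneg_nonneg[OF q nn])
        then show ?thesis by (simp add: C_def algebra_simps)
      qed
      finally show "(x t)\<^sup>2 \<le> - C * U' t" .
      have eBB: "e \<bullet> ((B t ** B t) *v e) = (B t *v e) \<bullet> (B t *v e)"
      proof -
        have "e \<bullet> ((B t ** B t) *v e) = e \<bullet> (B t *v (B t *v e))" by (simp add: matrix_vector_mul_assoc)
        also have "\<dots> = (transpose (B t) *v e) \<bullet> (B t *v e)" by (simp add: dot_lmul_matrix)
        finally show ?thesis by (simp only: symB[OF t])
      qed
      have "(- (B t ** B t) - R t) *v e = - ((B t ** B t) *v e) - R t *v e"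
        by (simp add: matrix_vector_mult_diff_rdistrib bounded_bilinear.minus_left[OF bounded_bilinear_matrix_vector_mult])
      then have "x' t = - \<sigma> * ((B t *v e) \<bullet> (B t *v e)) - f t"
        by (simp add: x'_def f_def inner_diff_right eBB algebra_simps)
      also have "\<dots> \<le> (B t *v e) \<bullet> (B t *v e) - \<rho>"
      proof -
        have "- \<sigma> * ((B t *v e) \<bullet> (B t *v e)) \<le> 1 * ((B t *v e) \<bullet> (B t *v e))"
          using \<sigma> by (intro mult_right_mono) auto
        then show ?thesis using near(1)[OF t'] by simp
      qed
      also have "\<dots> \<le> - \<rho> - C * U' t"
      proof -
        have "q * (q * (K * (- U' t))) \<ge> 0" by (rule mult_nonneg_nonneg[OF q mult_nonneg_nonneg[OF q nn]])
        then show ?thesis using Be by (simp add: C_def algebra_simps)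
      qed
      finally show "x' t \<le> - \<rho> - C * U' t" .
    next
      have "k * (\<tau> t0 - \<tau> r) * U t0 \<le> 1"
        by (rule riccati(2)) (assumption | rule exp_gt_zero dU \<tau> k i1 top s(1) r(1) t0 s(2) r(2))+
      moreover have "1 / \<delta> * U t0 \<le> k * (\<tau> t0 - \<tau> r) * U t0"
      proof (rule mult_right_mono)
        have "k * (1 / (k * \<delta>)) \<le> k * (\<tau> t0 - \<tau> r)" using r(3) k by (intro mult_left_mono) auto
        then show "1 / \<delta> \<le> k * (\<tau> t0 - \<tau> r)" using k by simp
        show "U t0 \<ge> 0" by (rule U0[OF t0]) (use s r in simp)
      qed
      ultimately have "1 / \<delta> * U t0 \<le> 1" by linarith
      then show "U t0 \<le> \<delta>" using \<delta> by (simp add: field_simps)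
    qed
  qed
qed

end

section \<open>Charts and tangent vectors\<close>

locale atlas =
  fixes A :: "('m::{t2_space, second_countable_topology}, 'n::finite) chart set"
  assumes atlas: "smooth_atlas A"
begin

lemma chart_homeomorphism:
  "c \<in> A \<Longrightarrow> homeomorphism (dom_chart c) (chart_img c) (chart_map c) (chart_inv c)"
  using atlas unfolding smooth_atlas_def by blast

lemma open_dom: "c \<in> A \<Longrightarrow> open (dom_chart c)"
  using atlas unfolding smooth_atlas_def by blast

lemma open_img: "c \<in> A \<Longrightarrow> open (chart_img c)"
  using atlas unfolding smooth_atlas_def by blast

lemma chart_exists: "\<exists>c\<in>A. x \<in> dom_chart c"
  using atlas unfolding smooth_atlas_def by blast

lemma chart_at: "chart_at A x \<in> A" "x \<in> dom_chart (chart_at A x)"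
  using someI_ex[of "\<lambda>c. c \<in> A \<and> x \<in> dom_chart c"] chart_exists[of x]
  unfolding chart_at_def by blast+

lemma chart_inv_map: "c \<in> A \<Longrightarrow> x \<in> dom_chart c \<Longrightarrow> chart_inv c (chart_map c x) = x"
  using chart_homeomorphism homeomorphism_apply1 by blast

lemma chart_map_inv: "c \<in> A \<Longrightarrow> y \<in> chart_img c \<Longrightarrow> chart_map c (chart_inv c y) = y"
  using chart_homeomorphism homeomorphism_apply2 by blast

lemma chart_inv_dom: "c \<in> A \<Longrightarrow> y \<in> chart_img c \<Longrightarrow> chart_inv c y \<in> dom_chart c"
  by (rule inv_into_into)

definition overlap where "overlap c d = chart_map c ` (dom_chart c \<inter> dom_chart d)"

lemma overlapI: "x \<in> dom_chart c \<Longrightarrow> x \<in> dom_chart d \<Longrightarrow> chart_map c x \<in> overlap c d"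
  by (auto simp: overlap_def)

lemma overlapE:
  assumes "c \<in> A" "y \<in> overlap c d"
  obtains x where "x \<in> dom_chart c" "x \<in> dom_chart d" "y = chart_map c x" "chart_inv c y = x"
proof -
  obtain x where "x \<in> dom_chart c" "x \<in> dom_chart d" "y = chart_map c x"
    using assms(2) by (auto simp: overlap_def)
  then show thesis using that chart_inv_map[OF assms(1)] by blast
qed

lemma overlap_eq: "c \<in> A \<Longrightarrow> overlap c d = chart_img c \<inter> chart_inv c -` dom_chart d"
proof (intro equalityI subsetI)
  fix y assume c: "c \<in> A" and "y \<in> chart_img c \<inter> chart_inv c -` dom_chart d"
  then have "y \<in> chart_img c" "chart_inv c y \<in> dom_chart d" by auto
  then show "y \<in> overlap c d"
    using overlapI[OF chart_inv_dom[OF c]] chart_map_inv[OF c] by metis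
next
  fix y assume c: "c \<in> A" and y: "y \<in> overlap c d"
  from overlapE[OF this] show "y \<in> chart_img c \<inter> chart_inv c -` dom_chart d" by blast
qed

lemma open_overlap: "c \<in> A \<Longrightarrow> d \<in> A \<Longrightarrow> open (overlap c d)"
  unfolding overlap_eq
  by (rule continuous_open_preimage[OF homeomorphism_cont2[OF chart_homeomorphism] open_img open_dom])

lemma smooth_transition:
  assumes "c \<in> A" "d \<in> A" shows "Cinf (overlap c d) (transition c d)"
proof -
  have "smooth_on (overlap c d) (transition c d)"
    using atlas assms unfolding smooth_atlas_def overlap_def by blast
  then show ?thesis
    unfolding Cinf_def using open_overlap[OF assms] smooth_on_open_Ck by blast
qed

lemma transition_chart: "c \<in> A \<Longrightarrow> x \<in> dom_chart c \<Longrightarrow> transition c d (chart_map c x) = chart_map d x"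
  by (simp add: transition_def chart_inv_map)

text \<open>The chain rule for coordinate changes. It makes \<open>tangent_vec\<close> compatible in
  all charts, and with \<open>dd_transition_refl\<close> it makes the Jacobians injective.\<close>

lemma dd_transition_cocycle:
  assumes A: "c \<in> A" "d \<in> A" "e \<in> A" and x: "x \<in> dom_chart c" "x \<in> dom_chart d" "x \<in> dom_chart e"
  shows "dd (dd k (transition c d) (chart_map c x)) (transition d e) (chart_map d x)
    = dd k (transition c e) (chart_map c x)"
proof -
  have "((\<lambda>y. transition d e (transition c d y)) has_derivative
      (\<lambda>k. dd (dd k (transition c d) (chart_map c x)) (transition d e) (chart_map d x))) (at (chart_map c x))"
  proof (rule has_derivative_compose[OF Cinf_has_derivative[OF smooth_transition[OF A(1,2)] overlapI[OF x(1,2)]]])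
    show "(transition d e has_derivative (\<lambda>k. dd k (transition d e) (chart_map d x))) (at (transition c d (chart_map c x)))"
      unfolding transition_chart[OF A(1) x(1)]
      by (rule Cinf_has_derivative[OF smooth_transition[OF A(2,3)] overlapI[OF x(2,3)]])
  qed
  then have "dd k (\<lambda>y. transition d e (transition c d y)) (chart_map c x)
    = dd (dd k (transition c d) (chart_map c x)) (transition d e) (chart_map d x)" by (rule dd_eqI)
  moreover have "dd k (\<lambda>y. transition d e (transition c d y)) (chart_map c x) = dd k (transition c e) (chart_map c x)"
  proof (rule dd_cong)
    show "open (overlap c d \<inter> overlap c e)" by (intro open_Int open_overlap A)
    show "chart_map c x \<in> overlap c d \<inter> overlap c e" using x by (auto intro: overlapI)
    fix y assume "y \<in> overlap c d \<inter> overlap c e"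
    then obtain x' where x': "x' \<in> dom_chart c" "x' \<in> dom_chart d" "y = chart_map c x'"
      using overlapE[OF A(1)] by blast
    then show "transition d e (transition c d y) = transition c e y"
      using A by (simp add: transition_chart)
  qed
  ultimately show ?thesis by simp
qed

lemma dd_transition_refl:
  assumes "c \<in> A" "x \<in> dom_chart c"
  shows "dd k (transition c c) (chart_map c x) = k"
proof -
  have "dd k (transition c c) (chart_map c x) = dd k (\<lambda>y. y) (chart_map c x)"
    by (rule dd_cong[OF open_img[OF assms(1)]])
      (use assms chart_map_inv in \<open>auto simp: transition_def\<close>)
  then show ?thesis by (simp add: dd_def)
qed

lemma linear_dd_transition:
  assumes "c \<in> A" "d \<in> A" "x \<in> dom_chart c" "x \<in> dom_chart d"
  shows "linear (\<lambda>k. dd k (transition c d) (chart_map c x))"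
  by (rule Cinf_linear_dd[OF smooth_transition[OF assms(1,2)] overlapI[OF assms(3,4)]])

lemma tangent_vec_apply:
  "tangent_vec A c x u d = (if d \<in> A \<and> x \<in> dom_chart d then dd u (transition c d) (chart_map c x) else 0)"
  by (simp add: tangent_vec_def dd_def)

lemma tangent_spaceD:
  assumes "v \<in> tangent_space A x" "c \<in> A" "d \<in> A" "x \<in> dom_chart c" "x \<in> dom_chart d"
  shows "v d = dd (v c) (transition c d) (chart_map c x)"
proof -
  have "\<forall>c\<in>A. \<forall>d\<in>A. x \<in> dom_chart c \<inter> dom_chart d \<longrightarrow>
      v d = frechet_derivative (transition c d) (at (chart_map c x)) (v c)"
    using assms(1) unfolding tangent_space_def by blast
  then show ?thesis using assms(2-) unfolding dd_def by blast
qed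

lemma tangent_space_outside: "v \<in> tangent_space A x \<Longrightarrow> \<not> (c \<in> A \<and> x \<in> dom_chart c) \<Longrightarrow> v c = 0"
  unfolding tangent_space_def by blast

lemma tangent_spaceI:
  assumes "\<And>c. \<not> (c \<in> A \<and> x \<in> dom_chart c) \<Longrightarrow> v c = 0"
    and "\<And>c d. c \<in> A \<Longrightarrow> d \<in> A \<Longrightarrow> x \<in> dom_chart c \<Longrightarrow> x \<in> dom_chart d \<Longrightarrow> v d = dd (v c) (transition c d) (chart_map c x)"
  shows "v \<in> tangent_space A x"
  using assms unfolding tangent_space_def dd_def by blast

lemma tangent_vec_in:
  assumes "c \<in> A" "x \<in> dom_chart c"
  shows "tangent_vec A c x u \<in> tangent_space A x"
proof (rule tangent_spaceI)
  show "tangent_vec A c x u d = 0" if "\<not> (d \<in> A \<and> x \<in> dom_chart d)" for d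
    unfolding tangent_vec_apply using that by (rule if_not_P)
  fix d e assume de: "d \<in> A" "e \<in> A" "x \<in> dom_chart d" "x \<in> dom_chart e"
  show "tangent_vec A c x u e = dd (tangent_vec A c x u d) (transition d e) (chart_map d x)"
    unfolding tangent_vec_apply
    using de dd_transition_cocycle[OF assms(1) de(1,2) assms(2) de(3,4), of u] by simp
qed

lemma tangent_vec_self: "c \<in> A \<Longrightarrow> x \<in> dom_chart c \<Longrightarrow> tangent_vec A c x u c = u"
  by (simp add: tangent_vec_apply dd_transition_refl)

lemma tangent_vec_of:
  assumes "v \<in> tangent_space A x" "c \<in> A" "x \<in> dom_chart c"
  shows "tangent_vec A c x (v c) = v"
proof
  fix d
  show "tangent_vec A c x (v c) d = v d"
  proof (cases "d \<in> A \<and> x \<in> dom_chart d")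
    case True
    then show ?thesis
      using tangent_spaceD[OF assms(1,2) _ assms(3), of d] by (simp add: tangent_vec_apply)
  next
    case False
    then show ?thesis
      unfolding tangent_vec_apply tangent_space_outside[OF assms(1) False] by (rule if_not_P)
  qed
qed

lemma tangent_eqI:
  assumes "v \<in> tangent_space A x" "w \<in> tangent_space A x" "c \<in> A" "x \<in> dom_chart c" "v c = w c"
  shows "v = w"
proof -
  have "v = tangent_vec A c x (v c)" by (rule tangent_vec_of[OF assms(1,3,4), symmetric])
  also have "\<dots> = w" unfolding assms(5) by (rule tangent_vec_of[OF assms(2,3,4)])
  finally show ?thesis .
qed

lemma tangent_vec_change:
  assumes "c \<in> A" "d \<in> A" "x \<in> dom_chart c" "x \<in> dom_chart d"
  shows "tangent_vec A d x (dd u (transition c d) (chart_map c x)) = tangent_vec A c x u"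
proof -
  have "tangent_vec A c x u d = dd u (transition c d) (chart_map c x)"
    using assms by (simp add: tangent_vec_apply)
  then show ?thesis
    using tangent_vec_of[OF tangent_vec_in[OF assms(1,3)] assms(2,4), of u] by simp
qed

lemma tangent_space_zero: "(\<lambda>_. 0) \<in> tangent_space A x"
  by (rule tangent_spaceI[OF refl linear_0[OF linear_dd_transition, symmetric]])

lemma tangent_space_add:
  assumes "v \<in> tangent_space A x" "w \<in> tangent_space A x"
  shows "(\<lambda>c. v c + w c) \<in> tangent_space A x"
proof (rule tangent_spaceI)
  show "v c + w c = 0" if "\<not> (c \<in> A \<and> x \<in> dom_chart c)" for c
    using tangent_space_outside[OF assms(1) that] tangent_space_outside[OF assms(2) that] by simp
  fix d e assume de: "d \<in> A" "e \<in> A" "x \<in> dom_chart d" "x \<in> dom_chart e"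
  show "v e + w e = dd (v d + w d) (transition d e) (chart_map d x)"
    using linear_add[OF linear_dd_transition[OF de], of "v d" "w d"]
      tangent_spaceD[OF assms(1) de] tangent_spaceD[OF assms(2) de] by simp
qed

lemma tangent_space_scaleR:
  assumes "v \<in> tangent_space A x"
  shows "(\<lambda>c. k *\<^sub>R v c) \<in> tangent_space A x"
proof (rule tangent_spaceI)
  show "k *\<^sub>R v c = 0" if "\<not> (c \<in> A \<and> x \<in> dom_chart c)" for c
    using tangent_space_outside[OF assms(1) that] by simp
  fix d e assume de: "d \<in> A" "e \<in> A" "x \<in> dom_chart d" "x \<in> dom_chart e"
  show "k *\<^sub>R v e = dd (k *\<^sub>R v d) (transition d e) (chart_map d x)"
    using linear_cmul[OF linear_dd_transition[OF de], of k "v d"] tangent_spaceD[OF assms(1) de] by simp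
qed

lemma tangent_space_sum:
  assumes "\<And>i. i \<in> K \<Longrightarrow> v i \<in> tangent_space A x"
  shows "(\<lambda>c. \<Sum>i\<in>K. v i c) \<in> tangent_space A x"
  using assms
proof (induction K rule: infinite_finite_induct)
  case (insert i K)
  then show ?case using tangent_space_add[of "v i" x "\<lambda>c. \<Sum>i\<in>K. v i c"] by simp
qed (simp_all add: tangent_space_zero)

lemma tangent_vec_scaleR:
  assumes "c \<in> A" "x \<in> dom_chart c"
  shows "tangent_vec A c x (k *\<^sub>R u) = (\<lambda>d. k *\<^sub>R tangent_vec A c x u d)"
  by (rule tangent_eqI[OF tangent_vec_in[OF assms] tangent_space_scaleR[OF tangent_vec_in[OF assms]] assms])
    (simp add: tangent_vec_self[OF assms])

lemma local_rep_chart: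
  assumes "v \<in> tangent_space A x" "c \<in> A" "x \<in> dom_chart c"
  shows "local_rep A f c (chart_map c x, v c) = f x v"
  by (simp add: local_rep_def chart_inv_map[OF assms(2,3)] tangent_vec_of[OF assms])

end

lemma lorentz_signature_invertible:
  assumes "lorentz_signature (B :: real ^ 'n ^ 'n)"
  shows "invertible B"
proof -
  obtain P i0 where P: "transpose P ** B ** P = (\<chi> i j. if i = j then if i = i0 then -1 else 1 else 0 :: real ^ 'n ^ 'n)"
    using assms unfolding lorentz_signature_def by blast
  have "det (\<chi> i j. if i = j then if i = i0 then -1 else 1 else 0 :: real ^ 'n ^ 'n) = (\<Prod>i\<in>UNIV. if i = i0 then -1 else 1 :: real)"
    by (subst det_diagonal) auto
  then have "det (transpose P ** B ** P) \<noteq> 0" unfolding P by simp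
  then have "det B \<noteq> 0" by (auto simp: det_mul)
  then show ?thesis by (simp add: invertible_det_nz)
qed

section \<open>The coordinate expressions of a Lorentz-Finsler structure\<close>

locale spacetime = atlas A
  for A :: "('m::{t2_space, second_countable_topology}, 'n::finite) chart set" +
  fixes L :: "'m \<Rightarrow> ('m, 'n) tvec \<Rightarrow> real"
  assumes finsler: "lorentz_finsler A L"
begin

abbreviation lr where "lr \<equiv> local_rep A L"

lemma L_scaleR: "v \<in> tangent_space A x \<Longrightarrow> k > 0 \<Longrightarrow> L x (\<lambda>c. k *\<^sub>R v c) = k\<^sup>2 * L x v"
  using finsler unfolding lorentz_finsler_def by blast

lemma L_zero: "L x (\<lambda>_. 0) = 0"
  using L_scaleR[OF tangent_space_zero, of 2 x] by simp

lemma lorentz_signature_chart: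
  assumes "c \<in> A" "z \<in> chart_img c \<times> - {0}"
  shows "lorentz_signature (g_mat (lr c) z)"
proof -
  obtain y u where z: "z = (y, u)" "y \<in> chart_img c" "u \<noteq> 0" using assms(2) by auto
  define x where "x = chart_inv c y"
  have x: "x \<in> dom_chart c" "chart_map c x = y"
    using chart_inv_dom[OF assms(1) z(2)] chart_map_inv[OF assms(1) z(2)] by (simp_all add: x_def)
  have "tangent_vec A c x u \<in> tangent_space A x - {\<lambda>_. 0}"
    using tangent_vec_in[OF assms(1) x(1)] tangent_vec_self[OF assms(1) x(1), of u] z(3) by auto
  then have "lorentz_signature (g_mat (lr c) (chart_map c x, tangent_vec A c x u c))"
    using finsler assms(1) x(1) unfolding lorentz_finsler_def by blast
  then show ?thesis by (simp add: x(2) tangent_vec_self[OF assms(1) x(1)] z(1))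
qed

lemma local_finsler_chart:
  assumes c: "c \<in> A" shows "local_finsler (lr c) (chart_img c)"
proof
  show "open (chart_img c)" by (rule open_img[OF c])
  have "smooth_on (chart_img c \<times> - {0}) (lr c)" using finsler c unfolding lorentz_finsler_def by blast
  moreover have "open (chart_img c \<times> - {0 :: real ^ 'n})" using open_img[OF c] by (intro open_Times) auto
  ultimately show "Cinf (chart_img c \<times> - {0}) (lr c)"
    unfolding Cinf_def using smooth_on_open_Ck by blast
  show "lr c (y, k *\<^sub>R u) = k\<^sup>2 * lr c (y, u)" if y: "y \<in> chart_img c" "k > 0" for y u k
    using L_scaleR[OF tangent_vec_in[OF c chart_inv_dom[OF c y(1)]] y(2)]
    by (simp add: local_rep_def tangent_vec_scaleR[OF c chart_inv_dom[OF c y(1)]])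
  show "invertible (g_mat (lr c) z)" if "z \<in> chart_img c \<times> - {0}" for z
    by (rule lorentz_signature_invertible[OF lorentz_signature_chart[OF c that]])
qed

lemma local_rep_change:
  assumes "c \<in> A" "d \<in> A" "y \<in> overlap c d"
  shows "local_rep A f c (y, u) = local_rep A f d (transition c d y, dd u (transition c d) y)"
proof -
  obtain x where x: "x \<in> dom_chart c" "x \<in> dom_chart d" "y = chart_map c x" "chart_inv c y = x"
    using overlapE[OF assms(1,3)] by blast
  show ?thesis
    using assms x tangent_vec_change[OF assms(1,2) x(1,2), of u]
    by (simp add: local_rep_def transition_chart chart_inv_map)
qed

lemma finsler_change_charts:
  assumes c: "c \<in> A" and d: "d \<in> A"
  shows "finsler_change (lr c) (chart_img c) (lr d) (chart_img d) (transition c d) (overlap c d)"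
proof (rule finsler_change.intro[OF local_finsler_chart[OF c] local_finsler_chart[OF d]], rule finsler_change_axioms.intro)
  show "overlap c d \<subseteq> chart_img c" by (auto simp: overlap_def)
  show "transition c d ` overlap c d \<subseteq> chart_img d"
  proof
    fix w assume "w \<in> transition c d ` overlap c d"
    then obtain x where "x \<in> dom_chart c" "x \<in> dom_chart d" "w = transition c d (chart_map c x)"
      by (auto simp: overlap_def)
    then show "w \<in> chart_img d" using transition_chart[OF c, of x d] by simp
  qed
  show "Cinf (overlap c d) (transition c d)" by (rule smooth_transition[OF c d])
  show "lr c (y, u) = lr d (transition c d y, dd u (transition c d) y)" if "y \<in> overlap c d" for y u
    by (rule local_rep_change[OF c d that])
  \<comment> \<open>Passing to the chart d and back to c is the identity on components.\<close>
  show "k = 0" if y: "y \<in> overlap c d" and k: "dd k (transition c d) y = 0" for y k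
  proof -
    obtain x where x: "x \<in> dom_chart c" "x \<in> dom_chart d" "y = chart_map c x"
      using overlapE[OF c y] by blast
    have "k = dd (dd k (transition c d) y) (transition d c) (chart_map d x)"
      using dd_transition_cocycle[OF c d c x(1,2,1), of k] dd_transition_refl[OF c x(1)] x(3) by simp
    also have "\<dots> = 0"
      using linear_0[OF linear_dd_transition[OF d c x(2,1)]] k by simp
    finally show ?thesis .
  qed
qed

end

section \<open>Parallel fields along a timelike geodesic\<close>

lemma has_vector_derivative_comp:
  assumes "(z has_vector_derivative z') (at t)" "Cinf S f" "z t \<in> S"
  shows "((\<lambda>s. f (z s)) has_vector_derivative dd z' f (z t)) (at t)"
proof -
  have "((\<lambda>s. f (z s)) has_derivative (\<lambda>h. dd (h *\<^sub>R z') f (z t))) (at t)"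
    by (rule has_derivative_compose[OF assms(1)[unfolded has_vector_derivative_def] Cinf_has_derivative[OF assms(2,3)]])
  then show ?thesis
    by (simp add: has_vector_derivative_def linear_cmul[OF Cinf_linear_dd[OF assms(2,3)]])
qed

text \<open>Separated from timelike geodesics because \<open>geodesic_from\<close> chooses among
  causal geodesics, and the uniqueness argument must apply to whatever it chooses.\<close>

locale causal_curve = spacetime A L
  for A :: "('m::{t2_space, second_countable_topology}, 'n::finite) chart set" and L +
  fixes a b :: ereal and \<eta> :: "real \<Rightarrow> 'm"
  assumes causal_geodesic: "causal_geodesic A L a b \<eta>"
begin

abbreviation I where "I \<equiv> einterval a b"
abbreviation W where "W c \<equiv> local_finsler.W (chart_img c)"
abbreviation GG where "GG c \<equiv> local_finsler.G (lr c)"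
abbreviation NN where "NN c \<equiv> local_finsler.NN (lr c)"
abbreviation RR where "RR c \<equiv> local_finsler.RR (lr c)"
abbreviation gg where "gg c \<equiv> local_finsler.g (lr c)"
abbreviation vel where "vel \<equiv> velocity A \<eta>"

text \<open>The coordinate expression of the lift of \<eta> to the tangent bundle, for which the
  geodesic equation is autonomous of first order.\<close>

definition z where "z c t = (chart_map c (\<eta> t), vel t c)"
definition D where "D c = {t \<in> I. \<eta> t \<in> dom_chart c}"

lemma continuous_eta: "continuous_on I \<eta>"
  using causal_geodesic unfolding causal_geodesic_def smooth_curve_def by blast

lemma D_I: "t \<in> D c \<Longrightarrow> t \<in> I" by (simp add: D_def)

lemma D_dom: "t \<in> D c \<Longrightarrow> \<eta> t \<in> dom_chart c" by (simp add: D_def)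

lemma open_D: "c \<in> A \<Longrightarrow> open (D c)"
proof -
  assume c: "c \<in> A"
  have "D c = I \<inter> \<eta> -` dom_chart c" by (auto simp: D_def)
  then show ?thesis
    using continuous_open_preimage[OF continuous_eta open_einterval open_dom[OF c]] by simp
qed

lemma D_exists: "t \<in> I \<Longrightarrow> \<exists>c\<in>A. t \<in> D c"
  using chart_exists[of "\<eta> t"] unfolding D_def by blast

lemma smooth_chart_eta:
  assumes "c \<in> A" shows "Cinf (D c) (\<lambda>t. chart_map c (\<eta> t))"
proof -
  have "smooth_on (D c) (\<lambda>t. chart_map c (\<eta> t))"
    using causal_geodesic assms unfolding causal_geodesic_def smooth_curve_def D_def by blast
  then show ?thesis unfolding Cinf_def using open_D[OF assms] smooth_on_open_Ck by blast
qed

lemma velocity_eq: "c \<in> A \<Longrightarrow> t \<in> D c \<Longrightarrow> vel t c = vector_derivative (\<lambda>s. chart_map c (\<eta> s)) (at t)"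
  by (simp add: velocity_def D_def)

lemma position_derivative:
  assumes "c \<in> A" "t \<in> D c"
  shows "((\<lambda>s. chart_map c (\<eta> s)) has_vector_derivative vel t c) (at t)"
  unfolding velocity_eq[OF assms] vector_derivative_works[symmetric]
  by (rule Cinf_differentiable[OF smooth_chart_eta[OF assms(1)] assms(2)])

lemma velocity_derivative:
  assumes "c \<in> A" "t \<in> D c"
  shows "((\<lambda>s. vel s c) has_vector_derivative - 2 *\<^sub>R GG c (z c t)) (at t)"
proof -
  have "\<forall>t\<in>I. \<forall>c\<in>A. \<eta> t \<in> dom_chart c \<longrightarrow> ((\<lambda>s. vel s c) has_vector_derivative
           - 2 *\<^sub>R spray (local_rep A L c) (chart_map c (\<eta> t), vel t c)) (at t)"
    using causal_geodesic unfolding causal_geodesic_def by blast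
  then show ?thesis
    using assms D_I D_dom unfolding local_finsler.G_def[OF local_finsler_chart[OF assms(1)]] z_def by blast
qed

lemma velocity_tangent:
  assumes "t \<in> I" shows "vel t \<in> tangent_space A (\<eta> t)"
proof (rule tangent_spaceI)
  show "vel t c = 0" if "\<not> (c \<in> A \<and> \<eta> t \<in> dom_chart c)" for c
    unfolding velocity_def using that by (rule if_not_P)
  fix c d assume cd: "c \<in> A" "d \<in> A" "\<eta> t \<in> dom_chart c" "\<eta> t \<in> dom_chart d"
  have t: "t \<in> D c" "t \<in> D d" using cd assms by (simp_all add: D_def)
  have "((\<lambda>s. transition c d (chart_map c (\<eta> s))) has_vector_derivative
      dd (vel t c) (transition c d) (chart_map c (\<eta> t))) (at t)"
    by (rule has_vector_derivative_comp[OF position_derivative[OF cd(1) t(1)] smooth_transition[OF cd(1,2)] overlapI[OF cd(3,4)]])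
  then have "((\<lambda>s. chart_map d (\<eta> s)) has_vector_derivative dd (vel t c) (transition c d) (chart_map c (\<eta> t))) (at t)"
    by (rule has_vector_derivative_transform_within_open[OF _ open_D[OF cd(1)] t(1)])
      (rule transition_chart[OF cd(1) D_dom])
  then show "vel t d = dd (vel t c) (transition c d) (chart_map c (\<eta> t))"
    using vector_derivative_unique_at[OF position_derivative[OF cd(2) t(2)]] by blast
qed

lemma z_derivative:
  assumes "c \<in> A" "t \<in> D c"
  shows "(z c has_vector_derivative (vel t c, - 2 *\<^sub>R GG c (z c t))) (at t)"
  unfolding z_def[abs_def]
  by (intro has_vector_derivative_Pair position_derivative[OF assms] velocity_derivative[OF assms, unfolded z_def])

end

locale geodesic = causal_curve A L a b \<eta>
  for A :: "('m::{t2_space, second_countable_topology}, 'n::finite) chart set" and L and a b and \<eta> +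
  assumes timelike_geodesic: "timelike_geodesic A L a b \<eta>"
begin

lemma L_velocity: "t \<in> I \<Longrightarrow> L (\<eta> t) (vel t) = - (1 / 2)"
proof -
  assume "t \<in> I"
  then have "sqrt (- 2 * L (\<eta> t) (vel t)) = 1"
    using timelike_geodesic unfolding timelike_geodesic_def finsler_F_def by blast
  then have "- 2 * L (\<eta> t) (vel t) = 1" by (simp add: real_sqrt_eq_1_iff)
  then show ?thesis by simp
qed

lemma velocity_nonzero:
  assumes "c \<in> A" "t \<in> D c" shows "vel t c \<noteq> 0"
proof
  assume "vel t c = 0"
  then have "vel t = (\<lambda>_. 0)"
    by (intro tangent_eqI[OF velocity_tangent[OF D_I[OF assms(2)]] tangent_space_zero assms(1) D_dom[OF assms(2)]])
  then show False using L_velocity[OF D_I[OF assms(2)]] L_zero by simp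
qed

lemma z_W: "c \<in> A \<Longrightarrow> t \<in> D c \<Longrightarrow> z c t \<in> W c"
proof -
  assume c: "c \<in> A" "t \<in> D c"
  show ?thesis
    unfolding local_finsler.W_def[OF local_finsler_chart[OF c(1)]] z_def
    using velocity_nonzero[OF c] imageI[OF D_dom[OF c(2)]] by simp
qed

text \<open>The lift is an integral curve of the spray, so \<open>SS\<close> is differentiation in
  the parameter.\<close>

lemma along_derivative:
  fixes f :: "_ \<Rightarrow> 'c::real_normed_vector"
  assumes "c \<in> A" "t \<in> D c" "Cinf (W c) f"
  shows "((\<lambda>s. f (z c s)) has_vector_derivative local_finsler.SS (lr c) f (z c t)) (at t)"
proof -
  have "(vel t c, - 2 *\<^sub>R GG c (z c t)) = (snd (z c t), - 2 *\<^sub>R GG c (z c t))" by (simp add: z_def)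
  then show ?thesis
    using has_vector_derivative_comp[OF z_derivative[OF assms(1,2)] assms(3) z_W[OF assms(1,2)]]
    by (simp add: local_finsler.SS_def[OF local_finsler_chart[OF assms(1)]])
qed

lemma continuous_along:
  assumes "c \<in> A" "Cinf (W c) f"
  shows "continuous_on (D c) (\<lambda>s. f (z c s))"
  using has_vector_derivative_continuous[OF along_derivative[OF assms(1) _ assms(2)]]
  by (intro continuous_at_imp_continuous_on) blast

lemma change_at:
  assumes "c \<in> A" "d \<in> A" "t \<in> D c" "t \<in> D d"
  shows "z c t \<in> finsler_change.V (overlap c d)"
    and "finsler_change.\<Phi> (transition c d) (z c t) = z d t"
proof -
  interpret ch: finsler_change "lr c" "chart_img c" "lr d" "chart_img d" "transition c d" "overlap c d"
    by (rule finsler_change_charts[OF assms(1,2)])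
  show "z c t \<in> ch.V"
    using overlapI[OF D_dom[OF assms(3)] D_dom[OF assms(4)]] velocity_nonzero[OF assms(1,3)]
    by (simp add: ch.V_def z_def)
  show "ch.\<Phi> (z c t) = z d t"
    using tangent_spaceD[OF velocity_tangent[OF D_I[OF assms(3)]] assms(1,2) D_dom[OF assms(3)] D_dom[OF assms(4)]]
      transition_chart[OF assms(1) D_dom[OF assms(3)]]
    by (simp add: ch.\<Phi>_def z_def)
qed

text \<open>By \<open>Gamma_contraction\<close> the covariant derivative of \<open>V\<close> is \<open>V' + NN V\<close>.\<close>

definition par :: "(real \<Rightarrow> ('m, 'n) tvec) \<Rightarrow> real \<Rightarrow> bool" where
  "par V t \<longleftrightarrow> V t \<in> tangent_space A (\<eta> t) \<and>
     (\<forall>c\<in>A. t \<in> D c \<longrightarrow> ((\<lambda>s. V s c) has_vector_derivative - NN c (V t c) (z c t)) (at t))"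

lemma par_tangent: "par V t \<Longrightarrow> V t \<in> tangent_space A (\<eta> t)"
  by (simp add: par_def)

lemma par_derivative: "par V t \<Longrightarrow> c \<in> A \<Longrightarrow> t \<in> D c \<Longrightarrow> ((\<lambda>s. V s c) has_vector_derivative - NN c (V t c) (z c t)) (at t)"
  unfolding par_def by blast

lemma par_cong:
  assumes "par V t" "open S" "t \<in> S" "\<And>s. s \<in> S \<Longrightarrow> V' s = V s"
  shows "par V' t"
  unfolding par_def
proof (intro conjI ballI impI)
  show "V' t \<in> tangent_space A (\<eta> t)" using par_tangent[OF assms(1)] assms(4)[OF assms(3)] by simp
  fix c assume c: "c \<in> A" "t \<in> D c"
  have "((\<lambda>s. V' s c) has_vector_derivative - NN c (V t c) (z c t)) (at t)"
    by (rule has_vector_derivative_transform_within_open[OF par_derivative[OF assms(1) c] assms(2,3)])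
      (simp add: assms(4))
  then show "((\<lambda>s. V' s c) has_vector_derivative - NN c (V' t c) (z c t)) (at t)"
    by (simp add: assms(4)[OF assms(3)])
qed

lemma par_velocity: "t \<in> I \<Longrightarrow> par vel t"
  unfolding par_def
proof (intro conjI ballI impI velocity_tangent)
  fix c assume c: "c \<in> A" "t \<in> D c"
  interpret l: local_finsler "lr c" "chart_img c" by (rule local_finsler_chart[OF c(1)])
  have "snd (z c t) = vel t c" by (simp add: z_def)
  then show "((\<lambda>s. vel s c) has_vector_derivative - NN c (vel t c) (z c t)) (at t)"
    using velocity_derivative[OF c] l.NN_radial[OF z_W[OF c]] by simp
qed

lemma NN_ode:
  assumes c: "c \<in> A" and J: "{p<..<q} \<subseteq> D c"
  shows "linear_ode (ereal p) (ereal q) (\<lambda>t u. - NN c u (z c t))"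
proof (rule linear_ode.intro)
  interpret l: local_finsler "lr c" "chart_img c" by (rule local_finsler_chart[OF c])
  show "linear (\<lambda>u. - NN c u (z c t))" if "t \<in> einterval (ereal p) (ereal q)" for t
    using linear_compose_neg[OF l.linear_NN[OF z_W[OF c]]] that J by auto
  show "continuous_on (einterval (ereal p) (ereal q)) (\<lambda>t. - NN c u (z c t))" for u
    using continuous_on_subset[OF continuous_along[OF c l.smooth_NN[of u]] J]
    by (auto intro: continuous_intros)
qed

lemma chart_interval:
  assumes "c \<in> A" "t \<in> D c" "open S" "t \<in> S"
  obtains e where "e > 0" "{t - e<..<t + e} \<subseteq> D c \<inter> S"
proof -
  obtain e where "e > 0" "ball t e \<subseteq> D c \<inter> S"
    using open_contains_ball[of "D c \<inter> S"] open_Int[OF open_D[OF assms(1)] assms(3)] assms(2,4) by blast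
  then show thesis using that[of e] by (simp add: ball_eq_greaterThanLessThan)
qed

lemma par_local_unique:
  assumes "open S" "\<And>r. r \<in> S \<Longrightarrow> par V r" "\<And>r. r \<in> S \<Longrightarrow> par V' r" "s \<in> S" "s \<in> I" "V s = V' s"
  shows "\<exists>e>0. \<forall>r\<in>ball s e. V r = V' r"
proof -
  obtain c where c: "c \<in> A" "s \<in> D c" using D_exists[OF assms(5)] by blast
  obtain e where e: "e > 0" "{s - e<..<s + e} \<subseteq> D c \<inter> S"
    by (rule chart_interval[OF c assms(1,4)])
  interpret ode: linear_ode "ereal (s - e)" "ereal (s + e)" "\<lambda>t u. - NN c u (z c t)"
    by (rule NN_ode[OF c(1)]) (use e in blast)
  have "V r = V' r" if r: "r \<in> ball s e" for r
  proof -
    have rI: "r \<in> {s - e<..<s + e}" using r by (simp add: ball_eq_greaterThanLessThan)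
    have "V r c = V' r c"
    proof (rule ode.unique[where s = s])
      fix t assume "t \<in> ode.I"
      then have "t \<in> D c \<inter> S" using e(2) by auto
      then show "((\<lambda>s. V s c) has_vector_derivative - NN c (V t c) (z c t)) (at t)"
        "((\<lambda>s. V' s c) has_vector_derivative - NN c (V' t c) (z c t)) (at t)"
        using par_derivative[OF assms(2) c(1)] par_derivative[OF assms(3) c(1)] by auto
    qed (use rI e assms(6) in auto)
    moreover have "r \<in> D c \<inter> S" using rI e(2) by blast
    ultimately show ?thesis
      using tangent_eqI[OF par_tangent[OF assms(2)] par_tangent[OF assms(3)] c(1) D_dom] by blast
  qed
  then show ?thesis using e(1) by blast
qed

text \<open>Uniqueness for the differential equation is available inside one chart, and
  connectedness of S spreads it. For openness of N the two fields are compared through their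
  components in a chart, where their difference is continuous.\<close>

lemma par_unique:
  assumes S: "open S" "connected S" "S \<subseteq> I"
    and V: "\<And>r. r \<in> S \<Longrightarrow> par V r" "\<And>r. r \<in> S \<Longrightarrow> par V' r"
    and s: "s \<in> S" "V s = V' s" and t: "t \<in> S"
  shows "V t = V' t"
proof (rule ccontr)
  assume ne: "V t \<noteq> V' t"
  define P where "P = {r \<in> S. V r = V' r}"
  define N where "N = {r \<in> S. V r \<noteq> V' r}"
  have "open P"
    unfolding open_contains_ball
  proof
    fix r assume r: "r \<in> P"
    then have rS: "r \<in> S" "V r = V' r" by (simp_all add: P_def)
    obtain e where e: "e > 0" "\<forall>u\<in>ball r e. V u = V' u"
      using par_local_unique[OF S(1) V rS(1) _ rS(2)] rS(1) S(3) by blast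
    obtain e' where e': "e' > 0" "ball r e' \<subseteq> S" using S(1) rS(1) open_contains_ball by blast
    show "\<exists>e>0. ball r e \<subseteq> P"
      by (rule exI[of _ "min e e'"]) (use e e' in \<open>auto simp: P_def\<close>)
  qed
  moreover have "open N"
    unfolding open_contains_ball
  proof
    fix r assume "r \<in> N"
    then have r: "r \<in> S" "V r \<noteq> V' r" by (simp_all add: N_def)
    obtain c where c: "c \<in> A" "r \<in> D c" using D_exists r S(3) by blast
    have "V r c \<noteq> V' r c"
      using tangent_eqI[OF par_tangent[OF V(1)[OF r(1)]] par_tangent[OF V(2)[OF r(1)]] c(1) D_dom[OF c(2)]] r(2) by blast
    then have nz: "V r c - V' r c \<noteq> 0" by simp
    have "isCont (\<lambda>u. V u c - V' u c) r"
      by (intro continuous_diff has_vector_derivative_continuous[OF par_derivative[OF V(1)[OF r(1)] c]]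
          has_vector_derivative_continuous[OF par_derivative[OF V(2)[OF r(1)] c]])
    then obtain e where e: "e > 0" "\<forall>y. dist r y < e \<longrightarrow> V y c - V' y c \<noteq> 0"
      using continuous_at_avoid[of r "\<lambda>u. V u c - V' u c" 0] nz by blast
    obtain e' where e': "e' > 0" "ball r e' \<subseteq> S" using S(1) r(1) open_contains_ball by blast
    have "ball r (min e e') \<subseteq> N"
    proof
      fix y assume "y \<in> ball r (min e e')"
      then have "dist r y < e" "y \<in> S" using e' by auto
      then show "y \<in> N" using e(2) by (auto simp: N_def)
    qed
    then show "\<exists>e>0. ball r e \<subseteq> N" using e(1) e'(1) by (intro exI[of _ "min e e'"]) simp
  qed
  moreover have "P \<inter> N \<inter> S = {}" "S \<subseteq> P \<union> N" "s \<in> P \<inter> S" "t \<in> N \<inter> S"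
    using s t ne by (auto simp: P_def N_def)
  ultimately show False using connectedD[OF S(2), of P N] by blast
qed

text \<open>The equation is solved in one chart c. In another chart the derivative of the moving
  Jacobian produces a Hessian term, which is the inhomogeneous term of \<open>NN_change\<close>, so
  the solution is parallel there too. One radius serves every initial parameter in the ball and
  every initial vector, as needed for continuation.\<close>

lemma par_local_exists:
  assumes "t0 \<in> I"
  shows "\<exists>e>0. ball t0 e \<subseteq> I \<and> (\<forall>s\<in>ball t0 e. \<forall>w\<in>tangent_space A (\<eta> s). \<exists>V. V s = w \<and> (\<forall>r\<in>ball t0 e. par V r))"
proof -
  obtain c where c: "c \<in> A" "t0 \<in> D c" using D_exists[OF assms] by blast
  obtain e where e: "e > 0" "{t0 - e<..<t0 + e} \<subseteq> D c \<inter> UNIV"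
    by (rule chart_interval[OF c open_UNIV UNIV_I])
  interpret ode: linear_ode "ereal (t0 - e)" "ereal (t0 + e)" "\<lambda>t u. - NN c u (z c t)"
    by (rule NN_ode[OF c(1)]) (use e in blast)
  have I: "ode.I = ball t0 e" by (simp add: ball_eq_greaterThanLessThan)
  have D: "r \<in> D c" if "r \<in> ball t0 e" for r using that e(2) by (auto simp: ball_eq_greaterThanLessThan)
  have "\<exists>V. V s = w \<and> (\<forall>r\<in>ball t0 e. par V r)" if s: "s \<in> ball t0 e" and w: "w \<in> tangent_space A (\<eta> s)" for s w
  proof -
    obtain u where u: "u s = w c" "\<And>t. t \<in> ball t0 e \<Longrightarrow> (u has_vector_derivative - NN c (u t) (z c t)) (at t)"
      using ode.existence[of s "w c"] s unfolding I by blast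
    define V where "V t = tangent_vec A c (\<eta> t) (u t)" for t
    have "par V r" if r: "r \<in> ball t0 e" for r
      unfolding par_def
    proof (intro conjI ballI impI)
      show "V r \<in> tangent_space A (\<eta> r)" unfolding V_def by (rule tangent_vec_in[OF c(1) D_dom[OF D[OF r]]])
      fix d assume d: "d \<in> A" "r \<in> D d"
      interpret ch: finsler_change "lr c" "chart_img c" "lr d" "chart_img d" "transition c d" "overlap c d"
        by (rule finsler_change_charts[OF c(1) d(1)])
      let ?x = "chart_map c (\<eta> r)"
      have x: "?x \<in> overlap c d" by (rule overlapI[OF D_dom[OF D[OF r]] D_dom[OF d(2)]])
      have Vd: "V t d = dd (u t) (transition c d) (chart_map c (\<eta> t))" if "t \<in> D d" for t
        using d(1) D_dom[OF that] by (simp add: V_def tangent_vec_apply)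
      have "((\<lambda>t. dd (u t) (transition c d) (chart_map c (\<eta> t))) has_derivative
         (\<lambda>h. dd (h *\<^sub>R vel r c) (dd (u r) (transition c d)) ?x + dd (h *\<^sub>R - NN c (u r) (z c r)) (transition c d) ?x)) (at r)"
        by (rule has_derivative_dd_variable[where \<Phi> = "\<lambda>t. chart_map c (\<eta> t)" and x = r, OF ch.smooth_phi x])
          (use position_derivative[OF c(1) D[OF r]] u(2)[OF r] in \<open>simp_all add: has_vector_derivative_def\<close>)
      then have "((\<lambda>t. dd (u t) (transition c d) (chart_map c (\<eta> t))) has_vector_derivative
         dd (vel r c) (dd (u r) (transition c d)) ?x + dd (- NN c (u r) (z c r)) (transition c d) ?x) (at r)"
        unfolding has_vector_derivative_def
        by (simp only: linear_cmul[OF Cinf_linear_dd[OF Cinf_dd[OF ch.smooth_phi] x]]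
          linear_cmul[OF ch.linear_J[OF x]] scaleR_add_right)
      moreover have "dd (vel r c) (dd (u r) (transition c d)) ?x + dd (- NN c (u r) (z c r)) (transition c d) ?x
          = - NN d (V r d) (z d r)"
      proof -
        have "NN d (dd (u r) (transition c d) ?x) (z d r)
          = dd (NN c (u r) (z c r)) (transition c d) ?x - ch.D2 (u r) (vel r c) ?x"
          using ch.NN_change[OF change_at(1)[OF c(1) d(1) D[OF r] d(2)], of "u r"]
            change_at(2)[OF c(1) d(1) D[OF r] d(2)] by (simp add: z_def)
        then show ?thesis
          unfolding Vd[OF d(2)] ch.D2_sym[OF x, of "u r"]
          by (simp add: ch.D2_def linear_neg[OF ch.linear_J[OF x]])
      qed
      ultimately have "((\<lambda>t. dd (u t) (transition c d) (chart_map c (\<eta> t))) has_vector_derivative - NN d (V r d) (z d r)) (at r)"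
        by simp
      then show "((\<lambda>t. V t d) has_vector_derivative - NN d (V r d) (z d r)) (at r)"
        by (rule has_vector_derivative_transform_within_open[OF _ open_D[OF d(1)] d(2)]) (simp add: Vd)
    qed
    moreover have "V s = w" unfolding V_def u(1) by (rule tangent_vec_of[OF w c(1) D_dom[OF D[OF s]]])
    ultimately show ?thesis by blast
  qed
  moreover have "ball t0 e \<subseteq> I" using D D_I by blast
  ultimately show ?thesis using e(1) by blast
qed

text \<open>The parameters reachable from s0 form an open set. So do the others: if the uniform ball
  around such a parameter contained a reachable s, the field could be restarted at s and continued
  over the whole ball. Connectedness of the interval finishes the argument.\<close>

lemma par_exists:
  assumes s0: "s0 \<in> I" and w0: "w0 \<in> tangent_space A (\<eta> s0)"
  shows "\<exists>V. V s0 = w0 \<and> (\<forall>t\<in>I. par V t)"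
proof -
  define good where "good t J V \<longleftrightarrow> open J \<and> connected J \<and> J \<subseteq> I \<and> s0 \<in> J \<and> t \<in> J \<and> V s0 = w0 \<and> (\<forall>r\<in>J. par V r)"
    for t J and V :: "real \<Rightarrow> ('m, 'n) tvec"
  define Q where "Q t \<longleftrightarrow> (\<exists>J V. good t J V)" for t
  have step: "Q t" if te: "ball t e \<subseteq> I" and ex: "\<forall>s\<in>ball t e. \<forall>w\<in>tangent_space A (\<eta> s). \<exists>V. V s = w \<and> (\<forall>r\<in>ball t e. par V r)"
    and s: "s \<in> ball t e" "Q s" for t e s
  proof -
    obtain J V where g: "good s J V" using s(2) unfolding Q_def by blast
    then have J: "open J" "connected J" "J \<subseteq> I" "s0 \<in> J" "s \<in> J" "V s0 = w0" and parV: "\<And>r. r \<in> J \<Longrightarrow> par V r"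
      unfolding good_def by blast+
    obtain V2 where V2: "V2 s = V s" and parV2: "\<And>r. r \<in> ball t e \<Longrightarrow> par V2 r"
      using ex s(1) par_tangent[OF parV[OF J(5)]] by blast
    have conn: "connected (J \<inter> ball t e)"
      using J(2) connected_ball[of t e] by (simp add: is_interval_connected_1[symmetric] is_interval_Int)
    have agree: "V r = V2 r" if "r \<in> J" "r \<in> ball t e" for r
      by (rule par_unique[of "J \<inter> ball t e" V V2 s])
        (use J s conn that V2 parV parV2 in \<open>auto intro: open_Int\<close>)
    define V3 where "V3 r = (if r \<in> J then V r else V2 r)" for r
    have "par V3 r" if r: "r \<in> J \<union> ball t e" for r
    proof (cases "r \<in> J")
      case True
      show ?thesis by (rule par_cong[OF parV[OF True] J(1) True]) (simp add: V3_def)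
    next
      case False
      then have "r \<in> ball t e" using r by blast
      then show ?thesis
        by (intro par_cong[OF parV2 open_ball[of t e]]) (auto simp: V3_def agree)
    qed
    moreover have "connected (J \<union> ball t e)"
      using connected_Un[OF J(2) connected_ball] J(5) s(1) by blast
    moreover have "t \<in> ball t e" using s(1) by (metis ball_empty centre_in_ball empty_iff not_le)
    ultimately have "good t (J \<union> ball t e) V3"
      unfolding good_def using J te by (auto simp: V3_def)
    then show ?thesis unfolding Q_def by blast
  qed
  have Q: "Q t" if t: "t \<in> I" for t
  proof (rule ccontr)
    assume nQ: "\<not> Q t"
    define P where "P = {r \<in> I. Q r}"
    define N where "N = {r \<in> I. \<not> Q r}"
    have "open P"
      unfolding open_contains_ball
    proof
      fix r assume "r \<in> P"
      then obtain J V where g: "good r J V" unfolding P_def Q_def by blast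
      then have J: "open J" "r \<in> J" unfolding good_def by blast+
      have "J \<subseteq> P"
      proof
        fix u assume "u \<in> J"
        then have "good u J V" using g unfolding good_def by blast
        then show "u \<in> P" using g \<open>u \<in> J\<close> unfolding P_def Q_def good_def by blast
      qed
      moreover obtain e where "e > 0" "ball r e \<subseteq> J" using J by (rule openE)
      ultimately show "\<exists>e>0. ball r e \<subseteq> P" by (intro exI[of _ e]) simp
    qed
    moreover have "open N"
      unfolding open_contains_ball
    proof
      fix r assume "r \<in> N"
      then have r: "r \<in> I" "\<not> Q r" unfolding N_def by blast+
      from par_local_exists[OF r(1)] obtain e where e: "e > 0" "ball r e \<subseteq> I"
        "\<forall>s\<in>ball r e. \<forall>w\<in>tangent_space A (\<eta> s). \<exists>V. V s = w \<and> (\<forall>r'\<in>ball r e. par V r')" by blast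
      then have "ball r e \<subseteq> N" using step[OF e(2,3)] r(2) unfolding N_def by blast
      then show "\<exists>e>0. ball r e \<subseteq> N" using e(1) by blast
    qed
    moreover have "Q s0"
    proof -
      from par_local_exists[OF s0] obtain e where e: "e > 0" "ball s0 e \<subseteq> I"
        "\<forall>s\<in>ball s0 e. \<forall>w\<in>tangent_space A (\<eta> s). \<exists>V. V s = w \<and> (\<forall>r'\<in>ball s0 e. par V r')" by blast
      then obtain V where "V s0 = w0" "\<forall>r\<in>ball s0 e. par V r" using w0 centre_in_ball by blast
      then have "good s0 (ball s0 e) V" unfolding good_def using e by simp
      then show ?thesis unfolding Q_def by blast
    qed
    moreover have "connected I"
      by (auto simp: is_interval_connected_1[symmetric] is_interval_1 intro: einterval_mono)
    ultimately show False
      using connectedD[of I P N] s0 t nQ unfolding P_def N_def by blast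
  qed
  \<comment> \<open>A solution is chosen separately for each parameter; \<open>par_unique\<close>
    makes the choices agree on common intervals, so reading off each at its own parameter gives one
    parallel field.\<close>
  define sel where "sel t = (SOME p. good t (fst p) (snd p))" for t
  have sel: "good t (fst (sel t)) (snd (sel t))" if t: "t \<in> I" for t
  proof -
    have "\<exists>p. good t (fst p) (snd p)" using Q[OF t] unfolding Q_def by auto
    then show ?thesis unfolding sel_def by (rule someI_ex)
  qed
  define V where "V t = snd (sel t) t" for t
  show ?thesis
  proof (rule exI[of _ V], intro conjI ballI)
    show "V s0 = w0" using sel[OF s0] unfolding V_def good_def by blast
    fix t assume t: "t \<in> I"
    let ?J = "fst (sel t)"
    have gt: "good t ?J (snd (sel t))" by (rule sel[OF t])
    show "par V t"
    proof (rule par_cong[of "snd (sel t)" t ?J])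
      show "par (snd (sel t)) t" "open ?J" "t \<in> ?J" using gt unfolding good_def by blast+
      fix r assume r: "r \<in> ?J"
      then have rI: "r \<in> I" using gt unfolding good_def by blast
      have gr: "good r (fst (sel r)) (snd (sel r))" by (rule sel[OF rI])
      have conn: "connected (?J \<inter> fst (sel r))"
        using gt gr unfolding good_def by (simp add: is_interval_connected_1[symmetric] is_interval_Int)
      show "V r = snd (sel t) r"
        unfolding V_def
        by (rule par_unique[of "?J \<inter> fst (sel r)" "snd (sel r)" "snd (sel t)" s0])
          (use gt gr conn r in \<open>auto simp: good_def\<close>)
    qed
  qed
qed

text \<open>The derivatives of V and Y contribute exactly the two \<open>NN\<close> terms that
  \<open>SS_g_compatible\<close> balances against the derivative of \<open>g\<close> along the
  spray.\<close>

lemma par_inner_derivative: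
  assumes "par V t" "par Y t" "c \<in> A" "t \<in> D c"
  shows "((\<lambda>s. gg c (V s c) (Y s c) (z c s)) has_vector_derivative 0) (at t)"
proof -
  interpret l: local_finsler "lr c" "chart_img c" by (rule local_finsler_chart[OF assms(3)])
  note zW = z_W[OF assms(3,4)]
  let ?z' = "(vel t c, - 2 *\<^sub>R GG c (z c t))"
  let ?V' = "- NN c (V t c) (z c t)" and ?Y' = "- NN c (Y t c) (z c t)"
  have V: "((\<lambda>s. (0 :: real ^ 'n, V s c)) has_derivative (\<lambda>h. (0, h *\<^sub>R ?V'))) (at t)"
    and Y: "((\<lambda>s. (0 :: real ^ 'n, Y s c)) has_derivative (\<lambda>h. (0, h *\<^sub>R ?Y'))) (at t)"
    using par_derivative[OF assms(1,3,4)] par_derivative[OF assms(2,3,4)] unfolding has_vector_derivative_def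
    by (auto intro: has_derivative_Pair has_derivative_const)
  have "((\<lambda>s. dd (0, V s c) (dd (0, Y s c) (lr c)) (z c s)) has_derivative
     (\<lambda>h. dd (h *\<^sub>R ?z') (dd (0, V t c) (dd (0, Y t c) (lr c))) (z c t)
        + dd (0, h *\<^sub>R ?V') (dd (0, Y t c) (lr c)) (z c t) + dd (0, V t c) (dd (0, h *\<^sub>R ?Y') (lr c)) (z c t))) (at t)"
    by (rule has_derivative_dd2_variable[where \<Phi> = "z c" and x = t, OF l.smooth_l_W zW z_derivative[OF assms(3,4), unfolded has_vector_derivative_def] V Y])
  moreover have "dd (h *\<^sub>R ?z') (dd (0, V t c) (dd (0, Y t c) (lr c))) (z c t)
        + dd (0, h *\<^sub>R ?V') (dd (0, Y t c) (lr c)) (z c t) + dd (0, V t c) (dd (0, h *\<^sub>R ?Y') (lr c)) (z c t) = 0" for h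
  proof -
    have 1: "dd (h *\<^sub>R ?z') (dd (0, V t c) (dd (0, Y t c) (lr c))) (z c t) = h *\<^sub>R l.SS (gg c (V t c) (Y t c)) (z c t)"
      unfolding linear_cmul[OF Cinf_linear_dd[OF l.smooth_dddl zW]] l.SS_def l.g_def by (simp add: z_def)
    have 2: "dd (0, h *\<^sub>R ?V') (dd (0, Y t c) (lr c)) (z c t) = - (h *\<^sub>R gg c (NN c (V t c) (z c t)) (Y t c) (z c t))"
      using linear_cmul[OF l.linear_g1[OF zW, of "Y t c"], of "- h" "NN c (V t c) (z c t)"] by (simp add: l.g_def)
    have 3: "dd (0, V t c) (dd (0, h *\<^sub>R ?Y') (lr c)) (z c t) = - (h *\<^sub>R gg c (V t c) (NN c (Y t c) (z c t)) (z c t))"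
      using linear_cmul[OF l.linear_g2[OF zW, of "V t c"], of "- h" "NN c (Y t c) (z c t)"] by (simp add: l.g_def)
    show ?thesis
      unfolding 1 2 3 using l.SS_g_compatible[OF zW, of "V t c" "Y t c"] by (simp add: algebra_simps)
  qed
  ultimately show ?thesis by (simp add: has_vector_derivative_def l.g_def)
qed

lemma inner_chart_independent:
  assumes "V \<in> tangent_space A (\<eta> t)" "Y \<in> tangent_space A (\<eta> t)" "c \<in> A" "d \<in> A" "t \<in> D c" "t \<in> D d"
  shows "gg c (V c) (Y c) (z c t) = gg d (V d) (Y d) (z d t)"
proof -
  interpret ch: finsler_change "lr c" "chart_img c" "lr d" "chart_img d" "transition c d" "overlap c d"
    by (rule finsler_change_charts[OF assms(3,4)])
  show ?thesis
    using ch.g_change[OF change_at(1)[OF assms(3-6)], of "V c" "Y c"] change_at(2)[OF assms(3-6)]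
      tangent_spaceD[OF assms(1,3,4) D_dom[OF assms(5)] D_dom[OF assms(6)]]
      tangent_spaceD[OF assms(2,3,4) D_dom[OF assms(5)] D_dom[OF assms(6)]] by (simp add: z_def)
qed

lemma par_inner_constant:
  assumes V: "\<And>t. t \<in> I \<Longrightarrow> par V t" and Y: "\<And>t. t \<in> I \<Longrightarrow> par Y t"
    and "c \<in> A" "d \<in> A" "s \<in> D c" "t \<in> D d"
  shows "gg c (V s c) (Y s c) (z c s) = gg d (V t d) (Y t d) (z d t)"
proof -
  define f where "f r = gg (chart_at A (\<eta> r)) (V r (chart_at A (\<eta> r))) (Y r (chart_at A (\<eta> r))) (z (chart_at A (\<eta> r)) r)" for r
  have f: "f r = gg c (V r c) (Y r c) (z c r)" if "c \<in> A" "r \<in> D c" for c r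
    unfolding f_def
    by (rule inner_chart_independent[OF par_tangent[OF V] par_tangent[OF Y] chart_at(1) that(1) _ that(2)])
      (use that chart_at(2) D_I in \<open>auto simp: D_def\<close>)
  have "(f has_vector_derivative 0) (at r)" if r: "r \<in> I" for r
  proof -
    obtain c where c: "c \<in> A" "r \<in> D c" using D_exists[OF r] by blast
    show ?thesis
      by (rule has_vector_derivative_transform_within_open[OF par_inner_derivative[OF V[OF r] Y[OF r] c] open_D[OF c(1)] c(2)])
        (simp add: f[OF c(1)])
  qed
  from constant_on_einterval[OF this D_I[OF assms(5)] D_I[OF assms(6)]] show ?thesis
    using f[OF assms(3,5)] f[OF assms(4,6)] by simp
qed

end

section \<open>Orthonormal frames and Jacobi fields\<close>

definition minkowski :: "'n \<Rightarrow> real ^ 'n ^ 'n" where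
  "minkowski i0 = (\<chi> i j. if i = j then if i = i0 then -1 else 1 else 0)"

lemma minkowski_mult: "(minkowski i0 *v x) $ i = (if i = i0 then - (x $ i) else x $ i)"
proof -
  have "(minkowski i0 *v x) $ i = (\<Sum>j\<in>UNIV. if j = i then (if i = i0 then - (x $ i) else x $ i) else 0)"
    unfolding matrix_vector_mult_def vec_lambda_beta by (rule sum.cong) (auto simp: minkowski_def)
  then show ?thesis by simp
qed

lemma inner_transpose: "x \<bullet> (transpose P *v y) = (P *v x) \<bullet> y" for P :: "real ^ 'n ^ 'n"
  using dot_lmul_matrix[of y P x] by (simp add: inner_commute)

lemma minkowski_involution: "minkowski i0 ** minkowski i0 = mat 1"
proof (rule matrix_eq[THEN iffD2], rule allI)
  fix x :: "real ^ 'a"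
  show "(minkowski i0 ** minkowski i0) *v x = mat 1 *v x"
    by (simp add: matrix_vector_mul_assoc[symmetric] vec_eq_iff minkowski_mult)
qed

lemma minkowski_sym: "x \<bullet> (minkowski i0 *v y) = y \<bullet> (minkowski i0 *v x)"
  by (auto simp: inner_vec_def minkowski_mult intro!: sum.cong)

text \<open>The Householder reflection in the hyperplane orthogonal to \<open>axis i0 1 - v\<close>.\<close>

lemma minkowski_transitive:
  fixes v :: "real ^ 'n"
  assumes v: "v \<bullet> (minkowski i0 *v v) = -1"
  shows "\<exists>P :: real ^ 'n ^ 'n. transpose P ** minkowski i0 ** P = minkowski i0 \<and> P *v axis i0 1 = v"
proof -
  define q where "q x y = x \<bullet> (minkowski i0 *v y)" for x y :: "real ^ 'n"
  have q_sym: "q x y = q y x" for x y unfolding q_def by (rule minkowski_sym)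
  have q_lin: "q (x - y) w = q x w - q y w" "q w (x - y) = q w x - q w y"
    "q (k *\<^sub>R x) w = k * q x w" "q w (k *\<^sub>R x) = k * q w x" for x y w k
    by (simp_all add: q_def inner_diff_left inner_diff_right matrix_vector_mult_diff_distrib
      matrix_vector_mult_scaleR)
  define e :: "real ^ 'n" where "e = axis i0 1"
  define w where "w = e - v"
  have qe: "q e x = - (x $ i0)" for x by (simp add: q_def e_def inner_axis' minkowski_mult)
  have e0: "e $ i0 = 1" by (simp add: e_def)
  have qee: "q e e = -1" by (simp add: qe e0)
  have qvv: "q v v = -1" using v by (simp add: q_def)
  have qww: "q w w = 2 * q e w" using q_sym[of v e] by (simp add: w_def q_lin qee qvv)
  show ?thesis
  proof (cases "q w w = 0")
    \<comment> \<open>There is no reflection for a null w. But then the component of v at i0 is 1,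
      and the normalisation of v leaves nothing for the other components, so v is the axis
      vector.\<close>
    case True
    then have v0: "v $ i0 = 1" using qww by (simp add: w_def q_lin qe e0)
    have "q v v = (\<Sum>i\<in>UNIV. (v $ i)\<^sup>2) - 2 * (v $ i0)\<^sup>2"
    proof -
      have "q v v = (\<Sum>i\<in>UNIV. (v $ i)\<^sup>2 - (if i = i0 then 2 * (v $ i)\<^sup>2 else 0))"
        unfolding q_def inner_vec_def by (auto simp: minkowski_mult power2_eq_square intro!: sum.cong)
      then show ?thesis by (simp add: sum_subtractf)
    qed
    moreover have "(\<Sum>i\<in>UNIV. (v $ i)\<^sup>2) = (v $ i0)\<^sup>2 + (\<Sum>i\<in>UNIV - {i0}. (v $ i)\<^sup>2)"
      by (rule sum.remove) auto
    ultimately have "(\<Sum>i\<in>UNIV - {i0}. (v $ i)\<^sup>2) = 0" using qvv v0 by simp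
    then have "\<forall>i\<in>UNIV - {i0}. (v $ i)\<^sup>2 = 0" by (subst (asm) sum_nonneg_eq_0_iff) auto
    then have "v = e" using v0 by (auto simp: vec_eq_iff e_def axis_def)
    then show ?thesis by (intro exI[of _ "mat 1"]) (simp add: e_def)
  next
    case False
    define h where "h x = x - (2 * q x w / q w w) *\<^sub>R w" for x
    have "linear h"
    proof (rule linearI)
      have add: "q (x + y) w = q x w + q y w" for x y by (simp add: q_def inner_add_left)
      show "h (x + y) = h x + h y" for x y
        by (simp add: h_def add add_divide_distrib scaleR_add_left distrib_left)
      show "h (k *\<^sub>R x) = k *\<^sub>R h x" for k x
        by (simp add: h_def q_lin scaleR_diff_right)
    qed
    then have h: "matrix h *v x = h x" for x by (simp add: matrix_works)
    have iso: "q (h x) (h y) = q x y" for x y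
    proof -
      have "q (h x) (h y) = q x y - 2 * q y w / q w w * q x w - 2 * q x w / q w w * q w y
        + (2 * q x w / q w w) * (2 * q y w / q w w) * q w w"
        by (simp add: h_def q_lin algebra_simps)
      also have "\<dots> = q x y" using False q_sym[of w y] by (simp add: field_simps)
      finally show ?thesis .
    qed
    have "x \<bullet> ((transpose (matrix h) ** minkowski i0 ** matrix h) *v y) = x \<bullet> (minkowski i0 *v y)" for x y
    proof -
      have "x \<bullet> ((transpose (matrix h) ** minkowski i0 ** matrix h) *v y)
          = x \<bullet> (transpose (matrix h) *v (minkowski i0 *v (matrix h *v y)))"
        by (simp only: matrix_vector_mul_assoc[symmetric])
      also have "\<dots> = q (h x) (h y)" by (simp only: inner_transpose h q_def)
      finally show ?thesis unfolding iso by (simp only: q_def)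
    qed
    then have "(transpose (matrix h) ** minkowski i0 ** matrix h) *v y = minkowski i0 *v y" for y
      by (intro vector_eq_ldot[THEN iffD1]) blast
    then have "transpose (matrix h) ** minkowski i0 ** matrix h = minkowski i0"
      by (rule matrix_eq[THEN iffD2, OF allI])
    \<comment> \<open>By \<open>qww\<close> the coefficient 2 q e w / q w w is 1, so e is sent to e
      - w = v.\<close>
    moreover have "matrix h *v axis i0 1 = v"
      unfolding h using False qww by (simp add: h_def e_def[symmetric] w_def)
    ultimately show ?thesis by blast
  qed
qed

text \<open>In a basis that diagonalises M, the vector v is a unit timelike vector for
  \<open>minkowski i0\<close>; a Lorentz transformation then moves the axis i0 onto it.\<close>

lemma lorentz_frame:
  fixes M :: "real ^ 'n ^ 'n"
  assumes M: "lorentz_signature M" and v: "v \<bullet> (M *v v) = -1"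
  shows "\<exists>(Q :: real ^ 'n ^ 'n) i0. transpose Q ** M ** Q = minkowski i0 \<and> Q *v axis i0 1 = v"
proof -
  obtain P :: "real ^ 'n ^ 'n" and i0 where P: "invertible P" "transpose P ** M ** P = minkowski i0"
    using M unfolding lorentz_signature_def minkowski_def by blast
  define u where "u = matrix_inv P *v v"
  have Pu: "P *v u = v" by (simp add: u_def matrix_vector_mul_assoc matrix_inv_right[OF P(1)])
  have "u \<bullet> (minkowski i0 *v u) = u \<bullet> (transpose P *v (M *v (P *v u)))"
    by (simp only: P(2)[symmetric] matrix_vector_mul_assoc[symmetric])
  also have "\<dots> = -1" by (simp only: inner_transpose Pu v)
  finally obtain \<Lambda> where L: "transpose \<Lambda> ** minkowski i0 ** \<Lambda> = minkowski i0" "\<Lambda> *v axis i0 1 = u"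
    using minkowski_transitive by blast
  have "transpose (P ** \<Lambda>) ** M ** (P ** \<Lambda>) = transpose \<Lambda> ** (transpose P ** M ** P) ** \<Lambda>"
    by (simp only: matrix_transpose_mul matrix_mul_assoc)
  then have "transpose (P ** \<Lambda>) ** M ** (P ** \<Lambda>) = minkowski i0" by (simp only: P(2) L(1))
  moreover have "(P ** \<Lambda>) *v axis i0 1 = v" by (simp add: matrix_vector_mul_assoc[symmetric] L(2) Pu)
  ultimately show ?thesis by blast
qed

lemma matrix_mult_axis: "(M :: real ^ 'n ^ 'm) *v axis j 1 = column j M"
  by (simp add: vec_eq_iff matrix_vector_mul_component inner_axis column_def)

lemma congruence_entry:
  fixes Q M :: "real ^ 'n ^ 'n"
  shows "(transpose Q ** M ** Q) $ i $ j = column i Q \<bullet> (M *v column j Q)"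
proof -
  have "(transpose Q ** M ** Q) $ i $ j = axis i 1 \<bullet> ((transpose Q ** M ** Q) *v axis j 1)"
    by (simp add: inner_axis' matrix_mult_axis column_def)
  also have "\<dots> = axis i 1 \<bullet> (transpose Q *v (M *v (Q *v axis j 1)))"
    by (simp only: matrix_vector_mul_assoc[symmetric])
  finally show ?thesis by (simp only: inner_transpose matrix_mult_axis)
qed

section \<open>A parallel orthonormal frame and the curvature matrix\<close>

context geodesic
begin

lemma lr_z: "c \<in> A \<Longrightarrow> t \<in> D c \<Longrightarrow> lr c (z c t) = - (1 / 2)"
  unfolding z_def using local_rep_chart[OF velocity_tangent[OF D_I] _ D_dom, of t c c L] L_velocity[OF D_I, of t c] by simp

text \<open>A frame at one parameter is transported parallelly. Inner products of parallel fields
  are constant, so it stays orthonormal, and the velocity is itself parallel, so it stays the member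
  i0 of the frame by uniqueness.\<close>

lemma frame_exists:
  "\<exists>(E :: 'n \<Rightarrow> real \<Rightarrow> ('m, 'n) tvec) i0. (\<forall>t\<in>I. \<forall>j. par (E j) t) \<and> (\<forall>t\<in>I. E i0 t = vel t) \<and>
    (\<forall>c\<in>A. \<forall>t\<in>D c. \<forall>i j. gg c (E i t c) (E j t c) (z c t) = minkowski i0 $ i $ j)"
proof -
  have "a < b" using causal_geodesic unfolding causal_geodesic_def by blast
  then obtain t0 where t0: "t0 \<in> I" using einterval_nonempty by blast
  obtain c where c: "c \<in> A" "t0 \<in> D c" using D_exists[OF t0] by blast
  interpret l: local_finsler "lr c" "chart_img c" by (rule local_finsler_chart[OF c(1)])
  have zW: "z c t0 \<in> l.W" by (rule z_W[OF c])
  have sig: "lorentz_signature (g_mat (lr c) (z c t0))"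
    by (rule lorentz_signature_chart[OF c(1)]) (use zW in \<open>simp add: l.W_def\<close>)
  have "snd (z c t0) \<bullet> (g_mat (lr c) (z c t0) *v snd (z c t0)) = -1"
    unfolding l.inner_g_mat[OF zW] l.g_radial_radial[OF zW] lr_z[OF c] by simp
  then obtain Q :: "real ^ 'n ^ 'n" and i0 where Q: "transpose Q ** g_mat (lr c) (z c t0) ** Q = minkowski i0" "Q *v axis i0 1 = snd (z c t0)"
    using lorentz_frame[OF sig] by blast
  have "\<exists>V. V t0 = tangent_vec A c (\<eta> t0) (column j Q) \<and> (\<forall>t\<in>I. par V t)" for j
    using par_exists[OF t0 tangent_vec_in[OF c(1) D_dom[OF c(2)]]] by blast
  then have "\<forall>j. \<exists>V. V t0 = tangent_vec A c (\<eta> t0) (column j Q) \<and> (\<forall>t\<in>I. par V t)" by blast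
  from choice[OF this] obtain E where
    E: "\<forall>j. E j t0 = tangent_vec A c (\<eta> t0) (column j Q) \<and> (\<forall>t\<in>I. par (E j) t)" by blast
  have parE: "par (E j) t" if "t \<in> I" for j t using E that by blast
  have Ec: "E j t0 c = column j Q" for j using E tangent_vec_self[OF c(1) D_dom[OF c(2)]] by simp
  have 1: "E i0 t = vel t" if t: "t \<in> I" for t
  proof (rule par_unique[of I _ _ t0])
    show "connected I"
      by (auto simp: is_interval_connected_1[symmetric] is_interval_1 intro: einterval_mono)
    have "E i0 t0 c = vel t0 c" unfolding Ec matrix_mult_axis[symmetric] Q(2) by (simp add: z_def)
    then show "E i0 t0 = vel t0"
      by (rule tangent_eqI[OF par_tangent[OF parE[OF t0]] velocity_tangent[OF t0] c(1) D_dom[OF c(2)]])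
  qed (use t t0 parE par_velocity in auto)
  have 2: "gg d (E i t d) (E j t d) (z d t) = minkowski i0 $ i $ j" if d: "d \<in> A" "t \<in> D d" for d t i j
  proof -
    have "gg d (E i t d) (E j t d) (z d t) = gg c (E i t0 c) (E j t0 c) (z c t0)"
      by (rule par_inner_constant[OF parE parE d(1) c(1) d(2) c(2)])
    also have "\<dots> = column i Q \<bullet> (g_mat (lr c) (z c t0) *v column j Q)"
      unfolding Ec l.inner_g_mat[OF zW] ..
    finally show ?thesis unfolding congruence_entry[symmetric] Q(1) .
  qed
  show ?thesis
    by (rule exI[of _ E], rule exI[of _ i0], intro conjI ballI allI) (simp_all only: parE 1 2)
qed

lemma R_op_chart:
  assumes "w \<in> tangent_space A (\<eta> t)" "c \<in> A" "t \<in> D c"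
  shows "R_op A L (\<eta> t) (vel t) w \<in> tangent_space A (\<eta> t)"
    and "R_op A L (\<eta> t) (vel t) w c = RR c (w c) (z c t)"
proof -
  define d where "d = chart_at A (\<eta> t)"
  have d: "d \<in> A" "t \<in> D d" using chart_at[of "\<eta> t"] D_I[OF assms(3)] by (simp_all add: d_def D_def)
  interpret l: local_finsler "lr d" "chart_img d" by (rule local_finsler_chart[OF d(1)])
  interpret ch: finsler_change "lr d" "chart_img d" "lr c" "chart_img c" "transition d c" "overlap d c"
    by (rule finsler_change_charts[OF d(1) assms(2)])
  have R: "R_op A L (\<eta> t) (vel t) w = tangent_vec A d (\<eta> t) (RR d (w d) (z d t))"
    by (simp add: R_op_def d_def[symmetric] Let_def l.R_mat_eq[OF z_W[OF d], unfolded z_def] z_def)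
  show "R_op A L (\<eta> t) (vel t) w \<in> tangent_space A (\<eta> t)"
    unfolding R by (rule tangent_vec_in[OF d(1) D_dom[OF d(2)]])
  show "R_op A L (\<eta> t) (vel t) w c = RR c (w c) (z c t)"
    using ch.RR_change[OF change_at(1)[OF d(1) assms(2) d(2) assms(3)], of "w d"]
      change_at(2)[OF d(1) assms(2) d(2) assms(3)] tangent_spaceD[OF assms(1) d(1) assms(2) D_dom[OF d(2)] D_dom[OF assms(3)]]
      assms(2) D_dom[OF assms(3)]
    by (simp add: R tangent_vec_apply z_def)
qed

end

locale framed_geodesic = geodesic A L a b \<eta>
  for A :: "('m::{t2_space, second_countable_topology}, 'n::finite) chart set" and L and a b and \<eta> +
  fixes E :: "'n \<Rightarrow> real \<Rightarrow> ('m, 'n) tvec" and i0 :: 'n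
  assumes par_E: "\<And>t j. t \<in> I \<Longrightarrow> par (E j) t"
    and E_velocity: "\<And>t. t \<in> I \<Longrightarrow> E i0 t = vel t"
    and orthonormal: "\<And>c t i j. c \<in> A \<Longrightarrow> t \<in> D c \<Longrightarrow> gg c (E i t c) (E j t c) (z c t) = minkowski i0 $ i $ j"
begin

definition Q where "Q c t = (\<chi> \<alpha> j. E j t c $ \<alpha>)"

abbreviation M where "M c t \<equiv> g_mat (lr c) (z c t)"
abbreviation Rm where "Rm c t \<equiv> R_mat (lr c) (z c t)"

text \<open>The matrix of g (E i) (R (E j)): lowering the index makes the symmetry of the curvature
  visible. The matrix of R in the frame itself is \<open>minkowski i0 ** Rf t\<close>, and
  \<open>minkowski_Rf\<close> shows that the two coincide because row i0 vanishes.\<close>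

definition Rf where "Rf t = (let c = chart_at A (\<eta> t) in transpose (Q c t) ** M c t ** (Rm c t ** Q c t))"

lemma column_Q: "column j (Q c t) = E j t c"
  by (simp add: column_def Q_def vec_eq_iff)

lemma Q_mult: "Q c t *v y = (\<Sum>j\<in>UNIV. y $ j *\<^sub>R E j t c)"
  by (simp add: vec_eq_iff matrix_vector_mult_def Q_def mult.commute)

text \<open>Orthonormality says that Q is a congruence from g to the Minkowski matrix, which is its
  own inverse; this gives the inverse of Q without a further choice.\<close>

lemma Q_inverse:
  assumes "c \<in> A" "t \<in> D c"
  shows "minkowski i0 ** transpose (Q c t) ** M c t ** Q c t = mat 1"
    and "Q c t ** (minkowski i0 ** transpose (Q c t) ** M c t) = mat 1"
proof -
  interpret l: local_finsler "lr c" "chart_img c" by (rule local_finsler_chart[OF assms(1)])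
  have "transpose (Q c t) ** M c t ** Q c t = minkowski i0"
    by (simp add: vec_eq_iff congruence_entry column_Q l.inner_g_mat[OF z_W[OF assms]] orthonormal[OF assms])
  then have "minkowski i0 ** (transpose (Q c t) ** M c t ** Q c t) = mat 1" by (simp only: minkowski_involution)
  then show "minkowski i0 ** transpose (Q c t) ** M c t ** Q c t = mat 1" by (simp only: matrix_mul_assoc)
  then show "Q c t ** (minkowski i0 ** transpose (Q c t) ** M c t) = mat 1"
    by (rule matrix_left_right_inverse[THEN iffD1])
qed

lemma frame_curvature_entry:
  assumes "c \<in> A" "t \<in> D c"
  shows "(transpose (Q c t) ** M c t ** (Rm c t ** Q c t)) $ i $ j = gg c (E i t c) (RR c (E j t c) (z c t)) (z c t)"
proof -
  interpret l: local_finsler "lr c" "chart_img c" by (rule local_finsler_chart[OF assms(1)])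
  have "(transpose (Q c t) ** M c t ** (Rm c t ** Q c t)) $ i $ j = (transpose (Q c t) ** (M c t ** Rm c t) ** Q c t) $ i $ j"
    by (simp only: matrix_mul_assoc)
  also have "\<dots> = E i t c \<bullet> (M c t *v (Rm c t *v E j t c))"
    unfolding congruence_entry column_Q by (simp only: matrix_vector_mul_assoc)
  finally show ?thesis
    unfolding l.R_mat_eq[OF z_W[OF assms]] l.inner_g_mat[OF z_W[OF assms]] .
qed

lemma Rf_chart:
  assumes "c \<in> A" "t \<in> D c"
  shows "Rf t = transpose (Q c t) ** M c t ** (Rm c t ** Q c t)"
proof -
  define d where "d = chart_at A (\<eta> t)"
  have d: "d \<in> A" "t \<in> D d" using chart_at[of "\<eta> t"] D_I[OF assms(2)] by (simp_all add: d_def D_def)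
  note T = par_tangent[OF par_E[OF D_I[OF assms(2)]]]
  have "gg d (E i t d) (RR d (E j t d) (z d t)) (z d t) = gg c (E i t c) (RR c (E j t c) (z c t)) (z c t)" for i j
    using inner_chart_independent[OF T[of i] R_op_chart(1)[OF T[of j] d] d(1) assms(1) d(2) assms(2)]
    unfolding R_op_chart(2)[OF T[of j] d] R_op_chart(2)[OF T[of j] assms] .
  then show ?thesis
    unfolding Rf_def d_def[symmetric] Let_def
    by (simp only: vec_eq_iff frame_curvature_entry[OF d] frame_curvature_entry[OF assms] simp_thms)
qed

lemma Rf_entry:
  assumes "c \<in> A" "t \<in> D c"
  shows "Rf t $ i $ j = gg c (E i t c) (RR c (E j t c) (z c t)) (z c t)"
  unfolding Rf_chart[OF assms] by (rule frame_curvature_entry[OF assms])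

lemma Rf_sym: "t \<in> I \<Longrightarrow> transpose (Rf t) = Rf t"
proof -
  assume "t \<in> I"
  then obtain c where c: "c \<in> A" "t \<in> D c" using D_exists by blast
  interpret l: local_finsler "lr c" "chart_img c" by (rule local_finsler_chart[OF c(1)])
  note zW = z_W[OF c]
  have "Rf t $ j $ i = Rf t $ i $ j" for i j
    unfolding Rf_entry[OF c] l.RR_symmetric[OF zW, of "E j t c"] by (rule l.g_sym[OF zW])
  then show ?thesis by (simp add: vec_eq_iff transpose_def)
qed

lemma Rf_column:
  assumes "t \<in> I" shows "Rf t $ i $ i0 = 0"
proof -
  obtain c where c: "c \<in> A" "t \<in> D c" using D_exists[OF assms] by blast
  interpret l: local_finsler "lr c" "chart_img c" by (rule local_finsler_chart[OF c(1)])
  have "E i0 t c = snd (z c t)" by (simp add: E_velocity[OF assms] z_def)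
  then show ?thesis
    unfolding Rf_entry[OF c] using l.RR_radial[OF z_W[OF c]] linear_0[OF l.linear_g2[OF z_W[OF c]]] by simp
qed

lemma Rf_axis: "t \<in> I \<Longrightarrow> Rf t *v axis i0 1 = 0"
  by (simp add: matrix_mult_axis column_def vec_eq_iff Rf_column)

lemma minkowski_Rf: "t \<in> I \<Longrightarrow> minkowski i0 ** Rf t = Rf t"
proof -
  assume t: "t \<in> I"
  have row: "Rf t $ i0 $ j = 0" for j
  proof -
    have "Rf t $ i0 $ j = transpose (Rf t) $ j $ i0" by (simp add: transpose_def)
    then show ?thesis unfolding Rf_sym[OF t] using Rf_column[OF t] by simp
  qed
  have "(minkowski i0 ** Rf t) $ i $ j = (minkowski i0 *v column j (Rf t)) $ i" for i j
    by (simp add: matrix_matrix_mult_def matrix_vector_mult_def column_def)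
  then show ?thesis by (simp add: vec_eq_iff minkowski_mult column_def row)
qed

lemma Q_Rf:
  assumes "c \<in> A" "t \<in> D c"
  shows "Q c t ** Rf t = Rm c t ** Q c t"
proof -
  have "Q c t ** Rf t = Q c t ** (minkowski i0 ** (transpose (Q c t) ** M c t ** (Rm c t ** Q c t)))"
    using minkowski_Rf[OF D_I[OF assms(2)]] unfolding Rf_chart[OF assms] by simp
  also have "\<dots> = (Q c t ** (minkowski i0 ** transpose (Q c t) ** M c t)) ** (Rm c t ** Q c t)"
    by (simp only: matrix_mul_assoc)
  finally show ?thesis by (simp only: Q_inverse(2)[OF assms] matrix_mul_lid)
qed

text \<open>By \<open>Q_Rf\<close> the matrices \<open>Rf t\<close> and \<open>Rm c t\<close> are
  similar.\<close>

lemma trace_Rf: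
  assumes "t \<in> I" shows "trace (Rf t) = Ric A L (\<eta> t) (vel t)"
proof -
  define c where "c = chart_at A (\<eta> t)"
  have c: "c \<in> A" "t \<in> D c" using chart_at[of "\<eta> t"] assms by (simp_all add: c_def D_def)
  define Qi where "Qi = minkowski i0 ** transpose (Q c t) ** M c t"
  have "Qi ** (Q c t ** Rf t) = Rf t"
    by (simp only: matrix_mul_assoc Qi_def Q_inverse(1)[OF c] matrix_mul_lid)
  then have "trace (Rf t) = trace (Qi ** (Rm c t ** Q c t))" by (simp only: Q_Rf[OF c])
  also have "\<dots> = trace ((Rm c t ** Q c t) ** Qi)" by (rule trace_mul_sym)
  also have "\<dots> = trace (Rm c t ** (Q c t ** Qi))" by (simp only: matrix_mul_assoc)
  also have "\<dots> = trace (Rm c t)" by (simp only: Qi_def Q_inverse(2)[OF c] matrix_mul_rid)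
  finally show ?thesis by (simp only: Ric_def c_def[symmetric] Let_def z_def)
qed

lemma continuous_Rf: "continuous_on I Rf"
  unfolding continuous_on_eq_continuous_at[OF open_einterval]
proof
  fix t assume t: "t \<in> I"
  then obtain c where c: "c \<in> A" "t \<in> D c" using D_exists by blast
  interpret l: local_finsler "lr c" "chart_img c" by (rule local_finsler_chart[OF c(1)])
  have "Cinf l.W (\<lambda>z. (0 :: real ^ 'n, l.NN w z))" for w
    by (rule Cinf_bounded_linear[OF _ l.smooth_NN, where h = "\<lambda>w. (0 :: real ^ 'n, w)"]) (intro bounded_linear_intros)
  from Cinf_dd_variable[OF l.smooth_G this] have "Cinf l.W (\<lambda>z. l.NN (l.NN w z) z)" for w
    by (simp add: l.NN_def[of "l.NN w _"])
  then have smooth_RR: "Cinf l.W (l.RR w)" for w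
    unfolding l.RR_def[abs_def]
    by (intro Cinf_diff Cinf_scaleR Cinf_const l.open_W Cinf_dd l.smooth_G l.smooth_SS[OF _ order_refl] l.smooth_NN)
  have entries: "continuous_on (D c) F" if "\<And>i j. continuous_on (D c) (\<lambda>t. F t $ i $ j)"
    for F :: "real \<Rightarrow> real ^ 'n ^ 'n"
  proof -
    have "continuous_on (D c) (\<lambda>t. \<chi> i. \<chi> j. F t $ i $ j)" by (intro continuous_on_vec_lambda that)
    then show ?thesis by simp
  qed
  have R_entry: "R_mat (lr c) z $ i $ j = l.RR (axis j 1) z $ i" if "z \<in> l.W" for z i j
    unfolding l.R_mat_eq[OF that, symmetric] by (simp add: matrix_mult_axis column_def)
  have cR: "continuous_on (D c) (\<lambda>t. Rm c t)"
  proof (rule entries)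
    fix i j
    have "continuous_on (D c) (\<lambda>t. l.RR (axis j 1) (z c t) $ i)"
      by (rule continuous_along[OF c(1) Cinf_vec_nth[OF smooth_RR]])
    then show "continuous_on (D c) (\<lambda>t. Rm c t $ i $ j)"
      by (rule continuous_on_eq) (simp add: R_entry z_W[OF c(1)])
  qed
  have cM: "continuous_on (D c) (\<lambda>t. M c t)"
    by (rule entries) (simp only: l.g_mat_entry continuous_along[OF c(1) l.smooth_g])
  have cE: "continuous_on (D c) (\<lambda>t. E j t c)" for j
    using has_vector_derivative_continuous[OF par_derivative[OF par_E[OF D_I] c(1)]]
    by (intro continuous_at_imp_continuous_on) blast
  have cQ: "continuous_on (D c) (Q c)"
    by (rule entries) (simp add: Q_def, intro continuous_intros cE)
  have cQT: "continuous_on (D c) (\<lambda>t. transpose (Q c t))"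
    by (rule bounded_linear.continuous_on[OF bounded_linear_transpose cQ])
  have "continuous_on (D c) (\<lambda>t. transpose (Q c t) ** M c t ** (Rm c t ** Q c t))"
    by (intro bounded_bilinear.continuous_on[OF bounded_bilinear_matrix_mult] cQ cQT cR cM)
  then have "continuous_on (D c) Rf"
    by (rule continuous_on_eq) (simp add: Rf_chart[OF c(1)])
  then show "isCont Rf t" using c(2) continuous_on_eq_continuous_at[OF open_D[OF c(1)]] by blast
qed

section \<open>Vector fields with given components in the frame\<close>

definition combination where "combination y t = (\<lambda>c. \<Sum>j\<in>UNIV. y t $ j *\<^sub>R E j t c)"

lemma combination_Q: "combination y t c = Q c t *v y t"
  by (simp add: combination_def Q_mult)

lemma combination_tangent: "t \<in> I \<Longrightarrow> combination y t \<in> tangent_space A (\<eta> t)"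
  unfolding combination_def
  by (intro tangent_space_sum tangent_space_scaleR par_tangent par_E)

text \<open>Differentiating the parallel frame members produces the connection term of the
  combination, so the covariant derivative acts on the components as the ordinary
  derivative.\<close>

lemma combination_covariant_derivative:
  assumes t: "t \<in> I" and y: "(y has_vector_derivative y1 t) (at t)"
  shows "has_covariant_derivative A L \<eta> (combination y) (combination y1 t) t"
  unfolding has_covariant_derivative_def
proof (intro conjI ballI impI combination_tangent[OF t])
  fix c assume c': "c \<in> A" "\<eta> t \<in> dom_chart c"
  then have c: "c \<in> A" "t \<in> D c" using t by (simp_all add: D_def)
  interpret l: local_finsler "lr c" "chart_img c" by (rule local_finsler_chart[OF c(1)])
  have "((\<lambda>s. combination y s c) has_vector_derivative
      (\<Sum>j\<in>UNIV. y t $ j *\<^sub>R - NN c (E j t c) (z c t) + y1 t $ j *\<^sub>R E j t c)) (at t)"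
    unfolding combination_def
    by (intro has_vector_derivative_sum has_vector_derivative_scaleR par_derivative[OF par_E[OF t] c]
      has_vector_derivative_vec_nth[OF y, folded has_real_derivative_iff_has_vector_derivative])
  moreover have "(\<Sum>j\<in>UNIV. y t $ j *\<^sub>R - NN c (E j t c) (z c t) + y1 t $ j *\<^sub>R E j t c)
    = combination y1 t c - NN c (combination y t c) (z c t)"
    by (simp add: combination_def sum.distrib linear_sum[OF l.linear_NN[OF z_W[OF c]]]
      linear_cmul[OF l.linear_NN[OF z_W[OF c]]] sum_subtractf)
  moreover have "NN c (combination y t c) (z c t) = (\<chi> \<alpha>. \<Sum>\<beta>\<in>UNIV. \<Sum>\<gamma>\<in>UNIV.
      Gamma (lr c) \<alpha> \<beta> \<gamma> (chart_map c (\<eta> t), vel t c) * (vel t c $ \<beta>) * (combination y t c $ \<gamma>))"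
    using l.Gamma_contraction[OF z_W[OF c], of _ "combination y t c"] by (simp add: vec_eq_iff z_def)
  ultimately show "((\<lambda>s. combination y s c) has_vector_derivative combination y1 t c - (\<chi> \<alpha>. \<Sum>\<beta>\<in>UNIV. \<Sum>\<gamma>\<in>UNIV.
      Gamma (lr c) \<alpha> \<beta> \<gamma> (chart_map c (\<eta> t), vel t c) * (vel t c $ \<beta>) * (combination y t c $ \<gamma>))) (at t)"
    by simp
qed

lemma combination_curvature:
  assumes t: "t \<in> I"
  shows "combination (\<lambda>t. - (Rf t *v y t)) t = (\<lambda>c. - R_op A L (\<eta> t) (vel t) (combination y t) c)"
proof -
  obtain c where c: "c \<in> A" "t \<in> D c" using D_exists[OF t] by blast
  interpret l: local_finsler "lr c" "chart_img c" by (rule local_finsler_chart[OF c(1)])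
  note R = R_op_chart[OF combination_tangent[OF t] c, of y]
  have "(\<lambda>c. (- 1) *\<^sub>R R_op A L (\<eta> t) (vel t) (combination y t) c) \<in> tangent_space A (\<eta> t)"
    by (rule tangent_space_scaleR[OF R(1)])
  then have T: "(\<lambda>c. - R_op A L (\<eta> t) (vel t) (combination y t) c) \<in> tangent_space A (\<eta> t)" by simp
  have "Q c t *v (Rf t *v y t) = Rm c t *v (Q c t *v y t)"
    by (simp only: matrix_vector_mul_assoc Q_Rf[OF c])
  then have "combination (\<lambda>t. - (Rf t *v y t)) t c = - R_op A L (\<eta> t) (vel t) (combination y t) c"
    unfolding R(2) l.R_mat_eq[OF z_W[OF c], symmetric]
    by (simp add: combination_Q bounded_bilinear.minus_right[OF bounded_bilinear_matrix_vector_mult])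
  then show ?thesis
    by (rule tangent_eqI[OF combination_tangent[OF t] T c(1) D_dom[OF c(2)]])
qed

lemma jacobi_field_combination:
  assumes "\<And>t. t \<in> I \<Longrightarrow> (y has_vector_derivative y1 t) (at t)"
    and "\<And>t. t \<in> I \<Longrightarrow> (y1 has_vector_derivative - (Rf t *v y t)) (at t)"
  shows "jacobi_field A L a b \<eta> (combination y)"
  unfolding jacobi_field_def
proof (intro conjI ballI exI[of _ "combination y1"] combination_tangent)
  fix t assume t: "t \<in> I"
  show "has_covariant_derivative A L \<eta> (combination y) (combination y1 t) t"
    by (rule combination_covariant_derivative[OF t]) (rule assms(1)[OF t])
  show "has_covariant_derivative A L \<eta> (combination y1) (\<lambda>c. - R_op A L (\<eta> t) (vel t) (combination y t) c) t"
    unfolding combination_curvature[OF t, symmetric]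
    by (rule combination_covariant_derivative[OF t]) (rule assms(2)[OF t])
qed

lemma combination_zero_iff:
  assumes "t \<in> I"
  shows "combination y t = (\<lambda>_. 0) \<longleftrightarrow> y t = 0"
proof
  assume 0: "combination y t = (\<lambda>_. 0)"
  obtain c where c: "c \<in> A" "t \<in> D c" using D_exists[OF assms] by blast
  have "Q c t *v y t = 0" using fun_cong[OF 0, of c] by (simp add: combination_Q)
  then have "(minkowski i0 ** transpose (Q c t) ** M c t) *v (Q c t *v y t) = 0" by simp
  then show "y t = 0"
    by (simp only: matrix_vector_mul_assoc Q_inverse(1)[OF c] matrix_vector_mul_lid)
qed (simp add: combination_def)

lemma no_conjugate_points:
  assumes nc: "\<not> has_conjugate_points A L a b \<eta>"
    and y: "\<And>t. t \<in> I \<Longrightarrow> (y has_vector_derivative y1 t) (at t)"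
      "\<And>t. t \<in> I \<Longrightarrow> (y1 has_vector_derivative - (Rf t *v y t)) (at t)"
    and "s \<in> I" "y s = 0" "t \<in> I" "s < t" "y t = 0"
  shows "\<forall>r\<in>I. y r = 0"
proof (rule ccontr)
  assume "\<not> ?thesis"
  then obtain r where "r \<in> I" "combination y r \<noteq> (\<lambda>_. 0)" using combination_zero_iff by blast
  then have "has_conjugate_points A L a b \<eta>"
    unfolding has_conjugate_points_def
    using jacobi_field_combination[OF y] assms(4-8) combination_zero_iff[of s y] combination_zero_iff[of t y] by blast
  with nc show False by blast
qed

lemma R_op_eq_0:
  assumes "t \<in> I" "Rf t = 0" "w \<in> tangent_space A (\<eta> t)"
  shows "R_op A L (\<eta> t) (vel t) w = (\<lambda>_. 0)"
proof -
  obtain c where c: "c \<in> A" "t \<in> D c" using D_exists[OF assms(1)] by blast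
  interpret l: local_finsler "lr c" "chart_img c" by (rule local_finsler_chart[OF c(1)])
  have "Rm c t ** Q c t = 0" using Q_Rf[OF c] assms(2) by simp
  then have "Rm c t ** (Q c t ** (minkowski i0 ** transpose (Q c t) ** M c t)) = 0"
    by (simp add: matrix_mul_assoc)
  then have "Rm c t = 0" by (simp only: Q_inverse(2)[OF c] matrix_mul_rid)
  then have "RR c (w c) (z c t) = 0" unfolding l.R_mat_eq[OF z_W[OF c], symmetric] by simp
  then show ?thesis
    using R_op_chart[OF assms(3) c] by (intro tangent_eqI[OF _ tangent_space_zero c(1) D_dom[OF c(2)]]) simp_all
qed

lemma jacobi_system: "jacobi_system a b Rf i0"
  by (rule jacobi_system.intro) (simp_all add: continuous_Rf Rf_sym Rf_axis)

end

section \<open>The weight and the weighted Ricci curvature along a geodesic\<close>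

lemma dd_translate:
  assumes "f differentiable (at (x + t))"
  shows "dd p (\<lambda>s. f (s + t)) x = dd p f (x + t)"
    and "(\<lambda>s. f (s + t)) differentiable (at x)"
proof -
  have "((\<lambda>s. s + t) has_derivative (\<lambda>h. h)) (at x)" by (auto intro!: derivative_eq_intros)
  from has_derivative_compose[OF this has_derivative_dd[OF assms]]
  have D: "((\<lambda>s. f (s + t)) has_derivative (\<lambda>p. dd p f (x + t))) (at x)" .
  show "dd p (\<lambda>s. f (s + t)) x = dd p f (x + t)" by (rule dd_eqI[OF D])
  show "(\<lambda>s. f (s + t)) differentiable (at x)" using D unfolding differentiable_def by blast
qed

lemma open_translate: "open S \<Longrightarrow> open {s. s + t \<in> S}" for S :: "'a::real_normed_vector set"
  using open_vimage[of S "\<lambda>s. s + t"] by (simp add: vimage_def continuous_intros)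

lemma Ck_on_translate:
  assumes "open S" "Ck_on k S f" shows "Ck_on k {s. s + t \<in> S} (\<lambda>s. f (s + t))"
  using assms(2)
proof (induction k arbitrary: f)
  case 0
  then show ?case by (auto intro!: continuous_intros continuous_on_compose2[of S f _ "\<lambda>s. s + t"])
next
  case (Suc k)
  have d: "f differentiable (at (s + t))" if "s + t \<in> S" for s using Suc.prems that by simp
  have "Ck_on k {s. s + t \<in> S} (dd i (\<lambda>s. f (s + t)))" if i: "i \<in> Basis" for i
  proof (rule Ck_on_cong[OF open_translate[OF assms(1)]])
    show "Ck_on k {s. s + t \<in> S} (\<lambda>s. dd i f (s + t))"
      by (rule Suc.IH) (use Suc.prems i in \<open>simp add: Ck_on_Suc_dd del: Ck_on.simps\<close>)
    show "dd i f (y + t) = dd i (\<lambda>s. f (s + t)) y" if "y \<in> {s. s + t \<in> S}" for y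
      using dd_translate(1)[OF d[of y]] that by simp
  qed
  moreover have "(\<lambda>s. f (s + t)) differentiable (at x)" if "x \<in> {s. s + t \<in> S}" for x
    using dd_translate(2)[OF d[of x]] that by simp
  ultimately show ?case by (simp add: Ck_on_Suc_dd del: Ck_on.simps)
qed

lemma smooth_on_translate:
  assumes "smooth_on S f" "T \<subseteq> {s. s + t \<in> S}" shows "smooth_on T (\<lambda>s. f (s + t))"
  unfolding smooth_on_def
proof
  fix x assume "x \<in> T"
  then have "x + t \<in> S" using assms(2) by blast
  then obtain W g where W: "open W" "x + t \<in> W" "\<forall>k. Ck_on k W g" "\<forall>y\<in>S \<inter> W. f y = g y"
    using assms(1) unfolding smooth_on_def by meson
  have "open {s. s + t \<in> W}" by (rule open_translate[OF W(1)])
  moreover have "\<forall>k. Ck_on k {s. s + t \<in> W} (\<lambda>s. g (s + t))" using Ck_on_translate[OF W(1)] W(3) by blast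
  moreover have "\<forall>y\<in>T \<inter> {s. s + t \<in> W}. f (y + t) = g (y + t)" using W(4) assms(2) by blast
  ultimately show "\<exists>W g. open W \<and> x \<in> W \<and> (\<forall>k. Ck_on k W g) \<and> (\<forall>y\<in>T \<inter> W. f (y + t) = g y)"
    using W(2) by (intro exI[of _ "{s. s + t \<in> W}"] exI[of _ "\<lambda>s. g (s + t)"]) simp
qed

lemma has_vector_derivative_translate:
  assumes "(f has_vector_derivative f') (at (s + t))"
  shows "((\<lambda>r. f (r + t)) has_vector_derivative f') (at s)"
proof -
  have "((\<lambda>r. r + t) has_derivative (\<lambda>h. h)) (at s)" by (auto intro!: derivative_eq_intros)
  from has_derivative_compose[OF this assms[unfolded has_vector_derivative_def]]
  show ?thesis by (simp add: has_vector_derivative_def)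
qed

context causal_curve
begin

lemma causal_geodesic_translate:
  assumes e: "e > 0" "{t - e<..<t + e} \<subseteq> I"
  shows "causal_geodesic A L (ereal (- e)) (ereal e) (\<lambda>s. \<eta> (s + t))"
    and "s \<in> {- e<..<e} \<Longrightarrow> velocity A (\<lambda>s. \<eta> (s + t)) s = vel (s + t)"
proof -
  have I: "s + t \<in> I" if "s \<in> {- e<..<e}" for s using e that by auto
  show v: "velocity A (\<lambda>s. \<eta> (s + t)) s = vel (s + t)" if s: "s \<in> {- e<..<e}" for s
  proof
    fix c
    show "velocity A (\<lambda>s. \<eta> (s + t)) s c = vel (s + t) c"
    proof (cases "c \<in> A \<and> \<eta> (s + t) \<in> dom_chart c")
      case True
      then have c: "c \<in> A" "s + t \<in> D c" using I[OF s] by (simp_all add: D_def)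
      have "((\<lambda>r. chart_map c (\<eta> (r + t))) has_vector_derivative vel (s + t) c) (at s)"
        by (rule has_vector_derivative_translate[OF position_derivative[OF c]])
      from vector_derivative_at[OF this] show ?thesis using True by (simp add: velocity_def)
    next
      case False
      show ?thesis unfolding velocity_def if_not_P[OF False] ..
    qed
  qed
  show "causal_geodesic A L (ereal (- e)) (ereal e) (\<lambda>s. \<eta> (s + t))"
    unfolding causal_geodesic_def smooth_curve_def einterval_eq
  proof (intro conjI ballI impI)
    show "ereal (- e) < ereal e" using e by simp
    show "continuous_on {- e<..<e} (\<lambda>s. \<eta> (s + t))"
      by (rule continuous_on_compose2[OF continuous_eta]) (use I in \<open>auto intro!: continuous_intros\<close>)
    fix c assume c: "c \<in> A"
    have "smooth_on (D c) (\<lambda>t. chart_map c (\<eta> t))"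
      using causal_geodesic c unfolding causal_geodesic_def smooth_curve_def D_def by blast
    then show "smooth_on {s \<in> {- e<..<e}. \<eta> (s + t) \<in> dom_chart c} (\<lambda>s. chart_map c (\<eta> (s + t)))"
      by (rule smooth_on_translate) (use I in \<open>auto simp: D_def\<close>)
  next
    fix s assume s: "s \<in> {- e<..<e}"
    show "causal L (\<eta> (s + t)) (velocity A (\<lambda>s. \<eta> (s + t)) s)"
      unfolding v[OF s] using causal_geodesic I[OF s] unfolding causal_geodesic_def by blast
    fix c assume c': "c \<in> A" "\<eta> (s + t) \<in> dom_chart c"
    then have c: "c \<in> A" "s + t \<in> D c" using I[OF s] by (simp_all add: D_def)
    have "((\<lambda>r. vel (r + t) c) has_vector_derivative - 2 *\<^sub>R GG c (z c (s + t))) (at s)"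
      by (rule has_vector_derivative_translate[OF velocity_derivative[OF c]])
    then have "((\<lambda>r. velocity A (\<lambda>s. \<eta> (s + t)) r c) has_vector_derivative - 2 *\<^sub>R GG c (z c (s + t))) (at s)"
      by (rule has_vector_derivative_transform_within_open[OF _ open_greaterThanLessThan s]) (simp add: v)
    then show "((\<lambda>r. velocity A (\<lambda>s. \<eta> (s + t)) r c) has_vector_derivative
         - 2 *\<^sub>R spray (lr c) (chart_map c (\<eta> (s + t)), velocity A (\<lambda>s. \<eta> (s + t)) s c)) (at s)"
      unfolding v[OF s] local_finsler.G_def[OF local_finsler_chart[OF c(1)]] z_def .
  qed
qed

lemma z_derivative_spray:
  "c \<in> A \<Longrightarrow> t \<in> D c \<Longrightarrow> (z c has_vector_derivative (snd (z c t), - 2 *\<^sub>R GG c (z c t))) (at t)"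
  using z_derivative[of c t] by (simp add: z_def)

end

text \<open>In a chart both lifts solve the autonomous spray equation with the same initial value. A
  nonzero velocity places that value in \<open>l.W\<close>, away from the zero section, where the
  spray is smooth.\<close>

lemma (in spacetime) causal_geodesic_unique:
  assumes g1: "causal_geodesic A L a b \<eta>" and g2: "causal_geodesic A L a' b' \<gamma>"
    and t: "t \<in> einterval a b" "t \<in> einterval a' b'"
    and eq: "\<eta> t = \<gamma> t" "velocity A \<eta> t = velocity A \<gamma> t"
    and nonzero: "velocity A \<eta> t \<noteq> (\<lambda>_. 0)"
  shows "\<forall>\<^sub>F s in nhds t. \<eta> s = \<gamma> s \<and> velocity A \<eta> s = velocity A \<gamma> s"
proof -
  interpret e1: causal_curve A L a b \<eta> by unfold_locales (rule g1)
  interpret e2: causal_curve A L a' b' \<gamma> by unfold_locales (rule g2)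
  obtain c where c: "c \<in> A" "t \<in> e1.D c" using e1.D_exists[OF t(1)] by blast
  then have c2: "t \<in> e2.D c" using eq(1) t(2) by (simp add: e1.D_def e2.D_def)
  interpret l: local_finsler "lr c" "chart_img c" by (rule local_finsler_chart[OF c(1)])
  have "velocity A \<eta> t c \<noteq> 0"
    using tangent_eqI[OF e1.velocity_tangent[OF t(1)] tangent_space_zero c(1) e1.D_dom[OF c(2)]] nonzero by blast
  then have zW: "e1.z c t \<in> l.W"
    using imageI[OF e1.D_dom[OF c(2)], of "chart_map c"] by (simp add: e1.z_def l.W_def)
  define J where "J = e1.D c \<inter> e2.D c"
  have J: "open J" "t \<in> J" using e1.open_D[OF c(1)] e2.open_D[OF c(1)] c(2) c2 by (auto simp: J_def)
  have "\<forall>\<^sub>F s in nhds t. e1.z c s = e2.z c s"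
  proof (rule autonomous_ode_unique[where F = "\<lambda>z. (snd z, - 2 *\<^sub>R l.G z)" and S = l.W and J = J])
    show "Cinf l.W (\<lambda>z. (snd z, - 2 *\<^sub>R l.G z))"
      by (rule l.smooth_spray_field[OF order_refl l.open_W])
    show "e1.z c t = e2.z c t" using eq by (simp add: e1.z_def e2.z_def)
    show "e1.z c t \<in> l.W" by (rule zW)
    show "(e1.z c has_vector_derivative (snd (e1.z c s), - 2 *\<^sub>R l.G (e1.z c s))) (at s)"
      "(e2.z c has_vector_derivative (snd (e2.z c s), - 2 *\<^sub>R l.G (e2.z c s))) (at s)" if "s \<in> J" for s
      using e1.z_derivative_spray[OF c(1)] e2.z_derivative_spray[OF c(1)] that by (simp_all add: J_def)
  qed (fact J)+
  then show ?thesis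
    using eventually_nhds_in_open[OF J]
  proof eventually_elim
    case (elim s)
    then have s: "s \<in> e1.D c" "s \<in> e2.D c" by (simp_all add: J_def)
    have m: "chart_map c (\<eta> s) = chart_map c (\<gamma> s)" and v: "velocity A \<eta> s c = velocity A \<gamma> s c"
      using elim(1) by (simp_all add: e1.z_def e2.z_def)
    have "\<eta> s = chart_inv c (chart_map c (\<eta> s))" by (rule chart_inv_map[OF c(1) e1.D_dom[OF s(1)], symmetric])
    also have "\<dots> = \<gamma> s" unfolding m by (rule chart_inv_map[OF c(1) e2.D_dom[OF s(2)]])
    finally have p: "\<eta> s = \<gamma> s" .
    have "velocity A \<eta> s \<in> tangent_space A (\<gamma> s)"
      using e1.velocity_tangent[OF e1.D_I[OF s(1)]] unfolding p .
    from tangent_eqI[OF this e2.velocity_tangent[OF e2.D_I[OF s(2)]] c(1) e2.D_dom[OF s(2)] v] p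
    show ?case by blast
  qed
qed

context geodesic
begin

text \<open>The translate of \<eta> shows that the choice in \<open>geodesic_from\<close> has a
  candidate, and uniqueness makes whatever is chosen agree with it near 0. A germ suffices, because
  the weighted curvature uses derivatives at 0 only.\<close>

lemma geodesic_from_germ:
  assumes t: "t \<in> I"
  shows "\<forall>\<^sub>F s in nhds 0. psi_along A \<psi> (geodesic_from A L (\<eta> t) (vel t)) s = psi_along A \<psi> \<eta> (s + t)"
proof -
  obtain e where e: "e > 0" "ball t e \<subseteq> I" using t by (rule openE[OF open_einterval])
  have e': "{t - e<..<t + e} \<subseteq> I" using e(2) by (simp add: ball_eq_greaterThanLessThan)
  define \<eta>' where "\<eta>' s = \<eta> (s + t)" for s
  have g: "causal_geodesic A L (ereal (- e)) (ereal e) \<eta>'"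
    and v: "\<And>s. s \<in> {- e<..<e} \<Longrightarrow> velocity A \<eta>' s = vel (s + t)"
    unfolding \<eta>'_def by (rule causal_geodesic_translate[OF e(1) e'], assumption?)+
  have v0: "velocity A \<eta>' 0 = vel t" using v[of 0] e(1) by simp
  define \<gamma> where "\<gamma> = geodesic_from A L (\<eta> t) (vel t)"
  have "\<exists>\<eta>0 a b. a < 0 \<and> 0 < b \<and> causal_geodesic A L a b \<eta>0 \<and> \<eta>0 0 = \<eta> t \<and> velocity A \<eta>0 0 = vel t"
    by (rule exI[of _ \<eta>'], rule exI[of _ "ereal (- e)"], rule exI[of _ "ereal e"])
      (use e(1) g v0 in \<open>simp add: \<eta>'_def\<close>)
  then have "\<exists>a b. a < 0 \<and> 0 < b \<and> causal_geodesic A L a b \<gamma> \<and> \<gamma> 0 = \<eta> t \<and> velocity A \<gamma> 0 = vel t"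
    unfolding \<gamma>_def geodesic_from_def by (rule someI_ex)
  then obtain a' b' where \<gamma>: "a' < 0" "0 < b'" "causal_geodesic A L a' b' \<gamma>" "\<gamma> 0 = \<eta> t" "velocity A \<gamma> 0 = vel t"
    by blast
  have "vel t \<noteq> (\<lambda>_. 0)" using L_velocity[OF t] L_zero by auto
  then have "\<forall>\<^sub>F s in nhds 0. \<eta>' s = \<gamma> s \<and> velocity A \<eta>' s = velocity A \<gamma> s"
    by (intro causal_geodesic_unique[OF g \<gamma>(3)])
      (use \<gamma> v0 e(1) in \<open>simp_all add: \<eta>'_def einterval_def zero_ereal_def[symmetric]\<close>)
  moreover have "\<forall>\<^sub>F s in nhds 0. s \<in> {- e<..<e}"
    by (rule eventually_nhds_in_open) (use e(1) in auto)
  ultimately show ?thesis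
  proof eventually_elim
    case (elim s)
    then show ?case using v[of s] by (simp add: psi_along_def \<gamma>_def[symmetric]) (simp add: \<eta>'_def)
  qed
qed

text \<open>The weight is smooth on a set with boundary, through local smooth extensions f. The
  lifted geodesic stays in that set, so \<psi> along it is the composition of f with the lift, and
  its derivatives are iterated \<open>SS\<close> of f.\<close>

lemma psi_along_derivative:
  assumes w: "weight A L X \<psi>" and fut: "\<And>t. t \<in> I \<Longrightarrow> vel t \<in> future_cone A L X (\<eta> t)"
    and t: "t \<in> I"
  shows "(psi_along A \<psi> \<eta> has_real_derivative deriv (psi_along A \<psi> \<eta>) t) (at t)"
    and "(deriv (psi_along A \<psi> \<eta>) has_real_derivative deriv (deriv (psi_along A \<psi> \<eta>)) t) (at t)"
proof -
  obtain c where c: "c \<in> A" "t \<in> D c" using D_exists[OF t] by blast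
  interpret l: local_finsler "lr c" "chart_img c" by (rule local_finsler_chart[OF c(1)])
  define S where "S = {(y, u). y \<in> chart_img c \<and> tangent_vec A c (chart_inv c y) u \<in>
        closure (future_cone A L X (chart_inv c y)) - {\<lambda>_. 0}}"
  have zS: "z c s \<in> S" if s: "s \<in> D c" for s
  proof -
    have "tangent_vec A c (\<eta> s) (vel s c) = vel s"
      by (rule tangent_vec_of[OF velocity_tangent[OF D_I[OF s]] c(1) D_dom[OF s]])
    moreover have "vel s \<in> closure (future_cone A L X (\<eta> s))" using fut[OF D_I[OF s]] closure_subset by blast
    moreover have "vel s \<noteq> (\<lambda>_. 0)" using L_velocity[OF D_I[OF s]] L_zero by auto
    ultimately show ?thesis
      using D_dom[OF s] by (simp add: S_def z_def chart_inv_map[OF c(1) D_dom[OF s]])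
  qed
  have "smooth_on S (local_rep A \<psi> c)" using w c(1) unfolding weight_def S_def by blast
  then obtain W' f where W': "open W'" "z c t \<in> W'" "\<forall>k. Ck_on k W' f" "\<forall>y\<in>S \<inter> W'. local_rep A \<psi> c y = f y"
    using zS[OF c(2)] unfolding smooth_on_def by meson
  \<comment> \<open>Inside \<open>l.W\<close> the spray is smooth, so \<open>SS f\<close> is smooth
    again and a second derivative can be taken.\<close>
  define V where "V = W' \<inter> l.W"
  have V: "open V" "V \<subseteq> l.W" using W'(1) l.open_W by (auto simp: V_def)
  have f: "Cinf V f" using Cinf_subset[of W' f V] W' V(1) by (simp add: Cinf_def V_def)
  have "continuous_on (D c) (z c)"
    using has_vector_derivative_continuous[OF z_derivative[OF c(1)]]
    by (intro continuous_at_imp_continuous_on) blast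
  then have "open (D c \<inter> z c -` V)"
    by (rule continuous_open_preimage[OF _ open_D[OF c(1)] V(1)])
  moreover define T where "T = D c \<inter> z c -` V"
  ultimately have T: "open T" "t \<in> T" using c(2) W'(2) z_W[OF c] by (auto simp: V_def)
  have TV: "z c s \<in> V" "s \<in> D c" if "s \<in> T" for s using that by (auto simp: T_def)
  have eq: "psi_along A \<psi> \<eta> s = f (z c s)" if s: "s \<in> T" for s
  proof -
    have "psi_along A \<psi> \<eta> s = local_rep A \<psi> c (z c s)"
      unfolding psi_along_def z_def
      by (rule local_rep_chart[OF velocity_tangent[OF D_I[OF TV(2)[OF s]]] c(1) D_dom[OF TV(2)[OF s]], symmetric])
    then show ?thesis using W'(4) zS[OF TV(2)[OF s]] TV(1)[OF s] by (simp add: V_def)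
  qed
  have der: "((\<lambda>s. h (z c s)) has_real_derivative l.SS h (z c s)) (at s)" if h: "Cinf V h" and s: "s \<in> T" for h s
  proof -
    have "((\<lambda>s. h (z c s)) has_vector_derivative dd (snd (z c s), - 2 *\<^sub>R l.G (z c s)) h (z c s)) (at s)"
      by (rule has_vector_derivative_comp[OF z_derivative_spray[OF c(1) TV(2)[OF s]] h TV(1)[OF s]])
    then show ?thesis by (simp add: has_real_derivative_iff_has_vector_derivative l.SS_def)
  qed
  have d1: "(psi_along A \<psi> \<eta> has_real_derivative l.SS f (z c s)) (at s)" if s: "s \<in> T" for s
    by (rule has_field_derivative_transform_within_open[OF der[OF f s] T(1) s]) (simp add: eq)
  have d1': "deriv (psi_along A \<psi> \<eta>) s = l.SS f (z c s)" if "s \<in> T" for s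
    by (rule DERIV_imp_deriv[OF d1[OF that]])
  have d2: "(deriv (psi_along A \<psi> \<eta>) has_real_derivative l.SS (l.SS f) (z c t)) (at t)"
    by (rule has_field_derivative_transform_within_open[OF der[OF l.smooth_SS[OF f V(2)] T(2)] T])
      (simp add: d1')
  show "(psi_along A \<psi> \<eta> has_real_derivative deriv (psi_along A \<psi> \<eta>) t) (at t)"
    using d1[OF T(2)] d1'[OF T(2)] by simp
  show "(deriv (psi_along A \<psi> \<eta>) has_real_derivative deriv (deriv (psi_along A \<psi> \<eta>)) t) (at t)"
    using d2 DERIV_imp_deriv[OF d2] by simp
qed

lemma psi_along_geodesic_from:
  assumes w: "weight A L X \<psi>" and fut: "\<And>t. t \<in> I \<Longrightarrow> vel t \<in> future_cone A L X (\<eta> t)"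
    and t: "t \<in> I"
  shows "deriv (psi_along A \<psi> (geodesic_from A L (\<eta> t) (vel t))) 0 = deriv (psi_along A \<psi> \<eta>) t"
    and "deriv (deriv (psi_along A \<psi> (geodesic_from A L (\<eta> t) (vel t)))) 0 = deriv (deriv (psi_along A \<psi> \<eta>)) t"
proof -
  let ?q = "psi_along A \<psi> \<eta>"
  define p where "p = psi_along A \<psi> (geodesic_from A L (\<eta> t) (vel t))"
  have "\<forall>\<^sub>F s in nhds 0. p s = ?q (s + t)" unfolding p_def by (rule geodesic_from_germ[OF t])
  then obtain S where S: "open S" "0 \<in> S" "\<forall>s\<in>S. p s = ?q (s + t)"
    unfolding eventually_nhds by blast
  define T where "T = S \<inter> {s. s + t \<in> I}"
  have T: "open T" "0 \<in> T" using S open_translate[OF open_einterval[of a b], of t] t by (auto simp: T_def)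
  have d1: "deriv p s = deriv ?q (s + t)" if s: "s \<in> T" for s
  proof (rule DERIV_imp_deriv)
    have "(?q has_real_derivative deriv ?q (s + t)) (at (s + t))"
      by (rule psi_along_derivative(1)[OF w fut]) (use s in \<open>simp_all add: T_def\<close>)
    then have "((\<lambda>s. ?q (s + t)) has_real_derivative deriv ?q (s + t)) (at s)" by (simp add: DERIV_shift)
    then show "(p has_real_derivative deriv ?q (s + t)) (at s)"
      by (rule has_field_derivative_transform_within_open[OF _ T(1) s]) (use S(3) in \<open>simp add: T_def\<close>)
  qed
  show "deriv (psi_along A \<psi> (geodesic_from A L (\<eta> t) (vel t))) 0 = deriv ?q t"
    using d1[OF T(2)] by (simp add: p_def)
  show "deriv (deriv (psi_along A \<psi> (geodesic_from A L (\<eta> t) (vel t)))) 0 = deriv (deriv ?q) t"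
    unfolding p_def[symmetric]
  proof (rule DERIV_imp_deriv)
    have "((\<lambda>s. deriv ?q (s + t)) has_real_derivative deriv (deriv ?q) t) (at 0)"
      using psi_along_derivative(2)[OF w fut t] DERIV_shift[of "deriv ?q" "deriv (deriv ?q) t" 0 t] by simp
    then show "(deriv p has_real_derivative deriv (deriv ?q) t) (at 0)"
      by (rule has_field_derivative_transform_within_open[OF _ T]) (simp add: d1)
  qed
qed

end

section \<open>The ends of the parameter interval and the parameter \<tau>\<close>

lemma eventually_at_left_einterval:
  assumes "eventually P (at_left (b :: ereal))" "t \<in> einterval a b"
  shows "\<exists>r\<in>einterval a b. t < r \<and> P (ereal r)"
proof -
  have tb: "ereal t < b" "a < ereal t" using assms(2) by (simp_all add: einterval_def)
  obtain b0 where b0: "b0 < b" "\<forall>y>b0. y < b \<longrightarrow> P y"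
    using assms(1) eventually_at_left[OF tb(1)] by blast
  have "max b0 (ereal t) < b" using b0 tb by simp
  then obtain r where r: "max b0 (ereal t) < ereal r" "ereal r < b" using ereal_dense2 by blast
  then show ?thesis using b0(2) tb(2) by (intro bexI[of _ r]) (auto simp: einterval_def intro: less_trans)
qed

lemma eventually_at_right_einterval:
  assumes "eventually P (at_right (a :: ereal))" "t \<in> einterval a b"
  shows "\<exists>r\<in>einterval a b. r < t \<and> P (ereal r)"
proof -
  have ta: "a < ereal t" "ereal t < b" using assms(2) by (simp_all add: einterval_def)
  obtain b0 where b0: "a < b0" "\<forall>y>a. y < b0 \<longrightarrow> P y"
    using assms(1) eventually_at_right[OF ta(1)] by blast
  have "a < min b0 (ereal t)" using b0 ta by simp
  then obtain r where r: "a < ereal r" "ereal r < min b0 (ereal t)" using ereal_dense2 by blast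
  then show ?thesis using b0(2) ta(2) by (intro bexI[of _ r]) (auto simp: einterval_def intro: less_trans[of "ereal r" "ereal t" b])
qed

lemma tau_derivative:
  assumes cont: "continuous_on (einterval a b) (psi_along A \<psi> \<eta>)"
    and t0: "t0 \<in> einterval a b" and t: "t \<in> einterval a b"
  shows "(tau A \<psi> n \<epsilon> \<eta> t0 has_real_derivative exp (2 * (\<epsilon> - 1) / real n * psi_along A \<psi> \<eta> t)) (at t)"
proof -
  obtain p q where pq: "p \<in> einterval a b" "q \<in> einterval a b" "p < t0" "t0 < q" "p < t" "t < q"
    by (rule einterval_extend[OF t0 t])
  let ?f = "\<lambda>s. exp (2 * (\<epsilon> - 1) / real n * psi_along A \<psi> \<eta> s)"
  have "continuous_on {p..q} ?f"
    by (intro continuous_intros continuous_on_subset[OF cont einterval_Icc[OF pq(1,2)]])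
  then have "((\<lambda>u. LBINT y=t0..u. ?f y) has_vector_derivative ?f t) (at t within {p..q})"
    by (intro interval_integral_FTC2) (use pq in auto)
  then show ?thesis
    using pq by (simp add: at_within_Icc_at tau_def[abs_def] has_real_derivative_iff_has_vector_derivative)
qed

text \<open>For \<open>N = n\<close> the convergence condition forces \<open>p1 = 0\<close>, so that \<open>\<kappa>\<close> is arbitrary.\<close>

lemma eps_range_constant:
  assumes N: "-\<infinity> < N \<and> N < 0 \<or> ereal (real n) \<le> N" and \<epsilon>: "\<epsilon> \<in> eps_range n N" and n: "n \<ge> 1"
  shows "\<exists>\<kappa>. \<epsilon>\<^sup>2 < \<kappa> \<and> (\<forall>R p1 p2. 0 \<le> (if N = \<infinity> then ereal (R + p2)
       else if N = ereal (real n) then (if p1 = 0 then ereal (R + p2) else -\<infinity>)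
       else ereal (R + p2 - p1\<^sup>2 / (real_of_ereal N - real n))) \<longrightarrow> R \<ge> - p2 + (\<kappa> - 1) / n * p1\<^sup>2)"
proof -
  consider "N = \<infinity>" | "N = ereal (real n)" | N' where "N = ereal N'" "N' \<noteq> real n"
    using N by (cases N) auto
  then show ?thesis
  proof cases
    case 1
    then have "\<epsilon>\<^sup>2 < 1" using \<epsilon> by (simp add: eps_range_def abs_square_less_1)
    then show ?thesis using 1 by (intro exI[of _ 1]) auto
  next
    case 2
    then show ?thesis by (intro exI[of _ "\<epsilon>\<^sup>2 + 1"]) (auto simp: zero_ereal_def)
  next
    case 3
    define \<kappa> where "\<kappa> = N' / (N' - real n)"
    have "\<bar>\<epsilon>\<bar> < sqrt \<kappa>" using \<epsilon> 3 by (simp add: eps_range_def \<kappa>_def)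
    then have "sqrt (\<epsilon>\<^sup>2) < sqrt \<kappa>" by (simp only: real_sqrt_abs)
    then have "\<epsilon>\<^sup>2 < \<kappa>" by (simp only: real_sqrt_less_iff)
    moreover have "(\<kappa> - 1) / n = 1 / (N' - real n)" using 3 n by (simp add: \<kappa>_def field_simps)
    ultimately show ?thesis using 3 by (intro exI[of _ \<kappa>]) auto
  qed
qed

theorem theorem7p11:
  fixes A :: "('m::{t2_space, second_countable_topology}, 'n::finite) chart set"
    and L :: "'m \<Rightarrow> ('m, 'n) tvec \<Rightarrow> real"
    and X :: "'m \<Rightarrow> ('m, 'n) tvec"
    and \<psi> :: "'m \<Rightarrow> ('m, 'n) tvec \<Rightarrow> real"
    and n :: nat and N :: ereal
  assumes "CARD('n) = n + 1" and "n + 1 \<ge> 2"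
    and "finsler_spacetime A L X" and "weight A L X \<psi>"
    and "-\<infinity> < N \<and> N < 0 \<or> ereal (real n) \<le> N"
    and "timelike_genericity A L"
    and "timelike_convergence A L X \<psi> n N"
  shows "\<forall>a b \<eta>. timelike_geodesic A L a b \<eta> \<and> inextendible a b \<eta> \<and>
           (\<forall>t\<in>einterval a b. future_directed A L X (\<eta> t) (velocity A \<eta> t)) \<longrightarrow>
         has_conjugate_points A L a b \<eta> \<or>
         (\<forall>\<epsilon>\<in>eps_range n N. eps_incomplete A \<psi> n \<epsilon> a b \<eta>)"
proof (intro allI impI, elim conjE)
  fix a b \<eta>
  assume geod: "timelike_geodesic A L a b \<eta>" and inext: "inextendible a b \<eta>"
    and future: "\<forall>t\<in>einterval a b. future_directed A L X (\<eta> t) (velocity A \<eta> t)"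
  have n: "n \<ge> 1" using assms(2) by simp
  have causal: "causal_geodesic A L a b \<eta>" using geod unfolding timelike_geodesic_def by blast
  interpret geodesic A L a b \<eta>
  proof (intro geodesic.intro causal_curve.intro spacetime.intro atlas.intro
      spacetime_axioms.intro causal_curve_axioms.intro geodesic_axioms.intro)
    show "smooth_atlas A" "lorentz_finsler A L" using assms(3) unfolding finsler_spacetime_def by blast+
  qed (fact causal geod)+
  obtain E i0 where E: "\<forall>t\<in>I. \<forall>j. par (E j) t" "\<forall>t\<in>I. E i0 t = vel t"
    "\<forall>c\<in>A. \<forall>t\<in>D c. \<forall>i j. gg c (E i t c) (E j t c) (z c t) = minkowski i0 $ i $ (j :: 'n)"
    using frame_exists by blast
  interpret framed_geodesic A L a b \<eta> E i0
    by (unfold_locales) (use E in blast)+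
  interpret jacobi_system a b Rf i0 by (rule jacobi_system)
  have fut: "vel t \<in> future_cone A L X (\<eta> t)" if "t \<in> I" for t
    using future geod that unfolding future_cone_def timelike_geodesic_def by blast
  let ?\<psi> = "psi_along A \<psi> \<eta>"
  show "has_conjugate_points A L a b \<eta> \<or> (\<forall>\<epsilon>\<in>eps_range n N. eps_incomplete A \<psi> n \<epsilon> a b \<eta>)"
  proof (rule ccontr)
    assume "\<not> ?thesis"
    then obtain \<epsilon> where nc: "\<not> has_conjugate_points A L a b \<eta>" and \<epsilon>: "\<epsilon> \<in> eps_range n N"
      and complete: "future_complete A \<psi> n \<epsilon> a b \<eta>" "past_complete A \<psi> n \<epsilon> a b \<eta>"
      unfolding eps_incomplete_def by blast
    obtain \<kappa> where \<kappa>: "\<epsilon>\<^sup>2 < \<kappa>" and ric: "\<forall>R p1 p2. 0 \<le> (if N = \<infinity> then ereal (R + p2)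
       else if N = ereal (real n) then (if p1 = 0 then ereal (R + p2) else -\<infinity>)
       else ereal (R + p2 - p1\<^sup>2 / (real_of_ereal N - real n))) \<longrightarrow> R \<ge> - p2 + (\<kappa> - 1) / n * p1\<^sup>2"
      using eps_range_constant[OF assms(5) \<epsilon> n] by blast
    have "a < b" using causal unfolding causal_geodesic_def by blast
    then obtain t0 where t0: "t0 \<in> I" using einterval_nonempty by blast
    note \<psi> = psi_along_derivative[OF assms(4) fut]
    have "continuous_on I ?\<psi>"
      using DERIV_isCont[OF \<psi>(1)] by (intro continuous_at_imp_continuous_on) blast
    \<comment> \<open>Completeness quantifies over all normalisations of \<tau>, so a single base
      point t0 serves both ends.\<close>
    note \<tau> = tau_derivative[OF this t0, of _ n \<epsilon>]
    have top: "\<exists>r\<in>I. t < r \<and> tau A \<psi> n \<epsilon> \<eta> t0 r > c" if t: "t \<in> I" for c t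
    proof -
      have "filterlim (tau A \<psi> n \<epsilon> \<eta> t0 \<circ> real_of_ereal) at_top (at_left b)"
        using complete(1) t0 unfolding future_complete_def by blast
      then have "\<forall>\<^sub>F x in at_left b. c < (tau A \<psi> n \<epsilon> \<eta> t0 \<circ> real_of_ereal) x"
        unfolding filterlim_at_top_dense by blast
      from eventually_at_left_einterval[OF this t] show ?thesis by simp
    qed
    have bot: "\<exists>r\<in>I. r < t \<and> tau A \<psi> n \<epsilon> \<eta> t0 r < c" if t: "t \<in> I" for c t
    proof -
      have "filterlim (tau A \<psi> n \<epsilon> \<eta> t0 \<circ> real_of_ereal) at_bot (at_right a)"
        using complete(2) t0 unfolding past_complete_def by blast
      then have "\<forall>\<^sub>F x in at_right a. (tau A \<psi> n \<epsilon> \<eta> t0 \<circ> real_of_ereal) x < c"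
        unfolding filterlim_at_bot_dense by blast
      from eventually_at_right_einterval[OF this t] show ?thesis by simp
    qed
    \<comment> \<open>The convergence condition speaks of \<psi> along \<open>geodesic_from\<close>;
      its derivatives at 0 are those of \<psi> along \<eta> at t, so it becomes an inequality
      between functions of t.\<close>
    have ric': "trace (Rf t) \<ge> - deriv (deriv ?\<psi>) t + (\<kappa> - 1) / n * (deriv ?\<psi> t)\<^sup>2" if t: "t \<in> I" for t
    proof -
      have "0 \<le> Ric_weighted A L \<psi> n N (\<eta> t) (vel t)"
        using assms(7) fut[OF t] unfolding timelike_convergence_def by blast
      moreover have "deriv (psi_along A \<psi> (geodesic_from A L (\<eta> t) (vel t))) 0 = deriv ?\<psi> t"
        "deriv (deriv (psi_along A \<psi> (geodesic_from A L (\<eta> t) (vel t)))) 0 = deriv (deriv ?\<psi>) t"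
        by (rule psi_along_geodesic_from[OF assms(4) _ t], rule fut, assumption)+
      ultimately show ?thesis
        unfolding Ric_weighted_def Let_def trace_Rf[OF t, symmetric] by (simp only: ric)
    qed
    have flat: "Rf t = 0" if t: "t \<in> I" for t
    proof (rule rigidity[where \<tau> = "tau A \<psi> n \<epsilon> \<eta> t0"])
      show "\<forall>r\<in>I. y r = 0"
        if "\<And>r. r \<in> I \<Longrightarrow> (y has_vector_derivative y1 r) (at r)"
          "\<And>r. r \<in> I \<Longrightarrow> (y1 has_vector_derivative - (Rf r *v y r)) (at r)"
          "s \<in> I" "y s = 0" "t \<in> I" "s < t" "y t = 0" for y y1 s t
        by (rule no_conjugate_points[OF nc that])
    qed (assumption | rule assms(1) n \<psi> ric' \<kappa> \<tau> top bot t)+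
    \<comment> \<open>The whole matrix \<open>Rf\<close> vanishes, hence \<open>R_op\<close>
      vanishes on every tangent vector and in particular on the normal one supplied by
      genericity.\<close>
    obtain t1 w where t1: "t1 \<in> I" and "w \<in> normal_space A L \<eta> t1"
      and nz: "R_op A L (\<eta> t1) (vel t1) w \<noteq> (\<lambda>_. 0)"
      using assms(6) geod inext unfolding timelike_genericity_def by blast
    then have "w \<in> tangent_space A (\<eta> t1)" unfolding normal_space_def by blast
    from R_op_eq_0[OF t1 flat[OF t1] this] nz show False by blast
  qed
qed

end
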